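(* Let $(A,\alpha)$ be a unital C*-dynamical system of multiplicity $d$ and let $\beta>\log d$. Then there is an affine weak*-homeomorphism $\tau\mapsto\varphi_\tau$ from the simplex of the tracial states on $A$ that vanish on $J_{(A,\alpha)}=(\bigcap_{i=1}^d\ker\alpha_i)^\perp$ onto the simplex of the $(\sigma,\beta)$-KMS states on $\mathcal{O}(A,\alpha)$ such that $$\varphi_\tau(S_\mu a S_\nu^* ) = \delta_{\mu,\nu}\cdot(1-e^{-\beta}d)\cdot\sum_{m=0}^\infty e^{-(m+|\mu|)\beta}\sum_{|w|=m}\tau\alpha_{\overline{w}}(a)$$ for all $a\in A$ and $\mu,\nu\in\mathbb{F}_+^d$.
   Context: A unital C*-dynamical system $(A,\alpha)$ of multiplicity $d$ (with $1 \le d < \infty$) consists of a unital C*-algebra $A$ and $d$ unital $*$-endomorphisms $\alpha_1,\dots,\alpha_d$ of $A$. $\mathbb{F}_+^d$ is the free semigroup (monoid) of words on $d$ symbols, with empty word $\emptyset$; $|\mu|$ is the length of $\mu$. For $w=i_m\cdots i_1$ write $\alpha_w=\alpha_{i_m}\circ\cdots\circ\alpha_{i_1}$ (and $\alpha_\emptyset=\mathrm{id}$), and $\overline{w}=i_1\cdots i_m$ for the reversed word. For an ideal $I$ of $A$, $I^\perp=\{a\in A: ab=0\text{ for all }b\in I\}$, and $J_{(A,\alpha)}:=(\bigcap_{i=1}^d\ker\alpha_i)^\perp$. $\mathcal{O}(A,\alpha)$ (the Cuntz-Pimsner algebra) is the universal C*-algebra generated by $A$ and elements $S_1,\dots,S_d$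 such that $[S_1,\dots,S_d]$ is a row isometry ($S_i^*S_j=\delta_{i,j}1$), $aS_i=S_i\alpha_i(a)$ for all $a\in A$, $i=1,\dots,d$, and $a(1-\sum_{i=1}^dS_iS_i^* )=0$ for all $a\in J_{(A,\alpha)}$. The algebra $A$ embeds in it isometrically and the unit of $A$ is its unit. For $\mu=\mu_n\cdots\mu_1$ write $S_\mu=S_{\mu_n}\cdots S_{\mu_1}$, with $S_\emptyset=1$. The gauge action satisfies $\gamma_z(a)=a$, $\gamma_z(S_i)=zS_i$ for $z\in\mathbb{T}$, and $\sigma:\mathbb{R}\to\mathrm{Aut}(\mathcal{O}(A,\alpha))$ is $\sigma_t=\gamma_{e^{it}}$. For $\beta\in\mathbb{R}$, a state $\psi$ on a C*-algebra $B$ with an action $\sigma$ of $\mathbb{R}$ is a $(\sigma,\beta)$-KMS state if $\psi(xy)=\psi(y\sigma_{i\beta}(x))$ for all $x,y$ in a norm-dense $\sigma$-invariant $*$-subalgebra of the analytic elements of $B$ (elements $x$ for which $t\mapsto\sigma_t(x)$ extends to an entire function $z\mapsto\sigma_z(x)$). *)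

theory Defs
  imports "HOL-Analysis.Analysis" "HOL-Library.Poly_Mapping"
begin

section \<open>Unital C*-algebras\<close>

text \<open>
  The norm is complete (\<^class>\<open>banach\<close>) and submultiplicative with \<open>norm 1 = 1\<close>
  (\<^class>\<open>real_normed_algebra_1\<close>); in particular the algebras are nonzero.
\<close>

class cstar_algebra = real_normed_algebra_1 + banach +
  fixes scaleC :: "complex \<Rightarrow> 'a \<Rightarrow> 'a"  (infixr \<open>*\<^sub>C\<close> 75)
    and star :: "'a \<Rightarrow> 'a"
  assumes scaleC_add_right: "c *\<^sub>C (x + y) = c *\<^sub>C x + c *\<^sub>C y"
    and scaleC_add_left: "(c + d) *\<^sub>C x = c *\<^sub>C x + d *\<^sub>C x"
    and scaleC_scaleC: "c *\<^sub>C d *\<^sub>C x = (c * d) *\<^sub>C x"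
    and scaleC_of_real: "complex_of_real r *\<^sub>C x = r *\<^sub>R x"
    and norm_scaleC: "norm (c *\<^sub>C x) = cmod c * norm x"
    and mult_scaleC_left: "(c *\<^sub>C x) * y = c *\<^sub>C (x * y)"
    and mult_scaleC_right: "x * (c *\<^sub>C y) = c *\<^sub>C (x * y)"
    and star_add: "star (x + y) = star x + star y"
    and star_scaleC: "star (c *\<^sub>C x) = cnj c *\<^sub>C star x"
    and star_mult: "star (x * y) = star y * star x"
    and star_star: "star (star x) = x"
    and norm_star_mult: "norm (star x * x) = (norm x)\<^sup>2"

definition unital_star_hom :: "('a::cstar_algebra \<Rightarrow> 'b::cstar_algebra) \<Rightarrow> bool" where
  "unital_star_hom f \<longleftrightarrow>
     (\<forall>x y. f (x + y) = f x + f y) \<and> (\<forall>c x. f (c *\<^sub>C x) = c *\<^sub>C f x) \<and>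
     (\<forall>x y. f (x * y) = f x * f y) \<and> (\<forall>x. f (star x) = star (f x)) \<and> f 1 = 1"

definition star_automorphism :: "('a::cstar_algebra \<Rightarrow> 'a) \<Rightarrow> bool" where
  "star_automorphism f \<longleftrightarrow> unital_star_hom f \<and> bij f"

definition star_subalgebra :: "'a::cstar_algebra set \<Rightarrow> bool" where
  "star_subalgebra D \<longleftrightarrow> 0 \<in> D \<and> (\<forall>x\<in>D. \<forall>y\<in>D. x + y \<in> D \<and> x * y \<in> D) \<and>
     (\<forall>x\<in>D. star x \<in> D \<and> (\<forall>c. c *\<^sub>C x \<in> D))"

definition is_state :: "('a::cstar_algebra \<Rightarrow> complex) \<Rightarrow> bool" where
  "is_state \<phi> \<longleftrightarrow>
     (\<forall>x y. \<phi> (x + y) = \<phi> x + \<phi> y) \<and> (\<forall>c x. \<phi> (c *\<^sub>C x) = c * \<phi> x) \<and>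
     (\<forall>x. \<phi> (star x * x) \<in> \<real>\<^sub>\<ge>\<^sub>0) \<and> \<phi> 1 = 1"

definition is_tracial_state :: "('a::cstar_algebra \<Rightarrow> complex) \<Rightarrow> bool" where
  "is_tracial_state \<phi> \<longleftrightarrow> is_state \<phi> \<and> (\<forall>x y. \<phi> (x * y) = \<phi> (y * x))"

section \<open>KMS states\<close>

text \<open>
  \<open>F\<close> is an entire extension of \<open>t \<mapsto> \<sigma> t x\<close>. Entire means complex differentiable
  everywhere as a Banach space valued map: the real derivative is \<open>h \<mapsto> h *\<^sub>C D\<close>.
  Such an extension is unique when it exists, and its value at \<open>z\<close> is written
  \<open>\<sigma>\<^sub>z(x)\<close> in the literature.
\<close>

definition entire_extension ::
  "(real \<Rightarrow> 'b \<Rightarrow> 'b) \<Rightarrow> 'b::cstar_algebra \<Rightarrow> (complex \<Rightarrow> 'b) \<Rightarrow> bool" where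
  "entire_extension \<sigma> x F \<longleftrightarrow>
     (\<forall>z. \<exists>D. (F has_derivative (\<lambda>h. h *\<^sub>C D)) (at z)) \<and>
     (\<forall>t. F (complex_of_real t) = \<sigma> t x)"

definition KMS_state ::
  "(real \<Rightarrow> 'b \<Rightarrow> 'b) \<Rightarrow> real \<Rightarrow> ('b::cstar_algebra \<Rightarrow> complex) \<Rightarrow> bool" where
  "KMS_state \<sigma> \<beta> \<psi> \<longleftrightarrow> is_state \<psi> \<and>
     (\<exists>D. star_subalgebra D \<and> closure D = UNIV \<and> (\<forall>t. \<sigma> t ` D \<subseteq> D) \<and>
        (\<forall>x\<in>D. \<exists>F. entire_extension \<sigma> x F \<and>
           (\<forall>y\<in>D. \<psi> (x * y) = \<psi> (y * F (\<i> * complex_of_real \<beta>)))))"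

section \<open>Universal C*-algebras given by generators and relations\<close>

text \<open>
  The free unital *-algebra on a set \<open>'g\<close> of generators is the algebra, with convolution
  product, of finitely supported functions on words in the letters \<open>(g, False)\<close>,
  standing for \<open>g\<close>, and \<open>(g, True)\<close>, standing for its adjoint. Words form a monoid under
  concatenation, which the product of \<^type>\<open>poly_mapping\<close> expects to be written
  additively.
\<close>

instantiation list :: (type) monoid_add
begin

definition zero_list :: "'a list" where "zero_list = []"
definition plus_list :: "'a list \<Rightarrow> 'a list \<Rightarrow> 'a list" where "plus_list = (@)"

instance by standard (simp_all add: zero_list_def plus_list_def)

end

type_synonym 'g free_star_algebra = "('g \<times> bool) list \<Rightarrow>\<^sub>0 complex"

definition free_gen :: "'g \<Rightarrow> 'g free_star_algebra" where
  "free_gen x = Poly_Mapping.single [(x, False)] 1"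

definition free_scale :: "complex \<Rightarrow> 'g free_star_algebra \<Rightarrow> 'g free_star_algebra" where
  "free_scale c p = Poly_Mapping.single [] c * p"

definition word_star :: "('g \<times> bool) list \<Rightarrow> ('g \<times> bool) list" where
  "word_star w = rev (map (\<lambda>(x, e). (x, \<not> e)) w)"

definition free_star :: "'g free_star_algebra \<Rightarrow> 'g free_star_algebra" where
  "free_star p =
     (\<Sum>w\<in>Poly_Mapping.keys p.
        Poly_Mapping.single (word_star w) (cnj (Poly_Mapping.lookup p w)))"

definition word_eval :: "('g \<Rightarrow> 'b::cstar_algebra) \<Rightarrow> ('g \<times> bool) list \<Rightarrow> 'b" where
  "word_eval h w = prod_list (map (\<lambda>(x, e). if e then star (h x) else h x) w)"

definition free_eval :: "('g \<Rightarrow> 'b::cstar_algebra) \<Rightarrow> 'g free_star_algebra \<Rightarrow> 'b" where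
  "free_eval h p = (\<Sum>w\<in>Poly_Mapping.keys p. Poly_Mapping.lookup p w *\<^sub>C word_eval h w)"

definition cstar_seminorm :: "('g free_star_algebra \<Rightarrow> real) \<Rightarrow> bool" where
  "cstar_seminorm p \<longleftrightarrow>
     (\<forall>x y. p (x + y) \<le> p x + p y) \<and> (\<forall>c x. p (free_scale c x) = cmod c * p x) \<and>
     (\<forall>x y. p (x * y) \<le> p x * p y) \<and> (\<forall>x. p (free_star x * x) = (p x)\<^sup>2)"

text \<open>
  The universal unital C*-algebra on generators \<open>'g\<close> subject to relations \<open>r = 0\<close>, \<open>r \<in> R\<close>,
  is the Hausdorff completion of the free *-algebra in its greatest C*-seminorm that
  vanishes on \<open>R\<close>. A type \<open>'b\<close> with elements \<open>h x\<close> is such an algebra iff the \<open>h x\<close>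
  satisfy the relations, generate a dense *-subalgebra, and the seminorm which \<open>'b\<close> induces
  is the greatest one. Quantifying over C*-seminorms replaces the quantification over all
  C*-algebras, hence over types, in the universal property; the latter is recovered in
  \<open>universal_cstar_algebra_lift\<close> below.
\<close>

definition universal_cstar_algebra ::
  "'g free_star_algebra set \<Rightarrow> ('g \<Rightarrow> 'b::cstar_algebra) \<Rightarrow> bool" where
  "universal_cstar_algebra R h \<longleftrightarrow>
     (\<forall>r\<in>R. free_eval h r = 0) \<and> closure (range (free_eval h)) = UNIV \<and>
     (\<forall>p. cstar_seminorm p \<longrightarrow> (\<forall>r\<in>R. p r = 0) \<longrightarrow> (\<forall>x. p x \<le> norm (free_eval h x)))"

section \<open>C*-dynamical systems and their Cuntz-Pimsner algebras\<close>

definition cstar_dynamical_system :: "('d::finite \<Rightarrow> 'a \<Rightarrow> 'a::cstar_algebra) \<Rightarrow> bool" where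
  "cstar_dynamical_system \<alpha> \<longleftrightarrow> (\<forall>i. unital_star_hom (\<alpha> i))"

definition annihilator :: "'a::cstar_algebra set \<Rightarrow> 'a set" where
  "annihilator I = {a. \<forall>b\<in>I. a * b = 0}"

definition covariance_ideal :: "('d::finite \<Rightarrow> 'a \<Rightarrow> 'a::cstar_algebra) \<Rightarrow> 'a set" where
  "covariance_ideal \<alpha> = annihilator (\<Inter>i. {a. \<alpha> i a = 0})"

text \<open>The generators are \<open>Inl a\<close> for \<open>a \<in> A\<close> and \<open>Inr i\<close> for \<open>S\<^sub>i\<close>. The first five families
  say that the generators from \<open>A\<close> form a unital *-homomorphic image of \<open>A\<close>.\<close>

definition cuntz_pimsner_relations ::
  "('d::finite \<Rightarrow> 'a \<Rightarrow> 'a::cstar_algebra) \<Rightarrow> ('a + 'd) free_star_algebra set" where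
  "cuntz_pimsner_relations \<alpha> =
    (let A = (\<lambda>a. free_gen (Inl a)); S = (\<lambda>i. free_gen (Inr i)) in
      {A (a + b) - (A a + A b) | a b. True} \<union>
      {A (c *\<^sub>C a) - free_scale c (A a) | c a. True} \<union>
      {A (a * b) - A a * A b | a b. True} \<union>
      {A (star a) - free_star (A a) | a. True} \<union>
      {A 1 - 1} \<union>
      {free_star (S i) * S j - (if i = j then 1 else 0) | i j. True} \<union>
      {A a * S i - S i * A (\<alpha> i a) | a i. True} \<union>
      {A a * (1 - (\<Sum>i\<in>UNIV. S i * free_star (S i))) | a. a \<in> covariance_ideal \<alpha>})"

definition cuntz_pimsner_algebra ::
  "('d::finite \<Rightarrow> 'a \<Rightarrow> 'a::cstar_algebra) \<Rightarrow> ('a \<Rightarrow> 'b) \<Rightarrow> ('d \<Rightarrow> 'b::cstar_algebra) \<Rightarrow> bool" where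
  "cuntz_pimsner_algebra \<alpha> \<iota> S \<longleftrightarrow>
     universal_cstar_algebra (cuntz_pimsner_relations \<alpha>) (case_sum \<iota> S)"

definition gauge_action ::
  "('a::cstar_algebra \<Rightarrow> 'b) \<Rightarrow> ('d \<Rightarrow> 'b::cstar_algebra) \<Rightarrow> (complex \<Rightarrow> 'b \<Rightarrow> 'b) \<Rightarrow> bool" where
  "gauge_action \<iota> S \<gamma> \<longleftrightarrow>
     (\<forall>z. cmod z = 1 \<longrightarrow> star_automorphism (\<gamma> z) \<and>
        (\<forall>a. \<gamma> z (\<iota> a) = \<iota> a) \<and> (\<forall>i. \<gamma> z (S i) = z *\<^sub>C S i))"

text \<open>The word \<open>i\<^sub>m \<cdots> i\<^sub>1\<close> is the list \<open>[i\<^sub>m, \<dots>, i\<^sub>1]\<close>.\<close>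

definition word_endo :: "('d \<Rightarrow> 'a \<Rightarrow> 'a) \<Rightarrow> 'd list \<Rightarrow> 'a \<Rightarrow> 'a" where
  "word_endo \<alpha> w = foldr \<alpha> w"

definition word_prod :: "('d \<Rightarrow> 'b::monoid_mult) \<Rightarrow> 'd list \<Rightarrow> 'b" where
  "word_prod S w = prod_list (map S w)"

definition vanishing_tracial_states ::
  "('d::finite \<Rightarrow> 'a \<Rightarrow> 'a::cstar_algebra) \<Rightarrow> ('a \<Rightarrow> complex) set" where
  "vanishing_tracial_states \<alpha> =
     {\<tau>. is_tracial_state \<tau> \<and> (\<forall>a\<in>covariance_ideal \<alpha>. \<tau> a = 0)}"

text \<open>
  The weak* topology on a set of functionals is the topology of pointwise convergence, i.e.
  the subspace topology of the product topology, which is the topology of the function type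
  in \<^theory>\<open>HOL-Analysis.Function_Topology\<close>.
\<close>

definition weak_star_topology :: "('a \<Rightarrow> complex) set \<Rightarrow> ('a \<Rightarrow> complex) topology" where
  "weak_star_topology K = top_of_set K"

definition affine_map_on ::
  "('a \<Rightarrow> complex) set \<Rightarrow> (('a \<Rightarrow> complex) \<Rightarrow> 'b \<Rightarrow> complex) \<Rightarrow> bool" where
  "affine_map_on K \<Phi> \<longleftrightarrow>
     (\<forall>f\<in>K. \<forall>g\<in>K. \<forall>s\<in>{0..1::real}.
        \<Phi> (\<lambda>x. of_real s * f x + of_real (1 - s) * g x) =
        (\<lambda>y. of_real s * \<Phi> f y + of_real (1 - s) * \<Phi> g y))"

section \<open>The universal property and the gauge action\<close>

lemma scaleC_zero_left [simp]: "0 *\<^sub>C (x::'a::cstar_algebra) = 0"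
  using scaleC_add_left [of 0 0 x] by simp

lemma scaleC_zero_right [simp]: "c *\<^sub>C (0::'a::cstar_algebra) = 0"
  using scaleC_add_right [of c 0 "0::'a"] by simp

lemma scaleC_one [simp]: "1 *\<^sub>C (x::'a::cstar_algebra) = x"
  using scaleC_of_real [of 1 x] by simp

lemma star_zero [simp]: "star (0::'a::cstar_algebra) = 0"
  using star_add [of 0 "0::'a"] by simp

lemma star_one [simp]: "star (1::'a::cstar_algebra) = 1"
  by (metis mult_1_left mult_1_right star_mult star_star)

lemma norm_star: "norm (star (x::'a::cstar_algebra)) = norm x"
proof -
  have le: "norm y \<le> norm (star y)" for y :: 'a
  proof (cases "norm y = 0")
    case False
    have "(norm y)\<^sup>2 \<le> norm (star y) * norm y"
      using norm_mult_ineq [of "star y" y] by (simp add: norm_star_mult)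
    with False show ?thesis by (simp add: power2_eq_square)
  qed simp
  show ?thesis using le [of x] le [of "star x"] by (simp add: star_star)
qed

lemma bounded_linear_scaleC: "bounded_linear (\<lambda>x. c *\<^sub>C (x::'a::cstar_algebra))"
  by (rule bounded_linear_intro [of _ "cmod c"])
     (simp_all add: scaleC_add_right norm_scaleC scaleC_scaleC mult.commute flip: scaleC_of_real)

lemma bounded_linear_star: "bounded_linear (star :: 'a \<Rightarrow> 'a::cstar_algebra)"
  by (rule bounded_linear_intro [of _ 1])
     (simp_all add: star_add norm_star star_scaleC flip: scaleC_of_real)

lemma word_eval_append: "word_eval h (v @ w) = word_eval h v * word_eval h w"
  by (simp add: word_eval_def)

lemma word_eval_star: "word_eval h (word_star w) = star (word_eval h w)"
  by (induction w) (auto simp: word_eval_def word_star_def star_mult star_star)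

lemma free_eval_add: "free_eval h (p + q) = free_eval h p + free_eval h q"
  unfolding free_eval_def
  by (rule setsum_keys_plus_distrib [of "\<lambda>w c. c *\<^sub>C word_eval h w"])
     (simp_all add: scaleC_add_left)

lemma free_eval_zero [simp]: "free_eval h 0 = 0"
  by (simp add: free_eval_def)

lemma free_eval_minus: "free_eval h (- p) = - free_eval h p"
  using free_eval_add [of h p "- p"] by (simp add: eq_neg_iff_add_eq_0 add.commute)

lemma free_eval_diff: "free_eval h (p - q) = free_eval h p - free_eval h q"
  using free_eval_add [of h p "- q"] by (simp add: free_eval_minus)

lemma free_eval_sum: "free_eval h (sum f I) = (\<Sum>i\<in>I. free_eval h (f i))"
  by (induction I rule: infinite_finite_induct) (simp_all add: free_eval_add)

lemma free_eval_single: "free_eval h (Poly_Mapping.single w c) = c *\<^sub>C word_eval h w"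
  by (simp add: free_eval_def)

lemma free_eval_one [simp]:
  fixes h :: "'g \<Rightarrow> 'b::cstar_algebra"
  shows "free_eval h 1 = 1"
proof -
  have *: "(1::'g free_star_algebra) = Poly_Mapping.single [] 1"
    using single_one [where 'a = "('g \<times> bool) list"] by (simp add: zero_list_def)
  show ?thesis by (subst *) (simp add: free_eval_single word_eval_def)
qed

lemma sum_single_keys:
  "(\<Sum>w\<in>Poly_Mapping.keys p. Poly_Mapping.single w (Poly_Mapping.lookup p w)) = p"
  by (rule poly_mapping_eqI)
     (auto simp: lookup_sum lookup_single when_def in_keys_iff)

lemma free_eval_mult: "free_eval h (p * q) = free_eval h p * free_eval h q"
proof -
  have single: "free_eval h (Poly_Mapping.single v c * Poly_Mapping.single w d) =
      free_eval h (Poly_Mapping.single v c) * free_eval h (Poly_Mapping.single w d)" for v w c d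
    by (simp add: mult_single free_eval_single plus_list_def word_eval_append
        mult_scaleC_left mult_scaleC_right scaleC_scaleC mult.commute)
  have "free_eval h
      ((\<Sum>v\<in>Poly_Mapping.keys p. Poly_Mapping.single v (Poly_Mapping.lookup p v)) *
       (\<Sum>w\<in>Poly_Mapping.keys q. Poly_Mapping.single w (Poly_Mapping.lookup q w))) =
      free_eval h (\<Sum>v\<in>Poly_Mapping.keys p. Poly_Mapping.single v (Poly_Mapping.lookup p v)) *
      free_eval h (\<Sum>w\<in>Poly_Mapping.keys q. Poly_Mapping.single w (Poly_Mapping.lookup q w))"
    by (simp add: sum_product free_eval_sum single)
  thus ?thesis by (simp only: sum_single_keys)
qed

lemma free_eval_scale: "free_eval h (free_scale c p) = c *\<^sub>C free_eval h p"
  by (simp add: free_scale_def free_eval_mult free_eval_single word_eval_def mult_scaleC_left)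

lemma star_sum: "star (sum f I) = (\<Sum>i\<in>I. star (f i :: 'a::cstar_algebra))"
  by (induction I rule: infinite_finite_induct) (simp_all add: star_add)

lemma free_eval_star: "free_eval h (free_star p) = star (free_eval h p)"
proof -
  have "free_eval h (free_star p) = (\<Sum>w\<in>Poly_Mapping.keys p.
      cnj (Poly_Mapping.lookup p w) *\<^sub>C star (word_eval h w))"
    by (simp add: free_star_def free_eval_sum free_eval_single word_eval_star)
  also have "\<dots> = star (free_eval h p)"
    by (simp add: free_eval_def star_sum star_scaleC)
  finally show ?thesis .
qed

lemma free_eval_gen [simp]: "free_eval h (free_gen x) = h x"
  by (simp add: free_gen_def free_eval_single word_eval_def)

lemma cstar_seminorm_free_eval: "cstar_seminorm (\<lambda>p. norm (free_eval h p))"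
  by (simp add: cstar_seminorm_def free_eval_add free_eval_mult free_eval_scale free_eval_star
      norm_triangle_ineq norm_mult_ineq norm_scaleC norm_star_mult)

theorem universal_cstar_algebra_lift:
  fixes h :: "'g \<Rightarrow> 'b::cstar_algebra" and k :: "'g \<Rightarrow> 'c::cstar_algebra"
  assumes univ: "universal_cstar_algebra R h" and rel: "\<And>r. r \<in> R \<Longrightarrow> free_eval k r = 0"
  shows "\<exists>\<Phi>. unital_star_hom \<Phi> \<and> (\<forall>x. \<Phi> (h x) = k x) \<and> (\<forall>y. norm (\<Phi> y) \<le> norm y)"
proof -
  let ?X = "range (free_eval h)"
  have le: "norm (free_eval k p) \<le> norm (free_eval h p)" for p
    using univ cstar_seminorm_free_eval [of k] rel
    by (auto simp: universal_cstar_algebra_def)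
  have dense: "closure ?X = UNIV"
    using univ by (simp add: universal_cstar_algebra_def)
  define \<Phi>0 where "\<Phi>0 y = free_eval k (SOME p. free_eval h p = y)" for y
  have \<Phi>0: "\<Phi>0 (free_eval h p) = free_eval k p" for p
  proof -
    have "free_eval h (SOME q. free_eval h q = free_eval h p) = free_eval h p"
      by (rule someI [of "\<lambda>q. free_eval h q = free_eval h p" p]) simp
    with le [of "(SOME q. free_eval h q = free_eval h p) - p"] show ?thesis
      by (simp add: \<Phi>0_def free_eval_diff)
  qed
  have "uniformly_continuous_on ?X \<Phi>0"
    unfolding uniformly_continuous_on_def
  proof (intro allI impI)
    fix e :: real assume "e > 0"
    moreover have "dist (\<Phi>0 y) (\<Phi>0 x) \<le> dist y x" if "x \<in> ?X" "y \<in> ?X" for x y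
      using that le by (auto simp: \<Phi>0 dist_norm simp flip: free_eval_diff)
    ultimately show "\<exists>d>0. \<forall>x\<in>?X. \<forall>x'\<in>?X. dist x' x < d \<longrightarrow> dist (\<Phi>0 x') (\<Phi>0 x) < e"
      by (meson le_less_trans)
  qed
  from uniformly_continuous_on_extension_on_closure [OF this]
  obtain \<Phi> where "uniformly_continuous_on (closure ?X) \<Phi>"
    and "\<And>x. x \<in> ?X \<Longrightarrow> \<Phi>0 x = \<Phi> x" by metis
  hence cont: "continuous_on UNIV \<Phi>" and \<Phi>: "\<Phi> (free_eval h p) = free_eval k p" for p
    using dense \<Phi>0 by (auto dest: uniformly_continuous_imp_continuous)
  have approx: "\<exists>p. (\<lambda>n. free_eval h (p n)) \<longlonglongrightarrow> y" for y
  proof -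
    have "y \<in> closure ?X" using dense by simp
    then obtain f where f: "\<forall>n. f n \<in> ?X" "f \<longlonglongrightarrow> y"
      unfolding closure_sequential by auto
    from f(1) have "\<forall>n. \<exists>q. f n = free_eval h q" by blast
    then obtain p where "\<forall>n. f n = free_eval h (p n)" by (rule choice [THEN exE])
    hence "f = (\<lambda>n. free_eval h (p n))" by blast
    with f(2) show ?thesis by blast
  qed
  have lim: "(\<lambda>n. free_eval k (p n)) \<longlonglongrightarrow> \<Phi> y" if "(\<lambda>n. free_eval h (p n)) \<longlonglongrightarrow> y" for p y
    using continuous_on_tendsto_compose [OF cont that] by (simp add: \<Phi>)
  have "\<Phi> (x + y) = \<Phi> x + \<Phi> y \<and> \<Phi> (x * y) = \<Phi> x * \<Phi> y" for x y
  proof -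
    obtain p q where p: "(\<lambda>n. free_eval h (p n)) \<longlonglongrightarrow> x" and q: "(\<lambda>n. free_eval h (q n)) \<longlonglongrightarrow> y"
      using approx by metis
    have "(\<lambda>n. free_eval k (p n + q n)) \<longlonglongrightarrow> \<Phi> (x + y)"
      by (intro lim) (simp add: free_eval_add tendsto_add p q)
    moreover have "(\<lambda>n. free_eval k (p n + q n)) \<longlonglongrightarrow> \<Phi> x + \<Phi> y"
      by (simp add: free_eval_add tendsto_add lim p q)
    moreover have "(\<lambda>n. free_eval k (p n * q n)) \<longlonglongrightarrow> \<Phi> (x * y)"
      by (intro lim) (simp add: free_eval_mult tendsto_mult p q)
    moreover have "(\<lambda>n. free_eval k (p n * q n)) \<longlonglongrightarrow> \<Phi> x * \<Phi> y"
      by (simp add: free_eval_mult tendsto_mult lim p q)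
    ultimately show ?thesis by (blast intro: LIMSEQ_unique)
  qed
  moreover have "\<Phi> (c *\<^sub>C x) = c *\<^sub>C \<Phi> x \<and> \<Phi> (star x) = star (\<Phi> x) \<and> norm (\<Phi> x) \<le> norm x" for c x
  proof -
    obtain p where p: "(\<lambda>n. free_eval h (p n)) \<longlonglongrightarrow> x"
      using approx by metis
    have "(\<lambda>n. free_eval k (free_scale c (p n))) \<longlonglongrightarrow> \<Phi> (c *\<^sub>C x)"
      by (intro lim) (simp add: free_eval_scale bounded_linear.tendsto [OF bounded_linear_scaleC] p)
    moreover have "(\<lambda>n. free_eval k (free_scale c (p n))) \<longlonglongrightarrow> c *\<^sub>C \<Phi> x"
      by (simp add: free_eval_scale bounded_linear.tendsto [OF bounded_linear_scaleC] lim p)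
    moreover have "(\<lambda>n. free_eval k (free_star (p n))) \<longlonglongrightarrow> \<Phi> (star x)"
      by (intro lim) (simp add: free_eval_star bounded_linear.tendsto [OF bounded_linear_star] p)
    moreover have "(\<lambda>n. free_eval k (free_star (p n))) \<longlonglongrightarrow> star (\<Phi> x)"
      by (simp add: free_eval_star bounded_linear.tendsto [OF bounded_linear_star] lim p)
    moreover have "norm (\<Phi> x) \<le> norm x"
      using le by (intro LIMSEQ_le [OF tendsto_norm [OF lim [OF p]] tendsto_norm [OF p]]) blast
    ultimately show ?thesis by (blast intro: LIMSEQ_unique)
  qed
  moreover have "\<Phi> 1 = 1" using \<Phi> [of 1] by simp
  moreover have "\<Phi> (h x) = k x" for x using \<Phi> [of "free_gen x"] by simp
  ultimately show ?thesis unfolding unital_star_hom_def by (intro exI [of _ \<Phi>]) simp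
qed

lemma ball_Collect_1: "(\<forall>r\<in>{f x | x. True}. P r) \<longleftrightarrow> (\<forall>x. P (f x))"
  and ball_Collect_2: "(\<forall>r\<in>{g x y | x y. True}. P r) \<longleftrightarrow> (\<forall>x y. P (g x y))"
  and ball_Collect_mem: "(\<forall>r\<in>{f x | x. x \<in> J}. P r) \<longleftrightarrow> (\<forall>x\<in>J. P (f x))"
  by blast+

lemma free_eval_delta: "free_eval h (if b then 1 else 0) = (if b then 1 else 0)"
  by simp

theorem cuntz_pimsner_relations_iff:
  "(\<forall>r\<in>cuntz_pimsner_relations \<alpha>. free_eval (case_sum \<iota> S) r = 0) \<longleftrightarrow>
     unital_star_hom \<iota> \<and>
     (\<forall>i j. star (S i) * S j = (if i = j then 1 else 0)) \<and>
     (\<forall>a i. \<iota> a * S i = S i * \<iota> (\<alpha> i a)) \<and>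
     (\<forall>a\<in>covariance_ideal \<alpha>. \<iota> a * (1 - (\<Sum>i\<in>UNIV. S i * star (S i))) = 0)"
  unfolding cuntz_pimsner_relations_def Let_def unital_star_hom_def ball_Un
    ball_Collect_1 ball_Collect_2 ball_Collect_mem
  by (simp add: free_eval_diff free_eval_add free_eval_mult free_eval_scale free_eval_star
      free_eval_sum free_eval_delta conj_assoc split del: if_split)

lemma unital_star_hom_free_eval:
  fixes h :: "'g \<Rightarrow> 'a::cstar_algebra" and f :: "'a \<Rightarrow> 'b::cstar_algebra"
  assumes "unital_star_hom f"
  shows "f (free_eval h p) = free_eval (\<lambda>x. f (h x)) p"
proof -
  have add: "f (x + y) = f x + f y" and scale: "f (c *\<^sub>C x) = c *\<^sub>C f x"
    and mult: "f (x * y) = f x * f y" and star: "f (star x) = star (f x)" and one: "f 1 = 1"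
    for x y c
    using assms by (auto simp: unital_star_hom_def)
  have zero: "f 0 = 0" using scale [of 0 0] by simp
  have "f (word_eval h w) = word_eval (\<lambda>x. f (h x)) w" for w
    by (induction w) (auto simp: word_eval_def mult star one)
  moreover have "f (sum g I) = (\<Sum>i\<in>I. f (g i))" for g :: "('g \<times> bool) list \<Rightarrow> 'a" and I
    by (induction I rule: infinite_finite_induct) (simp_all add: zero add)
  ultimately show ?thesis by (simp add: free_eval_def scale)
qed

text \<open>Assuming \<open>gauge_action \<iota> S \<gamma>\<close> of a given \<open>\<gamma>\<close> is no restriction on the algebra.\<close>

theorem gauge_action_exists:
  assumes "cuntz_pimsner_algebra \<alpha> \<iota> S"
  shows "\<exists>\<gamma>. gauge_action \<iota> S \<gamma>"
proof -
  have rel: "\<forall>r\<in>cuntz_pimsner_relations \<alpha>. free_eval (case_sum \<iota> S) r = 0"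
    and dense: "closure (range (free_eval (case_sum \<iota> S))) = UNIV"
    using assms by (simp_all add: cuntz_pimsner_algebra_def universal_cstar_algebra_def)
  have unit: "cnj z * z = 1" if "cmod z = 1" for z
    using that by (metis complex_norm_square mult.commute of_real_1 power_one)
  have "\<exists>\<Phi>. unital_star_hom \<Phi> \<and> (\<forall>a. \<Phi> (\<iota> a) = \<iota> a) \<and> (\<forall>i. \<Phi> (S i) = z *\<^sub>C S i) \<and>
          (\<forall>y. norm (\<Phi> y) \<le> norm y)" if "cmod z = 1" for z
  proof -
    have "\<forall>r\<in>cuntz_pimsner_relations \<alpha>. free_eval (case_sum \<iota> (\<lambda>i. z *\<^sub>C S i)) r = 0"
      using rel unit [OF that] unfolding cuntz_pimsner_relations_iff
      by (auto simp: star_scaleC mult_scaleC_left mult_scaleC_right scaleC_scaleC mult.commute)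
    with universal_cstar_algebra_lift [OF assms [unfolded cuntz_pimsner_algebra_def]]
    obtain \<Phi> where *: "unital_star_hom \<Phi>"
        "\<forall>x. \<Phi> (case_sum \<iota> S x) = case_sum \<iota> (\<lambda>i. z *\<^sub>C S i) x"
        "\<forall>y. norm (\<Phi> y) \<le> norm y"
      by metis
    from *(2) have "\<Phi> (\<iota> a) = \<iota> a" "\<Phi> (S i) = z *\<^sub>C S i" for a i
      by (metis sum.case(1), metis sum.case(2))
    with * show ?thesis by blast
  qed
  then obtain \<Phi> where \<Phi>: "unital_star_hom (\<Phi> z)" "\<Phi> z (\<iota> a) = \<iota> a" "\<Phi> z (S i) = z *\<^sub>C S i"
      "norm (\<Phi> z y) \<le> norm y" if "cmod z = 1" for z a i y
    by metis
  have inverse: "\<Phi> (cnj z) (\<Phi> z y) = y" if z: "cmod z = 1" for z y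
  proof -
    have z': "cmod (cnj z) = 1" using z by simp
    have gen: "\<Phi> (cnj z) (\<Phi> z (case_sum \<iota> S x)) = case_sum \<iota> S x" for x
      using \<Phi>(1) [OF z'] unit [OF z]
      by (cases x) (simp_all add: \<Phi> z z' unital_star_hom_def scaleC_scaleC mult.commute)
    have cont: "continuous_on UNIV (\<Phi> w)" if w: "cmod w = 1" for w
    proof -
      have "\<Phi> w x - \<Phi> w y = \<Phi> w (x - y)" for x y
        using \<Phi>(1) [OF w] unfolding unital_star_hom_def
        by (metis add_diff_cancel_right' diff_add_cancel)
      hence "dist (\<Phi> w x) (\<Phi> w y) \<le> 1 * dist x y" for x y
        using \<Phi>(4) [OF w] by (simp add: dist_norm)
      thus ?thesis
        by (intro lipschitz_on_continuous_on [of 1] lipschitz_onI) auto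
    qed
    have "closed {y. \<Phi> (cnj z) (\<Phi> z y) = y}"
      by (intro closed_Collect_eq continuous_on_compose2 [OF cont [OF z'] cont [OF z]] continuous_on_id)
         auto
    moreover have "range (free_eval (case_sum \<iota> S)) \<subseteq> {y. \<Phi> (cnj z) (\<Phi> z y) = y}"
      by (auto simp: unital_star_hom_free_eval \<Phi>(1) z z' gen)
    ultimately have "closure (range (free_eval (case_sum \<iota> S))) \<subseteq> {y. \<Phi> (cnj z) (\<Phi> z y) = y}"
      by (intro closure_minimal)
    with dense show ?thesis by blast
  qed
  have "bij (\<Phi> z)" if "cmod z = 1" for z
  proof (rule o_bij)
    show "\<Phi> (cnj z) \<circ> \<Phi> z = id" using inverse [OF that] by (simp add: fun_eq_iff)
    show "\<Phi> z \<circ> \<Phi> (cnj z) = id" using inverse [of "cnj z"] that by (simp add: fun_eq_iff)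
  qed
  with \<Phi>(1-3) show ?thesis
    unfolding gauge_action_def star_automorphism_def by blast
qed

end

(*
Write c = 1 - exp(-beta) d and P = 1 - sum_i S_i S_i^*. Since the flow is periodic, comparing
Fourier coefficients on the lines Im z = 0 and Im z = beta shows that a state psi is KMS iff
psi(a y) = psi(y a) and psi(S_i y) = exp(-beta) psi(y S_i) for all y, even if the S_i do not belong
to the subalgebra on which the KMS condition is given. For such psi, tau(a) = psi(a P) / c is a
tracial state that vanishes on J, and iterating psi(a) = c tau(a) + exp(-beta) sum_i psi(alpha_i(a))
gives the series for psi(a); hence tau determines psi. Conversely, the GNS construction of tau
induces a representation on the Fock module of finitely supported functions from words to A, and
psi = c sum_w exp(-|w| beta) <. xi_w, xi_w>, with xi_w the vacuum vector at the word w, is the KMS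
state of tau. No completion is needed, because the operator seminorm of this representation is a
C*-seminorm on the free *-algebra, to which the universal property applies.
*)

theory Submission
  imports Defs "HOL-Complex_Analysis.Complex_Analysis"
begin

section \<open>Square roots and states\<close>

text \<open>Every norm estimate rests on one fact: \<open>C *\<^sub>R 1 - star x * x\<close> has the
  form \<open>star y * y\<close> once \<open>(norm x)\<^sup>2 < C\<close>. Unital *-homomorphisms
  preserve this form and states are nonnegative on it, so bounds pass through
  \<open>word_endo \<alpha> w\<close>, \<open>\<iota>\<close> and \<open>\<sigma> t\<close> alike.
  Continuity of \<open>\<sigma> t\<close> is obtained behind a state, which is why the group law of
  the flow is stated under \<open>\<psi>\<close>. The projection P cuts the Fock module down to its
  component at the empty word, so compressing by it undoes the summation over words. The number 1/c
  is the partition function sum_m d^m exp(-m beta), where d^m counts the words of length m; beta >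
  log d is exactly its convergence. The Toeplitz relations hold outright on the Fock module, whereas
  the covariance relations hold only up to null vectors; the vanishing of tau on J is what makes
  these vectors null.\<close>

lemma abs_gbinomial_half_le_1: "\<bar>(1/2 :: real) gchoose n\<bar> \<le> 1"
proof (induction n)
  case (Suc n)
  have "(1/2 - real n) * (1/2 gchoose n) = real (Suc n) * (1/2 gchoose Suc n)"
    using gbinomial_mult_1 [of "1/2 :: real" n] by (simp add: algebra_simps)
  hence "real (Suc n) * \<bar>1/2 gchoose Suc n\<bar> = \<bar>1/2 - real n\<bar> * \<bar>1/2 gchoose n\<bar>"
    by (metis abs_mult abs_of_nat)
  also have "\<dots> \<le> real (Suc n) * 1"
    by (intro mult_mono Suc.IH) auto
  finally show ?case by (simp only: mult_le_cancel_left)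
qed simp

lemma star_scaleR: "star (r *\<^sub>R x) = r *\<^sub>R star (x::'a::cstar_algebra)"
  by (simp add: star_scaleC flip: scaleC_of_real)

lemma star_power: "star (x ^ n) = star (x::'a::cstar_algebra) ^ n"
  by (induction n) (simp_all add: star_mult power_commutes)

lemma star_minus: "star (- x) = - star (x::'a::cstar_algebra)"
  using star_scaleR [of "-1" x] by simp

lemma star_diff: "star (x - y) = star x - star (y::'a::cstar_algebra)"
  using star_add [of x "- y"] by (simp add: star_minus)

text \<open>The root is given by the binomial series of \<open>sqrt (1 - t)\<close>.\<close>

lemma star_root_one_minus:
  fixes h :: "'a::cstar_algebra"
  assumes h: "star h = h" and norm: "norm h < 1"
  shows "\<exists>y. star y * y = 1 - h"
proof -
  define c :: "nat \<Rightarrow> real" where "c n = (-1) ^ n * (1/2 gchoose n)" for n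
  \<comment> \<open>The square of the series terminates: by Vandermonde the convolution of its
    coefficients is, up to sign, \<open>1/2 + 1/2 = 1\<close> choose \<open>n\<close>.\<close>
  have c: "(\<Sum>k\<le>n. c k * c (n - k)) = (if n = 0 then 1 else if n = 1 then -1 else 0)" for n
  proof -
    have "(\<Sum>k\<le>n. c k * c (n - k)) = (\<Sum>k\<le>n. (-1) ^ n * ((1/2 gchoose k) * (1/2 gchoose (n - k))))"
    proof (rule sum.cong)
      fix k assume "k \<in> {..n}"
      hence "(-1) ^ k * (-1) ^ (n - k) = (-1 :: real) ^ n" by (simp flip: power_add)
      thus "c k * c (n - k) = (-1) ^ n * ((1/2 gchoose k) * (1/2 gchoose (n - k)))"
        unfolding c_def by (metis mult.assoc mult.left_commute)
    qed simp
    also have "\<dots> = (-1) ^ n * ((1/2 + 1/2) gchoose n)"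
      using gbinomial_Vandermonde [of "1/2 :: real" "1/2" n]
      by (simp add: atLeast0AtMost flip: sum_distrib_left)
    also have "(1/2 + 1/2 :: real) gchoose n = of_nat (1 choose n)"
      by (subst binomial_gbinomial) simp
    also have "(-1) ^ n * of_nat (1 choose n) = (if n = 0 then 1 else if n = 1 then -1 else 0 :: real)"
    proof -
      have "n = 0 \<or> n = 1 \<or> 1 < n" by linarith
      thus ?thesis by (auto simp: binomial_eq_0)
    qed
    finally show ?thesis .
  qed
  let ?f = "\<lambda>n. c n *\<^sub>R h ^ n"
  \<comment> \<open>The coefficients have absolute value at most 1, so the geometric series of
    \<open>norm h\<close> dominates.\<close>
  have summable: "summable (\<lambda>n. norm (?f n))"
  proof (rule summable_comparison_test)
    have "norm (?f n) \<le> norm h ^ n" for n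
    proof -
      have "norm (?f n) \<le> 1 * norm (h ^ n)"
        using abs_gbinomial_half_le_1 [of n]
        by (simp add: c_def abs_mult mult_left_le_one_le)
      also have "\<dots> \<le> norm h ^ n" using norm_power_ineq by simp
      finally show ?thesis .
    qed
    thus "\<exists>N. \<forall>n\<ge>N. norm (norm (?f n)) \<le> norm h ^ n" by simp
    show "summable (\<lambda>n. norm h ^ n)" using norm by (simp add: summable_geometric)
  qed
  define y where "y = suminf ?f"
  \<comment> \<open>The root comes out selfadjoint, so \<open>star y * y\<close> is a Cauchy
    square.\<close>
  have "(\<lambda>n. star (?f n)) sums star y"
    unfolding y_def
    by (intro bounded_linear.sums [OF bounded_linear_star]
        summable_sums summable_norm_cancel [OF summable])
  hence "star y = y"
    by (simp add: star_scaleR star_power h y_def sums_iff)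
  moreover have "y * y = 1 - h"
  proof -
    have "(\<Sum>i\<le>k. ?f i * ?f (k - i)) = (\<Sum>i\<le>k. c i * c (k - i)) *\<^sub>R h ^ k" for k
      by (simp add: scaleR_sum_left mult.commute flip: power_add)
    hence "(\<Sum>i\<le>k. ?f i * ?f (k - i)) = (if k = 0 then 1 else if k = 1 then -h else 0)" for k
      by (simp add: c)
    hence "(\<lambda>k. if k = 0 then 1 else if k = 1 then -h else 0) sums (y * y)"
      using Cauchy_product_sums [OF summable summable] by (simp add: y_def)
    moreover have "(\<lambda>k::nat. if k = 0 then 1 else if k = 1 then -h else 0) sums
        (\<Sum>k<2::nat. if k = 0 then 1 else if k = 1 then -h else 0)"
      by (rule sums_finite) auto
    ultimately show ?thesis
      using sums_unique2 by (fastforce simp: numeral_2_eq_2)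
  qed
  ultimately show ?thesis by metis
qed

text \<open>Stands for the operator inequality \<open>star x * x\<close> \<le> C: a state applied to
  the square of the root, or to a conjugate of it, turns this into a bound. The hypothesis is strict
  because the root series is summed for \<open>norm h < 1\<close>; applications pay with an epsilon
  or an extra 1.\<close>

lemma star_root_minus_star_mult:
  fixes x :: "'a::cstar_algebra"
  assumes "(norm x)\<^sup>2 < C"
  shows "\<exists>y. star y * y = C *\<^sub>R 1 - star x * x"
proof -
  have C: "C > 0" using assms by (smt (verit) zero_le_power2)
  let ?h = "(1 / C) *\<^sub>R (star x * x)"
  have "star ?h = ?h" by (simp add: star_scaleR star_mult star_star)
  moreover have "norm ?h < 1" using assms C by (simp add: norm_star_mult)
  ultimately obtain y where y: "star y * y = 1 - ?h" using star_root_one_minus by blast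
  have "star (sqrt C *\<^sub>R y) * (sqrt C *\<^sub>R y) = C *\<^sub>R 1 - star x * x"
    using C by (simp add: star_scaleR y scaleR_diff_right)
  thus ?thesis by blast
qed

text \<open>For \<open>a\<close>, \<open>b\<close>, \<open>c\<close> the values of a form at \<open>(x, x)\<close>, \<open>(x, y)\<close>, \<open>(y, y)\<close>, the hypothesis is
  its positivity at \<open>x + t y\<close>.\<close>

lemma cauchy_schwarz_complex:
  fixes a c :: real and b :: complex
  assumes pos: "\<And>t. 0 \<le> a + 2 * Re (t * b) + (cmod t)\<^sup>2 * c"
  shows "(cmod b)\<^sup>2 \<le> a * c"
proof -
  \<comment> \<open>Taking \<open>t\<close> along \<open>- cnj b\<close> removes the phase of
    \<open>b\<close> and leaves a real polynomial in \<open>s\<close>.\<close>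
  have *: "0 \<le> a - 2 * s * (cmod b)\<^sup>2 + s\<^sup>2 * (cmod b)\<^sup>2 * c" for s
  proof -
    have "Re (- of_real s * cnj b * b) = - s * (cmod b)\<^sup>2"
      by (simp only: cmod_power2) (simp add: algebra_simps power2_eq_square)
    moreover have "cmod (- of_real s * cnj b) = \<bar>s\<bar> * cmod b" by (simp add: norm_mult)
    ultimately show ?thesis
      using pos [of "- of_real s * cnj b"] by (simp add: power_mult_distrib algebra_simps)
  qed
  show ?thesis
  proof (cases "c = 0")
    case True
    have "cmod b = 0"
    proof (rule ccontr)
      assume "cmod b \<noteq> 0"
      \<comment> \<open>At this \<open>s\<close> the remaining affine function takes the value
        -1.\<close>
      hence "(a + 1) / (2 * (cmod b)\<^sup>2) * (2 * (cmod b)\<^sup>2) = a + 1" by simp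
      with * [of "(a + 1) / (2 * (cmod b)\<^sup>2)"] True show False
        by (simp add: algebra_simps)
    qed
    with True show ?thesis by simp
  next
    case False
    have "c \<ge> 0"
    proof (rule ccontr)
      assume "\<not> c \<ge> 0"
      \<comment> \<open>Adding the values at \<open>t\<close> and \<open>- t\<close> cancels the
        linear term; the modulus of \<open>t\<close> chosen next makes the rest negative.\<close>
      have "0 \<le> 2 * a + 2 * (cmod t)\<^sup>2 * c" for t
        using pos [of t] pos [of "- t"] by simp
      from this [of "of_real (sqrt ((\<bar>a\<bar> + 1) / (- c)))"] \<open>\<not> c \<ge> 0\<close>
      have "0 \<le> 2 * a + 2 * ((\<bar>a\<bar> + 1) / (- c) * c)"
        by (simp add: divide_nonneg_neg)
      moreover have "(\<bar>a\<bar> + 1) / (- c) * c = - (\<bar>a\<bar> + 1)" using \<open>\<not> c \<ge> 0\<close> by simp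
      ultimately show False by linarith
    qed
    with False have "c > 0" by simp
    \<comment> \<open>The minimum of the quadratic polynomial is at
      \<open>s = 1 / c\<close>.\<close>
    with * [of "1 / c"] show ?thesis
      by (simp add: power2_eq_square field_simps)
  qed
qed

section \<open>States: symmetry, Cauchy-Schwarz and norm bounds\<close>

lemma is_stateD:
  assumes "is_state \<psi>"
  shows "\<psi> (x + y) = \<psi> x + \<psi> y" "\<psi> (c *\<^sub>C x) = c * \<psi> x" "\<psi> 1 = 1" "\<psi> 0 = 0"
    "\<psi> (- x) = - \<psi> x" "\<psi> (x - y) = \<psi> x - \<psi> y" "\<psi> (r *\<^sub>R x) = of_real r * \<psi> x"
    "\<psi> (sum f I) = (\<Sum>i\<in>I. \<psi> (f i))"
    "Re (\<psi> (star x * x)) \<ge> 0" "Im (\<psi> (star x * x)) = 0"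
proof -
  show add: "\<psi> (x + y) = \<psi> x + \<psi> y" and scale: "\<psi> (c *\<^sub>C x) = c * \<psi> x" "\<psi> 1 = 1" for c x y
    using assms by (auto simp: is_state_def)
  show "Re (\<psi> (star x * x)) \<ge> 0" "Im (\<psi> (star x * x)) = 0"
    using assms by (auto simp: is_state_def complex_nonneg_Reals_iff)
  show R: "\<psi> (r *\<^sub>R x) = of_real r * \<psi> x" for r x by (simp add: scale flip: scaleC_of_real)
  show zero: "\<psi> 0 = 0" using R [of 0 0] by simp
  show minus: "\<psi> (- x) = - \<psi> x" for x using R [of "-1" x] by simp
  show "\<psi> (x - y) = \<psi> x - \<psi> y" using add [of x "- y"] minus by simp
  show "\<psi> (sum f I) = (\<Sum>i\<in>I. \<psi> (f i))"
    by (induction I rule: infinite_finite_induct) (simp_all add: zero add)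
qed

lemma unital_star_homD:
  assumes "unital_star_hom f"
  shows "f (x + y) = f x + f y" "f (c *\<^sub>C x) = c *\<^sub>C f x" "f (x * y) = f x * f y"
    "f (star x) = star (f x)" "f 1 = 1" "f 0 = 0" "f (- x) = - f x" "f (x - y) = f x - f y"
    "f (r *\<^sub>R x) = r *\<^sub>R f x"
proof -
  show add: "f (x + y) = f x + f y" and scale: "f (c *\<^sub>C x) = c *\<^sub>C f x" and "f (x * y) = f x * f y"
    "f (star x) = star (f x)" "f 1 = 1" for c x y
    using assms by (auto simp: unital_star_hom_def)
  show R: "f (r *\<^sub>R x) = r *\<^sub>R f x" for r x by (simp add: scale flip: scaleC_of_real)
  show "f 0 = 0" using R [of 0 0] by simp
  show minus: "f (- x) = - f x" for x using R [of "-1" x] by simp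
  show "f (x - y) = f x - f y" using add [of x "- y"] minus by simp
qed

lemma unital_star_hom_compose:
  "unital_star_hom f \<Longrightarrow> unital_star_hom g \<Longrightarrow> unital_star_hom (\<lambda>x. f (g x))"
  by (simp add: unital_star_hom_def)

lemma is_state_compose: "is_state \<psi> \<Longrightarrow> unital_star_hom f \<Longrightarrow> is_state (\<lambda>x. \<psi> (f x))"
  unfolding is_state_def unital_star_hom_def by simp

lemma is_state_star:
  assumes "is_state \<psi>"
  shows "\<psi> (star x) = cnj (\<psi> x)"
proof -
  note [simp] = is_stateD [OF assms]
  \<comment> \<open>Symmetry is read off from positivity by polarization against the unit:
    \<open>c = 1\<close> compares the imaginary parts of the two values, \<open>c = \<i>\<close> the
    real parts.\<close>
  have "Im (\<psi> (star (x + c *\<^sub>C 1) * (x + c *\<^sub>C 1))) = 0" for c by simp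
  moreover have "star (x + c *\<^sub>C 1) * (x + c *\<^sub>C 1) =
      star x * x + c *\<^sub>C star x + cnj c *\<^sub>C x + (cnj c * c) *\<^sub>C 1" for c
    by (simp add: star_add star_scaleC distrib_left distrib_right mult_scaleC_left
        mult_scaleC_right scaleC_scaleC mult.commute scaleC_add_right)
  ultimately have "Im (c * \<psi> (star x) + cnj c * \<psi> x) = 0" for c
    by simp
  from this [of 1] this [of \<i>] show ?thesis by (simp add: complex_eq_iff)
qed

lemma is_state_quadratic:
  assumes "is_state \<psi>"
  shows "Re (\<psi> (star (x + t *\<^sub>C y) * (x + t *\<^sub>C y))) = Re (\<psi> (star x * x)) +
      2 * Re (t * \<psi> (star x * y)) + (cmod t)\<^sup>2 * Re (\<psi> (star y * y))"
proof -
  note [simp] = is_stateD [OF assms]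
  have "star (x + t *\<^sub>C y) * (x + t *\<^sub>C y) =
      star x * x + t *\<^sub>C (star x * y) + cnj t *\<^sub>C star (star x * y) + (cnj t * t) *\<^sub>C (star y * y)"
    by (simp add: star_add star_scaleC distrib_left distrib_right mult_scaleC_left
        mult_scaleC_right scaleC_scaleC mult.commute star_mult star_star scaleC_add_right)
  hence "\<psi> (star (x + t *\<^sub>C y) * (x + t *\<^sub>C y)) = \<psi> (star x * x) + t * \<psi> (star x * y) +
      cnj (t * \<psi> (star x * y)) + (cnj t * t) * \<psi> (star y * y)"
    by (simp add: is_state_star [OF assms, of "star x * y"])
  also have "cnj t * t = of_real ((cmod t)\<^sup>2)"
    by (metis complex_norm_square mult.commute)
  finally show ?thesis by simp
qed

lemma is_state_cauchy_schwarz: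
  assumes "is_state \<psi>"
  shows "(cmod (\<psi> (star x * y)))\<^sup>2 \<le> Re (\<psi> (star x * x)) * Re (\<psi> (star y * y))"
proof (rule cauchy_schwarz_complex)
  show "0 \<le> Re (\<psi> (star x * x)) + 2 * Re (t * \<psi> (star x * y)) + (cmod t)\<^sup>2 * Re (\<psi> (star y * y))" for t
    using is_stateD(9) [OF assms] is_state_quadratic [OF assms] by metis
qed

text \<open>Positivity at the root of
  \<open>((norm x)\<^sup>2 + e) *\<^sub>R 1 - star x * x\<close>; the \<open>e\<close> provides the
  strict inequality.\<close>

lemma is_state_star_mult_le:
  assumes "is_state \<psi>"
  shows "Re (\<psi> (star x * x)) \<le> (norm x)\<^sup>2"
proof (rule field_le_epsilon)
  fix e :: real assume "e > 0"
  then obtain y where y: "star y * y = ((norm x)\<^sup>2 + e) *\<^sub>R 1 - star x * x"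
    using star_root_minus_star_mult [of x "(norm x)\<^sup>2 + e"] by auto
  have "0 \<le> Re (\<psi> (((norm x)\<^sup>2 + e) *\<^sub>R 1 - star x * x))"
    using is_stateD(9) [OF assms, of y] by (simp add: y)
  thus "Re (\<psi> (star x * x)) \<le> (norm x)\<^sup>2 + e"
    by (simp add: is_stateD [OF assms])
qed

text \<open>Cauchy-Schwarz for \<psi>, with the factor that contains \<open>f\<close> estimated by
  the state \<psi> \<circ> f on the domain of \<open>f\<close>. Hence \<open>norm x\<close> appears
  instead of the norm of \<open>f x\<close>, and \<open>\<psi> (y * f x)\<close> is continuous in
  \<open>x\<close> for every unital *-homomorphism \<open>f\<close>.\<close>

lemma is_state_mult_le:
  assumes "is_state \<psi>" "unital_star_hom f"
  shows "cmod (\<psi> (y * f x)) \<le> norm y * norm x" "cmod (\<psi> (f x * y)) \<le> norm x * norm y"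
proof -
  have f: "is_state (\<lambda>x. \<psi> (f x))" using assms by (rule is_state_compose)
  have "(cmod (\<psi> (star (star y) * f x)))\<^sup>2 \<le>
      Re (\<psi> (star (star y) * star y)) * Re (\<psi> (f (star x * x)))"
    using is_state_cauchy_schwarz [OF assms(1), of "star y" "f x"]
    by (simp add: unital_star_homD [OF assms(2)])
  also have "\<dots> \<le> (norm y)\<^sup>2 * (norm x)\<^sup>2"
    using is_state_star_mult_le [OF assms(1), of "star y"] is_state_star_mult_le [OF f, of x]
    by (intro mult_mono is_stateD(9) [OF f]) (auto simp: norm_star)
  finally have "(cmod (\<psi> (y * f x)))\<^sup>2 \<le> (norm y * norm x)\<^sup>2"
    by (simp add: star_star power_mult_distrib)
  thus "cmod (\<psi> (y * f x)) \<le> norm y * norm x"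
    by (rule power2_le_imp_le) simp
  have "(cmod (\<psi> (star (f (star x)) * y)))\<^sup>2 \<le>
      Re (\<psi> (f (star (star x) * star x))) * Re (\<psi> (star y * y))"
    using is_state_cauchy_schwarz [OF assms(1), of "f (star x)" y]
    by (simp add: unital_star_homD [OF assms(2)])
  also have "\<dots> \<le> (norm x)\<^sup>2 * (norm y)\<^sup>2"
    using is_state_star_mult_le [OF assms(1), of y] is_state_star_mult_le [OF f, of "star x"]
    by (intro mult_mono is_stateD(9) [OF assms(1)]) (auto simp: norm_star)
  finally have "(cmod (\<psi> (f x * y)))\<^sup>2 \<le> (norm x * norm y)\<^sup>2"
    by (simp add: star_star power_mult_distrib flip: unital_star_homD(4) [OF assms(2)])
  thus "cmod (\<psi> (f x * y)) \<le> norm x * norm y"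
    by (rule power2_le_imp_le) simp
qed

lemma unital_star_hom_id: "unital_star_hom (\<lambda>x. x)"
  by (simp add: unital_star_hom_def)

lemma is_state_le: "is_state \<psi> \<Longrightarrow> cmod (\<psi> x) \<le> norm x"
  using is_state_mult_le(1) [OF _ unital_star_hom_id, of \<psi> 1 x] by simp

lemma is_state_bounded_linear: "is_state \<psi> \<Longrightarrow> bounded_linear \<psi>"
  by (rule bounded_linear_intro [of _ 1])
     (simp_all add: is_stateD(1,7) is_state_le, simp add: scaleR_conv_of_real)

lemma continuous_on_state:
  "is_state \<psi> \<Longrightarrow> continuous_on X f \<Longrightarrow> continuous_on X (\<lambda>x. \<psi> (f x))"
  by (rule bounded_linear.continuous_on [OF is_state_bounded_linear])

lemma continuous_on_star [continuous_intros]: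
  "continuous_on X f \<Longrightarrow> continuous_on X (\<lambda>x. star (f x :: 'a::cstar_algebra))"
  by (rule bounded_linear.continuous_on [OF bounded_linear_star])

section \<open>The KMS condition on generators\<close>

text \<open>The form of the KMS condition that mentions no analytic elements: elements of A have
  degree 0 under the flow, \<open>S i\<close> has degree 1, and \<open>y\<close> ranges over the
  whole algebra. Both equations are linear in \<psi> and closed in \<open>y\<close>, so they can be
  tested on dense sets and pass to convex combinations.\<close>

definition KMS_on_generators ::
  "('a::cstar_algebra \<Rightarrow> 'b) \<Rightarrow> ('d \<Rightarrow> 'b) \<Rightarrow> real \<Rightarrow> ('b::cstar_algebra \<Rightarrow> complex) \<Rightarrow> bool" where
  "KMS_on_generators \<iota> S \<beta> \<psi> \<longleftrightarrow> is_state \<psi> \<and>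
     (\<forall>a y. \<psi> (\<iota> a * y) = \<psi> (y * \<iota> a)) \<and>
     (\<forall>i y. \<psi> (S i * y) = of_real (exp (- \<beta>)) * \<psi> (y * S i))"

lemma entire_eq_on_reals:
  assumes f: "f holomorphic_on UNIV" and g: "g holomorphic_on UNIV"
    and eq: "\<And>t. f (of_real t) = g (of_real t)"
  shows "f z = g z"
proof -
  have "(0::complex) islimpt \<real>"
    unfolding islimpt_approachable
  proof (intro allI impI)
    fix e :: real assume "e > 0"
    thus "\<exists>x\<in>\<real>. x \<noteq> 0 \<and> dist x (0::complex) < e"
      by (intro bexI [of _ "of_real (e / 2)"]) (auto simp: norm_divide)
  qed
  moreover have "f z - g z = 0" if "z \<in> \<real>" for z
    using that by (rule Reals_cases) (simp add: eq)
  ultimately have "(\<lambda>z. f z - g z) z = 0"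
    by (rule analytic_continuation [of "\<lambda>z. f z - g z" UNIV \<real> 0, rotated 5])
       (use f g in \<open>auto intro: holomorphic_intros\<close>)
  thus ?thesis by simp
qed

text \<open>A primitive \<open>H\<close> of \<open>g\<close> has the property that \<open>H (z + 2\<pi>) - H z\<close> is constant.\<close>

lemma periodic_entire_integral_shift:
  fixes g :: "complex \<Rightarrow> complex"
  assumes hol: "g holomorphic_on UNIV" and per: "\<And>z. g (z + 2 * of_real pi) = g z"
  shows "\<exists>I. \<forall>s. ((\<lambda>t. g (of_real t + \<i> * of_real s)) has_integral I) {0..2 * pi}"
proof -
  obtain H where H: "(H has_field_derivative g z) (at z)" for z
    using holomorphic_convex_primitive' [OF convex_UNIV open_UNIV hol] by auto
  have "((\<lambda>z. H (z + 2 * of_real pi) - H z) has_field_derivative 0) (at z)" for z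
  proof -
    have "((\<lambda>z. H (z + 2 * of_real pi)) has_field_derivative g (z + 2 * of_real pi)) (at z)"
      using H [of "z + 2 * of_real pi"] DERIV_shift [of H "g (z + 2 * of_real pi)" z "2 * of_real pi"] by simp
    from DERIV_diff [OF this H] show ?thesis by (simp add: per)
  qed
  then obtain I where I: "H (z + 2 * of_real pi) - H z = I" for z
    using has_field_derivative_zero_constant [of UNIV "\<lambda>z. H (z + 2 * of_real pi) - H z"] by auto
  \<comment> \<open>\<open>I\<close> is the increment of the primitive over one period. It is the
    same from every starting point, hence on every horizontal line.\<close>
  have "((\<lambda>t. g (of_real t + \<i> * of_real s)) has_integral I) {0..2 * pi}" for s
  proof -
    have "((\<lambda>t. g (of_real t + \<i> * of_real s)) has_integral
        (H (of_real (2 * pi) + \<i> * of_real s) - H (of_real 0 + \<i> * of_real s))) {0..2 * pi}"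
    proof (rule fundamental_theorem_of_calculus)
      fix t :: real
      have "((\<lambda>t. of_real t + \<i> * of_real s) has_vector_derivative 1) (at t within {0..2 * pi})"
        by (auto intro!: derivative_eq_intros)
      from field_vector_diff_chain_within [OF this DERIV_subset [OF H subset_UNIV]]
      show "((\<lambda>t. H (of_real t + \<i> * of_real s)) has_vector_derivative
          g (of_real t + \<i> * of_real s)) (at t within {0..2 * pi})"
        by (simp add: o_def)
    qed simp
    also have "H (of_real (2 * pi) + \<i> * of_real s) - H (of_real 0 + \<i> * of_real s) = I"
      using I [of "\<i> * of_real s"] by (simp add: add.commute)
    finally show ?thesis .
  qed
  thus ?thesis by blast
qed

text \<open>Testing against a state reduces Banach space valued extensions to scalar complex
  analysis.\<close>

lemma entire_extension_holomorphic:
  assumes "entire_extension \<sigma> x F" and \<psi>: "is_state \<psi>"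
  shows "(\<lambda>z. \<psi> (y * F z)) holomorphic_on UNIV"
proof -
  have "\<exists>D. ((\<lambda>z. \<psi> (y * F z)) has_field_derivative D) (at z)" for z
  proof -
    obtain D where D: "(F has_derivative (\<lambda>h. h *\<^sub>C D)) (at z)"
      using assms(1) unfolding entire_extension_def by blast
    have "bounded_linear (\<lambda>x. \<psi> (y * x))"
      by (rule bounded_linear_compose [OF is_state_bounded_linear [OF \<psi>] bounded_linear_mult_right])
    from bounded_linear.has_derivative [OF this D]
    have "((\<lambda>z. \<psi> (y * F z)) has_derivative (\<lambda>h. \<psi> (y * D) * h)) (at z)"
      by (simp add: mult_scaleC_right is_stateD [OF \<psi>] mult.commute)
    thus ?thesis by (auto simp: has_field_derivative_def)
  qed
  thus ?thesis by (auto simp: holomorphic_on_def field_differentiable_def)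
qed

text \<open>The entire function \<open>\<psi> (y * F z)\<close> equals
  \<open>\<psi> (y * \<sigma> t x)\<close> on the real line and
  \<open>\<psi> (\<sigma> t x * y)\<close> on Im z = \<beta>, and it inherits the period of the
  flow. The weight exp(- \<i> n z) selects the n-th coefficient; on the upper line it has the extra
  factor exp(n \<beta>), whose inverse is the ratio of the two coefficients.\<close>

lemma KMS_fourier_coefficient:
  assumes \<psi>: "is_state \<psi>"
    and kms: "\<And>x. x \<in> D \<Longrightarrow> \<exists>F. entire_extension \<sigma> x F \<and>
           (\<forall>y\<in>D. \<psi> (x * y) = \<psi> (y * F (\<i> * complex_of_real \<beta>)))"
    and inv: "\<And>t x. x \<in> D \<Longrightarrow> \<sigma> t x \<in> D"
    and group: "\<And>s t y x. \<psi> (y * \<sigma> s (\<sigma> t x)) = \<psi> (y * \<sigma> (s + t) x)"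
    and per: "\<And>t. \<sigma> (t + 2 * pi) = \<sigma> t"
    and x: "x \<in> D" and y: "y \<in> D"
  shows "\<exists>I. ((\<lambda>t. exp (- (\<i> * of_int n * of_real t)) * \<psi> (y * \<sigma> t x)) has_integral I) {0..2 * pi} \<and>
    ((\<lambda>t. exp (- (\<i> * of_int n * of_real t)) * \<psi> (\<sigma> t x * y)) has_integral
       of_real (exp (- (of_int n * \<beta>))) * I) {0..2 * pi}"
proof -
  obtain F where F: "entire_extension \<sigma> x F" using kms [OF x] by blast
  define g where "g z = \<psi> (y * F z)" for z
  have g_hol: "g holomorphic_on UNIV"
    unfolding g_def using F \<psi> by (rule entire_extension_holomorphic)
  have g_real: "g (of_real t) = \<psi> (y * \<sigma> t x)" for t
    using F by (simp add: g_def entire_extension_def)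
  have g_shift: "g (of_real t + \<i> * of_real \<beta>) = \<psi> (\<sigma> t x * y)" for t
  proof -
    obtain F' where F': "entire_extension \<sigma> (\<sigma> t x) F'"
      "\<psi> (\<sigma> t x * y) = \<psi> (y * F' (\<i> * complex_of_real \<beta>))"
      using kms [OF inv [OF x]] y by blast
    \<comment> \<open>As seen by \<psi>, the extension \<open>F'\<close> supplied for
      \<open>\<sigma> t x\<close> is the translate of \<open>F\<close> by \<open>t\<close>: both are
      entire and agree on the reals by the group law.\<close>
    have "(\<lambda>z. \<psi> (y * F' z)) (\<i> * complex_of_real \<beta>) =
        (\<lambda>z. g (z + of_real t)) (\<i> * complex_of_real \<beta>)"
    proof (rule entire_eq_on_reals [of "\<lambda>z. \<psi> (y * F' z)" "\<lambda>z. g (z + of_real t)"])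
      show "(\<lambda>z. \<psi> (y * F' z)) holomorphic_on UNIV"
        using F'(1) \<psi> by (rule entire_extension_holomorphic)
      have "g \<circ> (\<lambda>z. z + of_real t) holomorphic_on UNIV"
        by (intro holomorphic_on_compose_gen [OF _ g_hol] holomorphic_intros) auto
      thus "(\<lambda>z. g (z + of_real t)) holomorphic_on UNIV" by (simp add: o_def)
      show "\<psi> (y * F' (of_real s)) = g (of_real s + of_real t)" for s
        using F'(1) group [of y s t x] g_real [of "s + t"] by (simp add: entire_extension_def)
    qed
    with F'(2) show ?thesis by (simp add: add.commute)
  qed
  have g_per: "g (z + 2 * of_real pi) = g z" for z
  proof -
    have "g \<circ> (\<lambda>z. z + 2 * of_real pi) holomorphic_on UNIV"
      by (intro holomorphic_on_compose_gen [OF _ g_hol] holomorphic_intros) auto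
    hence "(\<lambda>z. g (z + 2 * of_real pi)) holomorphic_on UNIV" by (simp add: o_def)
    from entire_eq_on_reals [OF this g_hol, of z] show ?thesis
      using g_real per by (metis of_real_add of_real_mult of_real_numeral)
  qed
  let ?G = "\<lambda>z. exp (- (\<i> * of_int n * z)) * g z"
  have "?G holomorphic_on UNIV" by (intro holomorphic_intros g_hol)
  moreover have "?G (z + 2 * of_real pi) = ?G z" for z
  proof -
    have "exp (- (\<i> * of_int n * (z + 2 * of_real pi))) =
        exp (- (\<i> * of_int n * z)) * exp (2 * of_int (- n) * of_real pi * \<i>)"
      by (simp add: algebra_simps flip: exp_add)
    also have "exp (2 * of_int (- n) * of_real pi * \<i>) = 1"
      by (simp only: exp_eq_1) (auto intro: exI [of _ "- n"])
    finally show ?thesis by (simp add: g_per)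
  qed
  ultimately obtain I where
    I: "((\<lambda>t. ?G (of_real t + \<i> * of_real s)) has_integral I) {0..2 * pi}" for s
    using periodic_entire_integral_shift [of ?G] by blast
  have "((\<lambda>t. exp (- (\<i> * of_int n * of_real t)) * \<psi> (y * \<sigma> t x)) has_integral I) {0..2 * pi}"
    using I [of 0] by (simp add: g_real)
  moreover have "((\<lambda>t. of_real (exp (- (of_int n * \<beta>))) * ?G (of_real t + \<i> * of_real \<beta>)) has_integral
      of_real (exp (- (of_int n * \<beta>))) * I) {0..2 * pi}"
    using I [of \<beta>] by (rule has_integral_mult_right)
  moreover have "of_real (exp (- (of_int n * \<beta>))) * ?G (of_real t + \<i> * of_real \<beta>) =
      exp (- (\<i> * of_int n * of_real t)) * \<psi> (\<sigma> t x * y)" for t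
  proof -
    have "of_real (exp (- (of_int n * \<beta>))) * exp (- (\<i> * of_int n * (of_real t + \<i> * of_real \<beta>))) =
        exp (- (\<i> * of_int n * of_real t))"
      by (simp add: algebra_simps flip: exp_of_real exp_add)
    thus ?thesis by (simp add: g_shift flip: mult.assoc)
  qed
  ultimately show ?thesis by auto
qed

text \<open>An element of degree \<open>n\<close> need not lie in \<open>D\<close>, but its \<open>n\<close>-th Fourier coefficient is
  approximated by those of the elements of \<open>D\<close>.\<close>

lemma KMS_homogeneous:
  assumes \<psi>: "is_state \<psi>" and D: "closure D = UNIV"
    and kms: "\<And>x. x \<in> D \<Longrightarrow> \<exists>F. entire_extension \<sigma> x F \<and>
           (\<forall>y\<in>D. \<psi> (x * y) = \<psi> (y * F (\<i> * complex_of_real \<beta>)))"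
    and inv: "\<And>t x. x \<in> D \<Longrightarrow> \<sigma> t x \<in> D"
    and hom: "\<And>t. unital_star_hom (\<sigma> t)"
    and group: "\<And>s t y x. \<psi> (y * \<sigma> s (\<sigma> t x)) = \<psi> (y * \<sigma> (s + t) x)"
    and per: "\<And>t. \<sigma> (t + 2 * pi) = \<sigma> t"
    and deg: "\<And>t. \<sigma> t u = exp (\<i> * of_int n * of_real t) *\<^sub>C u"
  shows "\<psi> (u * y) = of_real (exp (- (of_int n * \<beta>))) * \<psi> (y * u)"
proof -
  define q where "q = exp (- (of_int n * \<beta>))"
  have q: "q > 0" by (simp add: q_def)
  define e where "e t = exp (- (\<i> * of_int n * of_real t))" for t
  have e: "cmod (e t) = 1" for t by (simp add: e_def)
  \<comment> \<open>The twisted flow fixes \<open>u\<close>, so the n-th Fourier integrals of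
    \<open>u\<close> are 2 pi times \<open>\<psi> (y * u)\<close> and
    \<open>\<psi> (u * y)\<close>.\<close>
  have deg': "e t *\<^sub>C \<sigma> t u = u" for t
    by (simp add: e_def deg scaleC_scaleC flip: exp_add)
  note st = is_stateD [OF \<psi>]
  have inD: "\<psi> (u * y) = of_real q * \<psi> (y * u)" if y: "y \<in> D" for y
  proof -
    \<comment> \<open>The two coefficients of \<open>x\<close> have the exact ratio
      \<open>q\<close>; replacing \<open>x\<close> by \<open>u\<close> changes each by at most
      \<open>norm y * norm (x - u) * (2 * pi)\<close>.\<close>
    have *: "cmod (\<psi> (u * y) - of_real q * \<psi> (y * u)) \<le> (1 + q) * (norm y * norm (x - u))"
      if x: "x \<in> D" for x
    proof -
      from KMS_fourier_coefficient [OF \<psi> kms inv group per x y, of n]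
      obtain I where I: "((\<lambda>t. e t * \<psi> (y * \<sigma> t x)) has_integral I) {0..2 * pi}"
          "((\<lambda>t. e t * \<psi> (\<sigma> t x * y)) has_integral of_real q * I) {0..2 * pi}"
        by (auto simp: e_def q_def)
      have 1: "((\<lambda>t. e t * \<psi> (y * \<sigma> t x) - \<psi> (y * u)) has_integral (I - (2 * pi) *\<^sub>R \<psi> (y * u))) (cbox 0 (2 * pi))"
        using has_integral_diff [OF I(1) has_integral_const_real [of "\<psi> (y * u)" 0 "2 * pi"]] by simp
      have 2: "((\<lambda>t. e t * \<psi> (\<sigma> t x * y) - \<psi> (u * y)) has_integral (of_real q * I - (2 * pi) *\<^sub>R \<psi> (u * y))) (cbox 0 (2 * pi))"
        using has_integral_diff [OF I(2) has_integral_const_real [of "\<psi> (u * y)" 0 "2 * pi"]] by simp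
      have "e t * \<psi> (y * \<sigma> t x) - \<psi> (y * u) = e t * \<psi> (y * \<sigma> t (x - u))"
           "e t * \<psi> (\<sigma> t x * y) - \<psi> (u * y) = e t * \<psi> (\<sigma> t (x - u) * y)" for t
      proof -
        have "\<psi> (y * u) = e t * \<psi> (y * \<sigma> t u)" "\<psi> (u * y) = e t * \<psi> (\<sigma> t u * y)"
          by (metis deg' mult_scaleC_right st(2), metis deg' mult_scaleC_left st(2))
        thus "e t * \<psi> (y * \<sigma> t x) - \<psi> (y * u) = e t * \<psi> (y * \<sigma> t (x - u))"
           "e t * \<psi> (\<sigma> t x * y) - \<psi> (u * y) = e t * \<psi> (\<sigma> t (x - u) * y)"
          by (simp_all add: unital_star_homD(8) [OF hom] right_diff_distrib left_diff_distrib st)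
      qed
      hence bd: "cmod (e t * \<psi> (y * \<sigma> t x) - \<psi> (y * u)) \<le> norm y * norm (x - u)"
            "cmod (e t * \<psi> (\<sigma> t x * y) - \<psi> (u * y)) \<le> norm y * norm (x - u)" for t
        using is_state_mult_le(1) [OF \<psi> hom, of y t "x - u"] is_state_mult_le(2) [OF \<psi> hom, of t "x - u" y]
        by (simp_all add: norm_mult e mult.commute)
      have 3: "cmod (I - (2 * pi) *\<^sub>R \<psi> (y * u)) \<le> norm y * norm (x - u) * (2 * pi)"
        using has_integral_bound [OF _ 1] bd(1) by simp
      have 4: "cmod (of_real q * I - (2 * pi) *\<^sub>R \<psi> (u * y)) \<le> norm y * norm (x - u) * (2 * pi)"
        using has_integral_bound [OF _ 2] bd(2) by simp
      have "(2 * pi) *\<^sub>R (\<psi> (u * y) - of_real q * \<psi> (y * u)) =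
          of_real q * (I - (2 * pi) *\<^sub>R \<psi> (y * u)) - (of_real q * I - (2 * pi) *\<^sub>R \<psi> (u * y))"
        by (simp add: algebra_simps scaleR_conv_of_real)
      hence "2 * pi * cmod (\<psi> (u * y) - of_real q * \<psi> (y * u)) =
          cmod (of_real q * (I - (2 * pi) *\<^sub>R \<psi> (y * u)) - (of_real q * I - (2 * pi) *\<^sub>R \<psi> (u * y)))"
        by (metis abs_of_pos norm_scaleR pi_gt_zero mult_pos_pos zero_less_numeral)
      also have "\<dots> \<le> q * cmod (I - (2 * pi) *\<^sub>R \<psi> (y * u)) + cmod (of_real q * I - (2 * pi) *\<^sub>R \<psi> (u * y))"
        using norm_triangle_ineq4 [of "of_real q * (I - (2 * pi) *\<^sub>R \<psi> (y * u))"] q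
        by (metis abs_of_pos norm_mult norm_of_real)
      also have "\<dots> \<le> q * (norm y * norm (x - u) * (2 * pi)) + norm y * norm (x - u) * (2 * pi)"
        using 3 4 q by (intro add_mono mult_left_mono) auto
      also have "\<dots> = 2 * pi * ((1 + q) * (norm y * norm (x - u)))"
        by (simp add: algebra_simps)
      finally show ?thesis by (subst (asm) mult_le_cancel_left_pos) simp_all
    qed
    have "u \<in> closure D" using D by simp
    then obtain f where f: "\<And>k. f k \<in> D" "f \<longlonglongrightarrow> u" unfolding closure_sequential by blast
    have "(\<lambda>k. (1 + q) * (norm y * norm (f k - u))) \<longlonglongrightarrow> (1 + q) * (norm y * norm (u - u))"
      by (intro tendsto_intros f)
    hence "cmod (\<psi> (u * y) - of_real q * \<psi> (y * u)) \<le> (1 + q) * (norm y * norm (u - u))"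
      by (rule LIMSEQ_le_const) (use * f in blast)
    thus ?thesis by simp
  qed
  \<comment> \<open>For fixed \<open>u\<close> both sides are continuous in \<open>y\<close>, so
    \<open>y\<close> may leave \<open>D\<close>.\<close>
  have "closed {y. \<psi> (u * y) = of_real q * \<psi> (y * u)}"
    by (intro closed_Collect_eq continuous_intros continuous_on_state \<psi>)
  from closure_minimal [OF _ this, of D] show ?thesis
    using inD D unfolding q_def by blast
qed

section \<open>The KMS states of the Cuntz-Pimsner algebra\<close>

lemma card_words: "card {w :: 'd::finite list. length w = n} = CARD('d) ^ n"
  using card_lists_length_eq [of "UNIV :: 'd set" n] by simp

lemma sum_words_Suc:
  "(\<Sum>w\<in>{w :: 'd::finite list. length w = Suc n}. g w) =
     (\<Sum>i\<in>UNIV. \<Sum>w\<in>{w. length w = n}. g (i # w))"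
proof -
  have "{w :: 'd list. length w = Suc n} = (\<lambda>(i, w). i # w) ` (UNIV \<times> {w. length w = n})"
    by (auto simp: length_Suc_conv image_iff)
  moreover have "inj_on (\<lambda>(i :: 'd, w). i # w) (UNIV \<times> {w. length w = n})"
    by (auto simp: inj_on_def)
  ultimately show ?thesis
    by (simp add: sum.reindex sum.cartesian_product case_prod_unfold)
qed

lemma sum_words_rev:
  "(\<Sum>w\<in>{w :: 'd::finite list. length w = n}. g (rev w)) = (\<Sum>w\<in>{w. length w = n}. g w)"
  by (rule sum.reindex_bij_witness [of _ rev rev]) auto

lemma bounded_linear_scaleC_left: "bounded_linear (\<lambda>c. c *\<^sub>C (x::'a::cstar_algebra))"
  by (rule bounded_linear_intro [of _ "norm x"])
     (simp_all add: scaleC_add_left norm_scaleC scaleR_conv_of_real scaleC_of_real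
        flip: scaleC_scaleC)

lemma continuous_on_state_hom:
  assumes "is_state \<psi>" "unital_star_hom f"
  shows "continuous_on X (\<lambda>x. \<psi> (y * f x))"
proof -
  have "bounded_linear (\<lambda>x. \<psi> (y * f x))"
    using is_state_mult_le(1) [OF assms, of y]
    by (intro bounded_linear_intro [of _ "norm y"])
       (simp_all add: unital_star_homD(1,9) [OF assms(2)] is_stateD(1,7) [OF assms(1)]
         distrib_left mult.commute, simp add: scaleR_conv_of_real)
  from bounded_linear.continuous_on [OF this continuous_on_id] show ?thesis by simp
qed

lemma star_subalgebra_range_free_eval:
  "star_subalgebra (range (free_eval (h :: 'g \<Rightarrow> 'b::cstar_algebra)))"
  unfolding star_subalgebra_def
proof (safe)
  show "0 \<in> range (free_eval h)" using free_eval_zero [of h] by (metis rangeI)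
next
  fix p q :: "'g free_star_algebra"
  show "free_eval h p + free_eval h q \<in> range (free_eval h)"
    "free_eval h p * free_eval h q \<in> range (free_eval h)"
    "star (free_eval h p) \<in> range (free_eval h)"
    "c *\<^sub>C free_eval h p \<in> range (free_eval h)" for c
    by (simp_all flip: free_eval_add free_eval_mult free_eval_star free_eval_scale)
qed

section \<open>Degrees of words under the gauge flow\<close>

fun letter_degree :: "('a + 'd) \<times> bool \<Rightarrow> int" where
  "letter_degree (Inl a, e) = 0"
| "letter_degree (Inr i, e) = (if e then -1 else 1)"

definition word_degree :: "(('a + 'd) \<times> bool) list \<Rightarrow> int" where
  "word_degree w = (\<Sum>x\<leftarrow>w. letter_degree x)"

lemma unital_star_hom_word_eval:
  "unital_star_hom f \<Longrightarrow> f (word_eval h w) = word_eval (\<lambda>x. f (h x)) w"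
  by (induction w) (auto simp: word_eval_def unital_star_homD)

lemma word_endo_Nil [simp]: "word_endo \<alpha> [] a = a"
  and word_endo_Cons [simp]: "word_endo \<alpha> (i # w) a = \<alpha> i (word_endo \<alpha> w a)"
  and word_endo_append [simp]: "word_endo \<alpha> (v @ w) a = word_endo \<alpha> v (word_endo \<alpha> w a)"
  by (simp_all add: word_endo_def)

lemma word_prod_Nil [simp]: "word_prod S [] = 1"
  and word_prod_Cons [simp]: "word_prod S (i # w) = S i * word_prod S w"
  by (simp_all add: word_prod_def)

text \<open>\<open>c\<close> is a parameter pinned down by \<open>c_def\<close>, so that it can be
  instantiated with the literal constant of the theorem.\<close>

locale cuntz_pimsner_gauge =
  fixes \<alpha> :: "'d::finite \<Rightarrow> 'a \<Rightarrow> 'a::cstar_algebra"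
    and \<iota> :: "'a \<Rightarrow> 'b::cstar_algebra"
    and S :: "'d \<Rightarrow> 'b"
    and \<gamma> :: "complex \<Rightarrow> 'b \<Rightarrow> 'b"
    and \<sigma> :: "real \<Rightarrow> 'b \<Rightarrow> 'b"
    and \<beta> :: real and c :: real
  assumes dynamical: "cstar_dynamical_system \<alpha>"
    and algebra: "cuntz_pimsner_algebra \<alpha> \<iota> S"
    and gauge: "gauge_action \<iota> S \<gamma>"
    and flow: "\<sigma> t = \<gamma> (exp (\<i> * complex_of_real t))"
    and beta: "\<beta> > ln (real CARD('d))"
    and c_def: "c = 1 - exp (- \<beta>) * real CARD('d)"
begin

lemma alpha_hom: "unital_star_hom (\<alpha> i)"
  using dynamical by (simp add: cstar_dynamical_system_def)

lemma word_endo_hom: "unital_star_hom (word_endo \<alpha> w)"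
  by (induction w)
     (use alpha_hom in \<open>simp_all add: unital_star_hom_def\<close>)

lemma relations: "\<forall>r\<in>cuntz_pimsner_relations \<alpha>. free_eval (case_sum \<iota> S) r = 0"
  and dense: "closure (range (free_eval (case_sum \<iota> S))) = UNIV"
  using algebra by (simp_all add: cuntz_pimsner_algebra_def universal_cstar_algebra_def)

lemma iota_hom: "unital_star_hom \<iota>"
  and isometry: "star (S i) * S j = (if i = j then 1 else 0)"
  and iota_S: "\<iota> a * S i = S i * \<iota> (\<alpha> i a)"
  and covariance: "a \<in> covariance_ideal \<alpha> \<Longrightarrow> \<iota> a * (1 - (\<Sum>i\<in>UNIV. S i * star (S i))) = 0"
  using relations unfolding cuntz_pimsner_relations_iff by blast+

lemma star_S_iota: "star (S i) * \<iota> a = \<iota> (\<alpha> i a) * star (S i)"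
proof -
  have "star (\<iota> (star a) * S i) = star (S i * \<iota> (\<alpha> i (star a)))" by (simp only: iota_S)
  thus ?thesis
    by (simp add: star_mult unital_star_homD [OF iota_hom] unital_star_homD [OF alpha_hom] star_star)
qed

lemma flow_hom: "unital_star_hom (\<sigma> t)"
  and flow_iota: "\<sigma> t (\<iota> a) = \<iota> a"
  and flow_S: "\<sigma> t (S i) = exp (\<i> * of_real t) *\<^sub>C S i"
  using gauge unfolding gauge_action_def flow star_automorphism_def by (simp_all add: norm_exp_i_times)

lemma flow_word_eval:
  "\<sigma> t (word_eval (case_sum \<iota> S) w) =
     exp (\<i> * of_int (word_degree w) * of_real t) *\<^sub>C word_eval (case_sum \<iota> S) w"
proof (induction w)
  case (Cons x w)
  obtain g e where x: "x = (g, e)" by (cases x)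
  have letter: "\<sigma> t (if e then star (case_sum \<iota> S g) else case_sum \<iota> S g) =
      exp (\<i> * of_int (letter_degree x) * of_real t) *\<^sub>C (if e then star (case_sum \<iota> S g) else case_sum \<iota> S g)"
    unfolding x
    by (cases g) (auto simp: unital_star_homD [OF flow_hom] flow_iota flow_S star_scaleC exp_cnj)
  have "\<sigma> t (word_eval (case_sum \<iota> S) (x # w)) =
      \<sigma> t (if e then star (case_sum \<iota> S g) else case_sum \<iota> S g) * \<sigma> t (word_eval (case_sum \<iota> S) w)"
    by (simp add: word_eval_def x unital_star_homD(3) [OF flow_hom])
  also have "\<dots> = exp (\<i> * of_int (word_degree (x # w)) * of_real t) *\<^sub>C
      ((if e then star (case_sum \<iota> S g) else case_sum \<iota> S g) * word_eval (case_sum \<iota> S) w)"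
    by (simp add: letter Cons.IH mult_scaleC_left mult_scaleC_right scaleC_scaleC word_degree_def
        distrib_left distrib_right exp_add mult.commute)
  finally show ?case by (simp add: word_eval_def x)
qed (simp add: word_eval_def word_degree_def unital_star_homD [OF flow_hom])

text \<open>The automorphisms are given one by one, so the group law is visible on the generators
  first. It reaches the closure behind \<psi>, where \<open>continuous_on_state_hom\<close> supplies
  continuity.\<close>

lemma state_flow_add:
  assumes \<psi>: "is_state \<psi>"
  shows "\<psi> (y * \<sigma> s (\<sigma> t x)) = \<psi> (y * \<sigma> (s + t) x)"
proof -
  have "closed {x. \<psi> (y * \<sigma> s (\<sigma> t x)) = \<psi> (y * \<sigma> (s + t) x)}"
    using continuous_on_state_hom [OF \<psi> unital_star_hom_compose [OF flow_hom flow_hom]]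
      continuous_on_state_hom [OF \<psi> flow_hom]
    by (intro closed_Collect_eq)
  moreover have "\<sigma> s (\<sigma> t (case_sum \<iota> S x)) = \<sigma> (s + t) (case_sum \<iota> S x)" for x
    by (cases x) (simp_all add: flow_iota flow_S unital_star_homD(2) [OF flow_hom] scaleC_scaleC
        distrib_left exp_add mult.commute)
  hence "range (free_eval (case_sum \<iota> S)) \<subseteq> {x. \<psi> (y * \<sigma> s (\<sigma> t x)) = \<psi> (y * \<sigma> (s + t) x)}"
    by (auto simp: unital_star_hom_free_eval flow_hom)
  ultimately show ?thesis
    using closure_minimal dense by blast
qed

text \<open>Words are eigenvectors, so the flow only changes the coefficients of a polynomial in the
  generators.\<close>

lemma flow_range:
  assumes "x \<in> range (free_eval (case_sum \<iota> S))"
  shows "\<sigma> t x \<in> range (free_eval (case_sum \<iota> S))"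
proof -
  let ?h = "case_sum \<iota> S"
  obtain p where p: "x = free_eval ?h p" using assms by blast
  have "\<sigma> t x = (\<Sum>w\<in>Poly_Mapping.keys p. Poly_Mapping.lookup p w *\<^sub>C \<sigma> t (word_eval ?h w))"
    by (simp add: p unital_star_hom_free_eval flow_hom unital_star_hom_word_eval)
       (simp add: free_eval_def)
  also have "\<dots> = free_eval ?h (\<Sum>w\<in>Poly_Mapping.keys p. Poly_Mapping.single w
      (Poly_Mapping.lookup p w * exp (\<i> * of_int (word_degree w) * of_real t)))"
    by (simp add: free_eval_sum free_eval_single flow_word_eval scaleC_scaleC)
  finally show ?thesis by simp
qed

text \<open>Conjugating the relation for \<open>S i\<close> at \<open>star y\<close> reverses both
  products, which inverts the factor.\<close>

lemma KMS_on_generators_star_S: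
  assumes "KMS_on_generators \<iota> S \<beta> \<psi>"
  shows "\<psi> (star (S i) * y) = of_real (exp \<beta>) * \<psi> (y * star (S i))"
proof -
  have \<psi>: "is_state \<psi>" and S: "\<psi> (S i * star y) = of_real (exp (- \<beta>)) * \<psi> (star y * S i)"
    using assms by (auto simp: KMS_on_generators_def)
  from S have "cnj (\<psi> (S i * star y)) = of_real (exp (- \<beta>)) * cnj (\<psi> (star y * S i))" by simp
  hence "\<psi> (y * star (S i)) = of_real (exp (- \<beta>)) * \<psi> (star (S i) * y)"
    by (simp add: star_mult star_star flip: is_state_star [OF \<psi>])
  thus ?thesis by (simp add: mult.assoc [symmetric] exp_minus flip: of_real_mult)
qed

text \<open>The letters are moved around cyclically one at a time, and their degrees add up in the
  exponent.\<close>

lemma KMS_on_generators_word: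
  assumes "KMS_on_generators \<iota> S \<beta> \<psi>"
  shows "\<psi> (word_eval (case_sum \<iota> S) w * y) =
    of_real (exp (- (of_int (word_degree w) * \<beta>))) * \<psi> (y * word_eval (case_sum \<iota> S) w)"
proof (induction w arbitrary: y)
  case (Cons x w)
  obtain g e where x: "x = (g, e)" by (cases x)
  let ?g = "if e then star (case_sum \<iota> S g) else case_sum \<iota> S g"
  have letter: "\<psi> (?g * y) = of_real (exp (- (of_int (letter_degree x) * \<beta>))) * \<psi> (y * ?g)" for y
    using assms KMS_on_generators_star_S [OF assms]
    unfolding x KMS_on_generators_def
    by (cases g) (auto simp flip: unital_star_homD(4) [OF iota_hom])
  have "\<psi> (word_eval (case_sum \<iota> S) (x # w) * y) = \<psi> (?g * (word_eval (case_sum \<iota> S) w * y))"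
    by (simp add: word_eval_def x mult.assoc)
  also have "\<dots> = of_real (exp (- (of_int (letter_degree x) * \<beta>))) *
      \<psi> (word_eval (case_sum \<iota> S) w * (y * ?g))"
    by (simp only: letter mult.assoc)
  also have "\<dots> = of_real (exp (- (of_int (letter_degree x) * \<beta>)) *
      exp (- (of_int (word_degree w) * \<beta>))) * \<psi> (y * (?g * word_eval (case_sum \<iota> S) w))"
    by (simp add: Cons.IH mult.assoc)
  also have "exp (- (of_int (letter_degree x) * \<beta>)) * exp (- (of_int (word_degree w) * \<beta>)) =
      exp (- (of_int (word_degree (x # w)) * \<beta>))"
    by (simp add: word_degree_def distrib_right mult_exp_exp)
  finally show ?case by (simp add: word_eval_def x)
qed (simp add: word_eval_def word_degree_def)

text \<open>The polynomials in the generators serve as the subalgebra. The flow multiplies a word by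
  an exponential, so the extension is a finite sum of exponentials; at \<i> \<beta> the one of
  degree n becomes exp(- n \<beta>), the constant of \<open>KMS_on_generators_word\<close>.\<close>

lemma KMS_on_generators_imp_KMS_state:
  assumes kms: "KMS_on_generators \<iota> S \<beta> \<psi>"
  shows "KMS_state \<sigma> \<beta> \<psi>"
proof -
  let ?h = "case_sum \<iota> S"
  have \<psi>: "is_state \<psi>" using kms by (simp add: KMS_on_generators_def)
  have "\<exists>F. entire_extension \<sigma> (free_eval ?h p) F \<and>
      (\<forall>y. \<psi> (free_eval ?h p * y) = \<psi> (y * F (\<i> * complex_of_real \<beta>)))" for p
  proof -
    define F where "F z = (\<Sum>w\<in>Poly_Mapping.keys p.
        (Poly_Mapping.lookup p w * exp (\<i> * of_int (word_degree w) * z)) *\<^sub>C word_eval ?h w)" for z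
    have "\<exists>D. (F has_derivative (\<lambda>h. h *\<^sub>C D)) (at z)" for z
    proof -
      let ?d = "\<lambda>w. Poly_Mapping.lookup p w * (exp (\<i> * of_int (word_degree w) * z) * (\<i> * of_int (word_degree w)))"
      have "((\<lambda>z. Poly_Mapping.lookup p w * exp (\<i> * of_int (word_degree w) * z)) has_derivative
          (\<lambda>h. ?d w * h)) (at z)" for w
        unfolding has_field_derivative_def [symmetric]
        by (auto intro!: derivative_eq_intros)
      hence "(F has_derivative (\<lambda>h. \<Sum>w\<in>Poly_Mapping.keys p. (?d w * h) *\<^sub>C word_eval ?h w)) (at z)"
        unfolding F_def
        by (intro has_derivative_sum bounded_linear.has_derivative [OF bounded_linear_scaleC_left])
      moreover have "(\<Sum>w\<in>Poly_Mapping.keys p. (?d w * h) *\<^sub>C word_eval ?h w) =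
          h *\<^sub>C (\<Sum>w\<in>Poly_Mapping.keys p. ?d w *\<^sub>C word_eval ?h w)" for h
        by (simp add: bounded_linear.linear [OF bounded_linear_scaleC, THEN linear_sum]
            scaleC_scaleC mult_ac)
      ultimately show ?thesis by auto
    qed
    moreover have "F (complex_of_real t) = \<sigma> t (free_eval ?h p)" for t
      by (simp add: F_def unital_star_hom_free_eval flow_hom)
         (simp add: free_eval_def flow_word_eval scaleC_scaleC
            flip: unital_star_hom_word_eval [OF flow_hom])
    moreover have "\<psi> (free_eval ?h p * y) = \<psi> (y * F (\<i> * complex_of_real \<beta>))" for y
    proof -
      have "exp (\<i> * of_int n * (\<i> * complex_of_real \<beta>)) = of_real (exp (- (of_int n * \<beta>)))" for n
      proof -
        have "\<i> * of_int n * (\<i> * complex_of_real \<beta>) = of_real (- (of_int n * \<beta>))"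
          by (simp add: complex_eq_iff)
        thus ?thesis by (simp only: exp_of_real)
      qed
      thus ?thesis
        by (simp add: free_eval_def F_def sum_distrib_left sum_distrib_right is_stateD [OF \<psi>]
            mult_scaleC_left mult_scaleC_right KMS_on_generators_word [OF kms] mult.assoc)
    qed
    ultimately show ?thesis unfolding entire_extension_def by blast
  qed
  hence "\<forall>x\<in>range (free_eval ?h). \<exists>F. entire_extension \<sigma> x F \<and>
      (\<forall>y\<in>range (free_eval ?h). \<psi> (x * y) = \<psi> (y * F (\<i> * complex_of_real \<beta>)))"
    by blast
  moreover have "\<sigma> t ` range (free_eval ?h) \<subseteq> range (free_eval ?h)" for t
    using flow_range by blast
  ultimately show ?thesis
    unfolding KMS_state_def using \<psi> star_subalgebra_range_free_eval [of ?h] dense by blast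
qed

lemma KMS_state_imp_KMS_on_generators:
  assumes "KMS_state \<sigma> \<beta> \<psi>"
  shows "KMS_on_generators \<iota> S \<beta> \<psi>"
proof -
  from assms have \<psi>: "is_state \<psi>" by (simp add: KMS_state_def)
  from assms obtain D where D: "closure D = UNIV" "\<forall>t. \<sigma> t ` D \<subseteq> D"
    "\<forall>x\<in>D. \<exists>F. entire_extension \<sigma> x F \<and>
           (\<forall>y\<in>D. \<psi> (x * y) = \<psi> (y * F (\<i> * complex_of_real \<beta>)))"
    unfolding KMS_state_def by (elim conjE exE) (rule that)
  have per: "\<sigma> (t + 2 * pi) = \<sigma> t" for t
    by (simp add: flow algebra_simps exp_add)
  have inv: "\<sigma> t x \<in> D" if "x \<in> D" for t x using D(2) that by blast
  note homogeneous = KMS_homogeneous [OF \<psi> D(1) bspec [OF D(3)] inv flow_hom state_flow_add [OF \<psi>] per]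
  have "\<psi> (\<iota> a * y) = \<psi> (y * \<iota> a)" for a y
    using homogeneous [of "\<iota> a" 0 y] by (simp add: flow_iota)
  moreover have "\<psi> (S i * y) = of_real (exp (- \<beta>)) * \<psi> (y * S i)" for i y
    using homogeneous [of "S i" 1 y] by (simp add: flow_S)
  ultimately show ?thesis using \<psi> by (simp add: KMS_on_generators_def)
qed

lemma KMS_state_iff: "KMS_state \<sigma> \<beta> \<psi> \<longleftrightarrow> KMS_on_generators \<iota> S \<beta> \<psi>"
  using KMS_state_imp_KMS_on_generators KMS_on_generators_imp_KMS_state by blast

end

section \<open>From a KMS state to its trace and its series\<close>

context cuntz_pimsner_gauge
begin

abbreviation defect :: 'b where
  "defect \<equiv> 1 - (\<Sum>i\<in>UNIV. S i * star (S i))"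

text \<open>This is the ratio of the geometric series that dominates all sums over words.\<close>

lemma card_exp_less_1: "real CARD('d) * exp (- \<beta>) < 1"
proof -
  have "real CARD('d) < exp \<beta>"
    using beta by (metis exp_less_mono exp_ln of_nat_0_less_iff zero_less_card_finite)
  thus ?thesis by (simp add: exp_minus field_simps)
qed

lemma c_pos: "c > 0"
  using card_exp_less_1 by (simp add: c_def mult.commute)

lemma beta_pos: "\<beta> > 0"
proof -
  have "0 \<le> ln (real CARD('d))" by simp
  with beta show ?thesis by linarith
qed

lemma iota_range: "\<iota> a * (S i * star (S i)) = (S i * star (S i)) * \<iota> a"
proof -
  have "\<iota> a * (S i * star (S i)) = S i * (\<iota> (\<alpha> i a) * star (S i))"
    by (simp add: iota_S flip: mult.assoc)
  thus ?thesis by (simp add: star_S_iota mult.assoc)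
qed

lemma iota_defect: "\<iota> a * defect = defect * \<iota> a"
  by (simp only: left_diff_distrib right_diff_distrib sum_distrib_left sum_distrib_right iota_range
      mult_1_left mult_1_right)

lemma star_defect: "star defect = defect"
  by (simp add: star_diff star_sum star_mult star_star)

lemma defect_S: "defect * S i = 0"
proof -
  have "(\<Sum>j\<in>UNIV. S j * star (S j)) * S i = (\<Sum>j\<in>UNIV. if j = i then S j else 0)"
    unfolding sum_distrib_right by (rule sum.cong) (simp_all add: mult.assoc isometry)
  thus ?thesis by (simp add: left_diff_distrib)
qed

lemma defect_idem: "defect * defect = defect"
proof -
  have "defect * (\<Sum>i\<in>UNIV. S i * star (S i)) = 0"
    by (simp only: sum_distrib_left mult.assoc [symmetric] defect_S) simp
  hence "defect * 1 - defect * (\<Sum>i\<in>UNIV. S i * star (S i)) = defect" by simp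
  thus ?thesis by (simp only: right_diff_distrib)
qed

context
  fixes \<psi> :: "'b \<Rightarrow> complex"
  assumes kms: "KMS_on_generators \<iota> S \<beta> \<psi>"
begin

lemma kms_state: "is_state \<psi>"
  and kms_iota: "\<psi> (\<iota> a * y) = \<psi> (y * \<iota> a)"
  and kms_S: "\<psi> (S i * y) = of_real (exp (- \<beta>)) * \<psi> (y * S i)"
  using kms by (auto simp: KMS_on_generators_def)

lemmas kms_linear = is_stateD [OF kms_state]

lemma kms_iota_range:
  "\<psi> (\<iota> a * (S i * star (S i))) = of_real (exp (- \<beta>)) * \<psi> (\<iota> (\<alpha> i a))"
proof -
  have "\<psi> (\<iota> a * (S i * star (S i))) = \<psi> (S i * (\<iota> (\<alpha> i a) * star (S i)))"
    by (simp add: iota_S flip: mult.assoc)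
  also have "\<dots> = of_real (exp (- \<beta>)) * \<psi> (\<iota> (\<alpha> i a) * (star (S i) * S i))"
    by (simp add: kms_S mult.assoc)
  finally show ?thesis by (simp add: isometry)
qed

text \<open>Solved for \<open>\<psi> (\<iota> a)\<close>, this is the recursion whose iteration
  gives the series.\<close>

lemma kms_iota_defect:
  "\<psi> (\<iota> a * defect) = \<psi> (\<iota> a) - of_real (exp (- \<beta>)) * (\<Sum>i\<in>UNIV. \<psi> (\<iota> (\<alpha> i a)))"
  by (simp add: right_diff_distrib sum_distrib_left kms_linear kms_iota_range)

text \<open>Outside this context the KMS hypothesis is a premise of the defining equation, whence
  the later \<open>defect_trace_def [OF kms]\<close>.\<close>

definition defect_trace :: "'a \<Rightarrow> complex" where
  "defect_trace a = \<psi> (\<iota> a * defect) / of_real c"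

text \<open>P commutes with the image of A, so \<open>kms_iota\<close> gives the trace property, and
  \<open>\<iota> (star a * a) * defect\<close> is a square because P is a projection. The value of
  \<psi> at P is 1 - d exp(- \<beta>), the origin of \<open>c\<close>. Vanishing on the ideal is the
  covariance relation.\<close>

lemma defect_trace_vanishing: "defect_trace \<in> vanishing_tracial_states \<alpha>"
proof -
  note iota = unital_star_homD [OF iota_hom]
  have "\<psi> (\<iota> (star a * a) * defect) \<in> \<real>\<^sub>\<ge>\<^sub>0" for a
  proof -
    have "star (\<iota> a * defect) * (\<iota> a * defect) = defect * (\<iota> (star a * a) * defect)"
      by (simp only: star_mult star_defect iota mult.assoc)
    also have "\<dots> = \<iota> (star a * a) * defect"
      by (simp only: iota_defect [symmetric] mult.assoc [symmetric])
         (simp only: mult.assoc defect_idem)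
    finally show ?thesis
      using kms_linear(9,10) [of "\<iota> a * defect"] by (simp only: complex_nonneg_Reals_iff)
  qed
  hence "defect_trace (star a * a) \<in> \<real>\<^sub>\<ge>\<^sub>0" for a
    using c_pos unfolding defect_trace_def
    by (metis nonneg_Reals_divide_I nonneg_Reals_of_real_iff less_imp_le)
  moreover have "defect_trace 1 = 1"
  proof -
    have "\<psi> (\<iota> 1 * defect) = of_real c"
      by (subst kms_iota_defect)
         (simp add: iota kms_linear c_def unital_star_homD [OF alpha_hom])
    thus ?thesis using c_pos by (simp add: defect_trace_def)
  qed
  moreover have "defect_trace (a * b) = defect_trace (b * a)" for a b
  proof -
    have "\<psi> (\<iota> a * \<iota> b * defect) = \<psi> (\<iota> b * defect * \<iota> a)"
      by (simp only: mult.assoc kms_iota)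
    also have "\<dots> = \<psi> (\<iota> b * \<iota> a * defect)"
      by (simp only: mult.assoc) (simp only: iota_defect)
    finally show ?thesis by (simp only: defect_trace_def iota)
  qed
  moreover have "defect_trace (a + b) = defect_trace a + defect_trace b"
    "defect_trace (k *\<^sub>C a) = k * defect_trace a" for a b k
    unfolding defect_trace_def
    by (simp_all only: iota distrib_right kms_linear mult_scaleC_left add_divide_distrib
        times_divide_eq_right)
  moreover have "defect_trace a = 0" if "a \<in> covariance_ideal \<alpha>" for a
    using covariance [OF that] by (simp only: defect_trace_def kms_linear div_0)
  ultimately show ?thesis
    by (simp add: vanishing_tracial_states_def is_tracial_state_def is_state_def)
qed

text \<open>Each further use of the recursion applies one more endomorphism outermost, so its letter
  becomes the head of the longer word. The last summand is the remainder.\<close>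

lemma kms_iota_partial_sum:
  "\<psi> (\<iota> a) = of_real c * (\<Sum>m<n. of_real (exp (- (real m * \<beta>))) *
      (\<Sum>w\<in>{w. length w = m}. defect_trace (word_endo \<alpha> w a))) +
    of_real (exp (- (real n * \<beta>))) * (\<Sum>w\<in>{w. length w = n}. \<psi> (\<iota> (word_endo \<alpha> w a)))"
proof (induction n)
  case (Suc n)
  have eq: "\<psi> (\<iota> b) = of_real c * defect_trace b +
      of_real (exp (- \<beta>)) * (\<Sum>i\<in>UNIV. \<psi> (\<iota> (\<alpha> i b)))" for b
    using c_pos kms_iota_defect [of b] by (simp add: defect_trace_def)
  have "(\<Sum>w\<in>{w. length w = n}. \<psi> (\<iota> (word_endo \<alpha> w a))) =
      of_real c * (\<Sum>w\<in>{w. length w = n}. defect_trace (word_endo \<alpha> w a)) +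
      of_real (exp (- \<beta>)) * (\<Sum>w\<in>{w. length w = n}. \<Sum>i\<in>UNIV. \<psi> (\<iota> (\<alpha> i (word_endo \<alpha> w a))))"
    by (subst eq) (simp only: sum.distrib sum_distrib_left)
  also have "(\<Sum>w\<in>{w. length w = n}. \<Sum>i\<in>UNIV. \<psi> (\<iota> (\<alpha> i (word_endo \<alpha> w a)))) =
      (\<Sum>w\<in>{w. length w = Suc n}. \<psi> (\<iota> (word_endo \<alpha> w a)))"
    by (simp add: sum_words_Suc sum.swap [of _ UNIV])
  finally have step: "(\<Sum>w\<in>{w. length w = n}. \<psi> (\<iota> (word_endo \<alpha> w a))) =
      of_real c * (\<Sum>w\<in>{w. length w = n}. defect_trace (word_endo \<alpha> w a)) +
      of_real (exp (- \<beta>)) * (\<Sum>w\<in>{w. length w = Suc n}. \<psi> (\<iota> (word_endo \<alpha> w a)))" .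
  have "exp (- (real (Suc n) * \<beta>)) = exp (- (real n * \<beta>)) * exp (- \<beta>)"
    by (simp add: algebra_simps mult_exp_exp)
  thus ?case
    by (subst Suc.IH, subst step) (simp add: distrib_left mult_ac)
qed simp

lemma kms_iota_sums:
  "(\<lambda>m. of_real (exp (- (real m * \<beta>))) * (\<Sum>w\<in>{w. length w = m}. defect_trace (word_endo \<alpha> w a)))
     sums (\<psi> (\<iota> a) / of_real c)"
proof -
  let ?r = "\<lambda>n. of_real (exp (- (real n * \<beta>))) * (\<Sum>w\<in>{w. length w = n}. \<psi> (\<iota> (word_endo \<alpha> w a)))"
  \<comment> \<open>Each of the \<open>CARD('d) ^ n\<close> summands is a state of A evaluated at
    \<open>a\<close>.\<close>
  have bound: "cmod (?r n) \<le> (real CARD('d) * exp (- \<beta>)) ^ n * norm a" for n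
  proof -
    have "cmod (\<psi> (\<iota> (word_endo \<alpha> w a))) \<le> norm a" for w
      by (intro is_state_le [of "\<lambda>a. \<psi> (\<iota> (word_endo \<alpha> w a))"]
          is_state_compose [OF kms_state unital_star_hom_compose [OF iota_hom word_endo_hom]])
    hence "cmod (\<Sum>w\<in>{w. length w = n}. \<psi> (\<iota> (word_endo \<alpha> w a))) \<le> of_nat (card {w :: 'd list. length w = n}) * norm a"
      by (intro sum_norm_bound)
    hence "exp (- (real n * \<beta>)) * cmod (\<Sum>w\<in>{w. length w = n}. \<psi> (\<iota> (word_endo \<alpha> w a))) \<le>
        exp (- (real n * \<beta>)) * (real CARD('d) ^ n * norm a)"
      by (intro mult_left_mono) (simp_all add: card_words)
    also have "exp (- (real n * \<beta>)) = exp (- \<beta>) ^ n"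
      by (simp flip: exp_of_nat_mult)
    finally show ?thesis
      by (simp add: norm_mult power_mult_distrib mult_ac flip: exp_of_nat_mult)
  qed
  have "(\<lambda>n. (real CARD('d) * exp (- \<beta>)) ^ n * norm a) \<longlonglongrightarrow> 0 * norm a"
    using card_exp_less_1 by (intro tendsto_intros LIMSEQ_realpow_zero) auto
  hence "?r \<longlonglongrightarrow> 0"
    using bound by (intro Lim_null_comparison [of ?r]) auto
  hence "(\<lambda>n. (\<psi> (\<iota> a) - ?r n) / of_real c) \<longlonglongrightarrow> (\<psi> (\<iota> a) - 0) / of_real c"
    using c_pos by (intro tendsto_intros) auto
  moreover have "(\<psi> (\<iota> a) - ?r n) / of_real c = (\<Sum>m<n. of_real (exp (- (real m * \<beta>))) *
      (\<Sum>w\<in>{w. length w = m}. defect_trace (word_endo \<alpha> w a)))" for n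
    using kms_iota_partial_sum [of a n] c_pos
    by (simp add: field_simps)
  ultimately show ?thesis unfolding sums_def by simp
qed

lemma kms_word_prod:
  "\<psi> (word_prod S \<mu> * y) = of_real (exp (- (real (length \<mu>) * \<beta>))) * \<psi> (y * word_prod S \<mu>)"
proof (induction \<mu> arbitrary: y)
  case (Cons i \<mu>)
  have "\<psi> (word_prod S (i # \<mu>) * y) =
      of_real (exp (- \<beta>)) * \<psi> (word_prod S \<mu> * (y * S i))"
    by (simp add: mult.assoc kms_S)
  also have "\<dots> = of_real (exp (- \<beta>) * exp (- (real (length \<mu>) * \<beta>))) * \<psi> (y * (S i * word_prod S \<mu>))"
    by (simp add: Cons.IH mult.assoc)
  also have "exp (- \<beta>) * exp (- (real (length \<mu>) * \<beta>)) = exp (- (real (length (i # \<mu>)) * \<beta>))"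
    by (simp add: algebra_simps mult_exp_exp)
  finally show ?case by simp
qed simp

text \<open>Moving \<open>\<iota> a\<close> and the word past each other multiplies the value by
  \<open>exp (- length \<mu> * \<beta>) \<noteq> 1\<close>.\<close>

lemma kms_iota_word_prod:
  assumes "\<mu> \<noteq> []"
  shows "\<psi> (\<iota> a * word_prod S \<mu>) = 0" "\<psi> (\<iota> a * star (word_prod S \<mu>)) = 0"
proof -
  have *: "\<psi> (\<iota> a * word_prod S \<mu>) = 0" for a
  proof -
    have "exp (- (real (length \<mu>) * \<beta>)) < 1" using assms beta_pos by simp
    moreover have "\<psi> (\<iota> a * word_prod S \<mu>) = of_real (exp (- (real (length \<mu>) * \<beta>))) * \<psi> (\<iota> a * word_prod S \<mu>)"
      using kms_word_prod [of \<mu> "\<iota> a"] kms_iota [of a "word_prod S \<mu>"] by simp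
    hence "(1 - of_real (exp (- (real (length \<mu>) * \<beta>)))) * \<psi> (\<iota> a * word_prod S \<mu>) = 0"
      by (simp add: left_diff_distrib)
    ultimately show ?thesis
      by (metis less_irrefl mult_eq_0_iff of_real_eq_1_iff right_minus_eq)
  qed
  show "\<psi> (\<iota> a * word_prod S \<mu>) = 0" by (rule *)
  have "\<psi> (\<iota> a * star (word_prod S \<mu>)) = cnj (\<psi> (word_prod S \<mu> * \<iota> (star a)))"
    by (simp add: star_mult star_star unital_star_homD [OF iota_hom] flip: is_state_star [OF kms_state])
  also have "\<dots> = 0" by (simp add: * flip: kms_iota)
  finally show "\<psi> (\<iota> a * star (word_prod S \<mu>)) = 0" .
qed

text \<open>Equal first letters cancel by the isometry relation and different ones give 0. Once one
  word is exhausted, a nonempty rest of the other has expectation 0 by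
  \<open>kms_iota_word_prod\<close>.\<close>

lemma kms_iota_star_word_prod:
  "\<psi> (\<iota> a * (star (word_prod S \<nu>) * word_prod S \<mu>)) = (if \<mu> = \<nu> then \<psi> (\<iota> a) else 0)"
proof (induction \<mu> arbitrary: \<nu>)
  case Nil
  show ?case using kms_iota_word_prod(2) [of \<nu> a] by (cases "\<nu> = []") auto
next
  case (Cons i \<mu>)
  show ?case
  proof (cases \<nu>)
    case Nil
    thus ?thesis using kms_iota_word_prod(1) [of "i # \<mu>" a] by simp
  next
    case (Cons j \<nu>')
    have "star (word_prod S (j # \<nu>')) * word_prod S (i # \<mu>) =
        star (word_prod S \<nu>') * ((star (S j) * S i) * word_prod S \<mu>)"
      by (simp add: star_mult mult.assoc)
    also have "\<dots> = (if i = j then star (word_prod S \<nu>') * word_prod S \<mu> else 0)"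
      by (simp add: isometry)
    finally show ?thesis using Cons.IH [of \<nu>'] Cons
      by (cases "i = j") (auto simp only: kms_linear list.inject mult_zero_right simp_thms if_True if_False)
  qed
qed

text \<open>Moving \<open>word_prod S \<mu>\<close> around gives the factor for its length and
  brings \<open>star (word_prod S \<nu>) * word_prod S \<mu>\<close> together, which yields the
  Kronecker delta. Reversal permutes the words of each length, so \<open>rev w\<close> and
  \<open>w\<close> give the same sums.\<close>

theorem kms_formula:
  "\<psi> (word_prod S \<mu> * \<iota> a * star (word_prod S \<nu>)) =
     (if \<mu> = \<nu> then 1 else 0) *
     complex_of_real c *
     suminf (\<lambda>m. complex_of_real (exp (- (real (m + length \<mu>) * \<beta>))) *
        (\<Sum>w\<in>{w :: 'd list. length w = m}. defect_trace (word_endo \<alpha> (rev w) a)))"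
proof -
  have "(\<lambda>m. of_real (exp (- (real (length \<mu>) * \<beta>))) * (of_real (exp (- (real m * \<beta>))) *
        (\<Sum>w\<in>{w :: 'd list. length w = m}. defect_trace (word_endo \<alpha> w a)))) sums
      (of_real (exp (- (real (length \<mu>) * \<beta>))) * (\<psi> (\<iota> a) / of_real c))"
    by (intro sums_mult kms_iota_sums)
  moreover have "of_real (exp (- (real (length \<mu>) * \<beta>))) * (of_real (exp (- (real m * \<beta>))) * z) =
      of_real (exp (- (real (m + length \<mu>) * \<beta>))) * (z :: complex)" for m z
    by (simp add: algebra_simps mult_exp_exp flip: of_real_mult mult.assoc)
  moreover have "(\<Sum>w\<in>{w :: 'd list. length w = m}. defect_trace (word_endo \<alpha> (rev w) a)) =
      (\<Sum>w\<in>{w. length w = m}. defect_trace (word_endo \<alpha> w a))" for m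
    by (rule sum_words_rev)
  ultimately have sum: "suminf (\<lambda>m. complex_of_real (exp (- (real (m + length \<mu>) * \<beta>))) *
        (\<Sum>w\<in>{w :: 'd list. length w = m}. defect_trace (word_endo \<alpha> (rev w) a))) =
      of_real (exp (- (real (length \<mu>) * \<beta>))) * (\<psi> (\<iota> a) / of_real c)"
    by (simp only: sums_iff)
  have "\<psi> (word_prod S \<mu> * \<iota> a * star (word_prod S \<nu>)) =
      of_real (exp (- (real (length \<mu>) * \<beta>))) * \<psi> (\<iota> a * (star (word_prod S \<nu>) * word_prod S \<mu>))"
    by (simp add: mult.assoc kms_word_prod)
  also have "\<dots> = (if \<mu> = \<nu> then 1 else 0) * of_real c *
      (of_real (exp (- (real (length \<mu>) * \<beta>))) * (\<psi> (\<iota> a) / of_real c))"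
    using c_pos by (simp add: kms_iota_star_word_prod)
  finally show ?thesis by (simp only: sum)
qed

end

end

section \<open>The Fock representation\<close>

text \<open>The algebraic Fock module consists of the finitely supported functions from words to \<open>A\<close>.
  The generator \<open>S\<^sub>i\<close> prepends the letter \<open>i\<close>, and \<open>a\<close> acts on the component at \<open>w\<close> by
  \<open>word_endo \<alpha> (rev w) a\<close>, as forced by \<open>a S\<^sub>w = S\<^sub>w \<alpha>\<^bsub>rev w\<^esub>(a)\<close>.\<close>

fun letter_act ::
  "('d \<Rightarrow> 'a \<Rightarrow> 'a) \<Rightarrow> ('a + 'd) \<times> bool \<Rightarrow> ('d list \<Rightarrow> 'a::cstar_algebra) \<Rightarrow> 'd list \<Rightarrow> 'a" where
  "letter_act \<alpha> (Inl a, e) v = (\<lambda>w. word_endo \<alpha> (rev w) (if e then star a else a) * v w)"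
| "letter_act \<alpha> (Inr i, False) v = (\<lambda>w. case w of [] \<Rightarrow> 0 | j # u \<Rightarrow> if j = i then v u else 0)"
| "letter_act \<alpha> (Inr i, True) v = (\<lambda>w. v (i # w))"

definition word_act ::
  "('d \<Rightarrow> 'a \<Rightarrow> 'a) \<Rightarrow> (('a + 'd) \<times> bool) list \<Rightarrow> ('d list \<Rightarrow> 'a::cstar_algebra) \<Rightarrow> 'd list \<Rightarrow> 'a" where
  "word_act \<alpha> x = foldr (letter_act \<alpha>) x"

definition fock_act ::
  "('d \<Rightarrow> 'a \<Rightarrow> 'a) \<Rightarrow> ('a + 'd) free_star_algebra \<Rightarrow> ('d list \<Rightarrow> 'a::cstar_algebra) \<Rightarrow> 'd list \<Rightarrow> 'a" where
  "fock_act \<alpha> p v = (\<lambda>w. \<Sum>x\<in>Poly_Mapping.keys p. Poly_Mapping.lookup p x *\<^sub>C word_act \<alpha> x v w)"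

lemma scaleC_sum: "c *\<^sub>C (\<Sum>i\<in>I. f i) = (\<Sum>i\<in>I. c *\<^sub>C (f i :: 'a::cstar_algebra))"
  by (rule linear_sum [OF bounded_linear.linear [OF bounded_linear_scaleC]])

lemma word_act_Nil [simp]: "word_act \<alpha> [] v = v"
  and word_act_Cons [simp]: "word_act \<alpha> (g # x) v = letter_act \<alpha> g (word_act \<alpha> x v)"
  and word_act_append: "word_act \<alpha> (x @ y) v = word_act \<alpha> x (word_act \<alpha> y v)"
  by (simp_all add: word_act_def)

lemma letter_act_sum:
  "letter_act \<alpha> g (\<lambda>w. \<Sum>i\<in>I. c i *\<^sub>C f i w) = (\<lambda>w. \<Sum>i\<in>I. c i *\<^sub>C letter_act \<alpha> g (f i) w)"
proof
  fix w
  obtain h e where g: "g = (h, e)" by (cases g)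
  show "letter_act \<alpha> g (\<lambda>w. \<Sum>i\<in>I. c i *\<^sub>C f i w) w = (\<Sum>i\<in>I. c i *\<^sub>C letter_act \<alpha> g (f i) w)"
    unfolding g by (cases h; cases e; cases w) (simp_all add: sum_distrib_left mult_scaleC_right)
qed

lemma word_act_sum:
  "word_act \<alpha> x (\<lambda>w. \<Sum>i\<in>I. c i *\<^sub>C f i w) = (\<lambda>w. \<Sum>i\<in>I. c i *\<^sub>C word_act \<alpha> x (f i) w)"
  by (induction x) (simp_all add: letter_act_sum)

lemma fock_act_add: "fock_act \<alpha> (p + q) v w = fock_act \<alpha> p v w + fock_act \<alpha> q v w"
  unfolding fock_act_def
  by (rule setsum_keys_plus_distrib [of "\<lambda>x c. c *\<^sub>C word_act \<alpha> x v w"])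
     (simp_all add: scaleC_add_left)

lemma fock_act_zero [simp]: "fock_act \<alpha> 0 v w = 0"
  by (simp add: fock_act_def)

lemma fock_act_diff: "fock_act \<alpha> (p - q) v w = fock_act \<alpha> p v w - fock_act \<alpha> q v w"
  using fock_act_add [of \<alpha> "p - q" q v w] by simp

lemma fock_act_sum: "fock_act \<alpha> (sum f I) v w = (\<Sum>i\<in>I. fock_act \<alpha> (f i) v w)"
  by (induction I rule: infinite_finite_induct) (simp_all add: fock_act_add)

lemma fock_act_single: "fock_act \<alpha> (Poly_Mapping.single x c) v w = c *\<^sub>C word_act \<alpha> x v w"
  by (simp add: fock_act_def)

lemma fock_act_one [simp]:
  fixes \<alpha> :: "'d \<Rightarrow> 'a \<Rightarrow> 'a::cstar_algebra"
  shows "fock_act \<alpha> 1 v = v"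
proof
  have *: "(1 :: ('a + 'd) free_star_algebra) = Poly_Mapping.single [] 1"
    using single_one [where 'a = "(('a + 'd) \<times> bool) list"] by (simp add: zero_list_def)
  show "fock_act \<alpha> 1 v w = v w" for w by (subst *) (simp add: fock_act_single)
qed

lemma fock_act_mult: "fock_act \<alpha> (p * q) v = fock_act \<alpha> p (fock_act \<alpha> q v)"
proof
  fix w
  have single: "fock_act \<alpha> (Poly_Mapping.single x c * Poly_Mapping.single y d) v w =
      (c * d) *\<^sub>C word_act \<alpha> x (word_act \<alpha> y v) w" for x y c d
    by (simp add: mult_single fock_act_single plus_list_def word_act_append)
  have "fock_act \<alpha>
      ((\<Sum>x\<in>Poly_Mapping.keys p. Poly_Mapping.single x (Poly_Mapping.lookup p x)) *
       (\<Sum>y\<in>Poly_Mapping.keys q. Poly_Mapping.single y (Poly_Mapping.lookup q y))) v w =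
      fock_act \<alpha> p (fock_act \<alpha> q v) w"
    by (simp add: sum_product fock_act_sum single)
       (simp add: fock_act_def word_act_sum scaleC_sum scaleC_scaleC)
  thus "fock_act \<alpha> (p * q) v w = fock_act \<alpha> p (fock_act \<alpha> q v) w" by (simp only: sum_single_keys)
qed

lemma fock_act_scale: "fock_act \<alpha> (free_scale c p) v w = c *\<^sub>C fock_act \<alpha> p v w"
  by (simp add: free_scale_def fock_act_mult fock_act_single)

lemma fock_act_gen [simp]: "fock_act \<alpha> (free_gen g) v = letter_act \<alpha> (g, False) v"
  by (rule ext) (simp add: free_gen_def fock_act_single)

lemma free_star_gen: "free_star (free_gen g) = Poly_Mapping.single [(g, True)] 1"
  by (simp add: free_star_def free_gen_def word_star_def)

lemma fock_act_star_gen [simp]: "fock_act \<alpha> (free_star (free_gen g)) v = letter_act \<alpha> (g, True) v"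
  by (rule ext) (simp add: free_star_gen fock_act_single)

lemma fock_act_star:
  "fock_act \<alpha> (free_star p) v w =
     (\<Sum>x\<in>Poly_Mapping.keys p. cnj (Poly_Mapping.lookup p x) *\<^sub>C word_act \<alpha> (word_star x) v w)"
  by (simp add: free_star_def fock_act_sum fock_act_single)

text \<open>The Fock module is a right A-module and the representation is by module maps;
  \<open>vacuum_functional_Inl\<close> combines this with the trace property.\<close>

lemma fock_act_right: "fock_act \<alpha> p (\<lambda>w. v w * b) w = fock_act \<alpha> p v w * b"
proof -
  have letter: "letter_act \<alpha> g (\<lambda>w. v w * b) = (\<lambda>w. letter_act \<alpha> g v w * b)" for g v
  proof
    fix w
    obtain h e where g: "g = (h, e)" by (cases g)
    show "letter_act \<alpha> g (\<lambda>w. v w * b) w = letter_act \<alpha> g v w * b"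
      unfolding g by (cases h; cases e; cases w) (simp_all add: mult.assoc)
  qed
  have "word_act \<alpha> x (\<lambda>w. v w * b) = (\<lambda>w. word_act \<alpha> x v w * b)" for x
    by (induction x) (simp_all add: letter)
  thus ?thesis by (simp add: fock_act_def sum_distrib_right mult_scaleC_left)
qed

section \<open>Finitely supported vectors and the scalar product of a trace\<close>

definition finsupp :: "('w \<Rightarrow> 'a::zero) \<Rightarrow> bool" where
  "finsupp v \<longleftrightarrow> finite {w. v w \<noteq> 0}"

lemma finsupp_subset: "finite W \<Longrightarrow> (\<And>w. w \<notin> W \<Longrightarrow> v w = 0) \<Longrightarrow> finsupp v"
  unfolding finsupp_def by (rule finite_subset [of _ W]) auto

lemma finsupp_letter_act:
  assumes "finsupp v"
  shows "finsupp (letter_act \<alpha> g v)"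
proof -
  obtain h e where g: "g = (h, e)" by (cases g)
  have fin: "finite {w. v w \<noteq> 0}" using assms by (simp add: finsupp_def)
  consider a where "h = Inl a" | i where "h = Inr i" "e" | i where "h = Inr i" "\<not> e"
    by (cases h) auto
  thus ?thesis
  proof cases
    case 1
    thus ?thesis using fin unfolding g by (intro finsupp_subset [of "{w. v w \<noteq> 0}"]) auto
  next
    case (2 i)
    have "finite ((#) i -` {w. v w \<noteq> 0})" by (intro finite_vimageI fin) simp
    with 2 show ?thesis unfolding g by (intro finsupp_subset [of "(#) i -` {w. v w \<noteq> 0}"]) auto
  next
    case (3 i)
    thus ?thesis using fin unfolding g
      by (intro finsupp_subset [of "(#) i ` {w. v w \<noteq> 0}"]) (auto split: list.split)
  qed
qed

lemma finsupp_word_act: "finsupp v \<Longrightarrow> finsupp (word_act \<alpha> x v)"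
  by (induction x) (simp_all add: finsupp_letter_act)

lemma finsupp_sum:
  assumes "finite I" "\<And>i. i \<in> I \<Longrightarrow> finsupp (f i)"
  shows "finsupp (\<lambda>w. \<Sum>i\<in>I. c i *\<^sub>C (f i w :: 'a::cstar_algebra))"
  by (rule finsupp_subset [of "\<Union>i\<in>I. {w. f i w \<noteq> 0}"])
     (use assms in \<open>auto simp: finsupp_def intro!: sum.neutral\<close>)

lemma finsupp_fock_act: "finsupp v \<Longrightarrow> finsupp (fock_act \<alpha> p v)"
  unfolding fock_act_def by (intro finsupp_sum finsupp_word_act) simp_all

text \<open>The A-valued scalar product followed by \<tau>, linear in the first argument. Null
  vectors are kept, so the form is only semidefinite. Summing over the support of \<open>v\<close>
  leaves \<open>u\<close> arbitrary.\<close>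

definition fock_inner ::
  "('a::cstar_algebra \<Rightarrow> complex) \<Rightarrow> ('w \<Rightarrow> 'a) \<Rightarrow> ('w \<Rightarrow> 'a) \<Rightarrow> complex" where
  "fock_inner \<tau> v u = (\<Sum>w\<in>{w. v w \<noteq> 0}. \<tau> (star (u w) * v w))"

definition fock_norm :: "('a::cstar_algebra \<Rightarrow> complex) \<Rightarrow> ('w \<Rightarrow> 'a) \<Rightarrow> real" where
  "fock_norm \<tau> v = sqrt (Re (fock_inner \<tau> v v))"

locale fock =
  fixes \<alpha> :: "'d::finite \<Rightarrow> 'a \<Rightarrow> 'a::cstar_algebra" and \<tau> :: "'a \<Rightarrow> complex"
  assumes dynamical: "cstar_dynamical_system \<alpha>"
    and vanishing: "\<tau> \<in> vanishing_tracial_states \<alpha>"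
begin

lemma state: "is_state \<tau>" and trace: "\<tau> (a * b) = \<tau> (b * a)"
  and vanish: "a \<in> covariance_ideal \<alpha> \<Longrightarrow> \<tau> a = 0"
  using vanishing by (auto simp: vanishing_tracial_states_def is_tracial_state_def)

lemma endo: "unital_star_hom (word_endo \<alpha> w)"
  using dynamical by (induction w) (simp_all add: unital_star_hom_def cstar_dynamical_system_def)

lemmas tau = is_stateD [OF state]
lemmas endo_simps = unital_star_homD [OF endo]

lemma fock_inner_superset:
  assumes "finite W" "\<And>w. w \<notin> W \<Longrightarrow> v w = 0"
  shows "fock_inner \<tau> v u = (\<Sum>w\<in>W. \<tau> (star (u w) * v w))"
  unfolding fock_inner_def
  by (rule sum.mono_neutral_left) (use assms in \<open>auto simp: tau\<close>)

lemma fock_inner_cnj: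
  assumes "finsupp v" "finsupp u"
  shows "fock_inner \<tau> v u = cnj (fock_inner \<tau> u v)"
proof -
  let ?W = "{w. v w \<noteq> 0} \<union> {w. u w \<noteq> 0}"
  have "fock_inner \<tau> v u = (\<Sum>w\<in>?W. \<tau> (star (u w) * v w))"
    "fock_inner \<tau> u v = (\<Sum>w\<in>?W. \<tau> (star (v w) * u w))"
    using assms by (auto simp: finsupp_def intro!: fock_inner_superset)
  moreover have "\<tau> (star (u w) * v w) = cnj (\<tau> (star (v w) * u w))" for w
    by (simp add: star_mult star_star flip: is_state_star [OF state])
  ultimately show ?thesis by simp
qed

lemma fock_inner_sum_left:
  assumes "finite I" "\<And>i. i \<in> I \<Longrightarrow> finsupp (f i)"
  shows "fock_inner \<tau> (\<lambda>w. \<Sum>i\<in>I. c i *\<^sub>C f i w) u = (\<Sum>i\<in>I. c i * fock_inner \<tau> (f i) u)"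
proof -
  define W where "W = (\<Union>i\<in>I. {w. f i w \<noteq> 0})"
  have W: "finite W" using assms by (simp add: W_def finsupp_def)
  have "fock_inner \<tau> (\<lambda>w. \<Sum>i\<in>I. c i *\<^sub>C f i w) u = (\<Sum>w\<in>W. \<tau> (star (u w) * (\<Sum>i\<in>I. c i *\<^sub>C f i w)))"
    by (rule fock_inner_superset [OF W]) (auto simp: W_def intro!: sum.neutral)
  also have "\<dots> = (\<Sum>w\<in>W. \<Sum>i\<in>I. c i * \<tau> (star (u w) * f i w))"
    by (simp add: sum_distrib_left mult_scaleC_right tau)
  also have "\<dots> = (\<Sum>i\<in>I. c i * (\<Sum>w\<in>W. \<tau> (star (u w) * f i w)))"
    by (simp add: sum.swap [of _ W] sum_distrib_left)
  also have "\<dots> = (\<Sum>i\<in>I. c i * fock_inner \<tau> (f i) u)"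
    by (intro sum.cong refl arg_cong2 [where f = "(*)"] fock_inner_superset [OF W, symmetric])
       (auto simp: W_def)
  finally show ?thesis .
qed

lemma fock_inner_sum_right:
  "fock_inner \<tau> v (\<lambda>w. \<Sum>i\<in>I. c i *\<^sub>C f i w) = (\<Sum>i\<in>I. cnj (c i) * fock_inner \<tau> v (f i))"
  by (simp add: fock_inner_def star_sum star_scaleC sum_distrib_right mult_scaleC_left tau
      sum_distrib_left sum.swap [of _ I])

text \<open>Creation is a reindexing along \<open>(#) i\<close>, an element of A crosses over as its
  star, and annihilation follows from creation by conjugate symmetry.\<close>

lemma fock_inner_letter_act:
  assumes v: "finsupp v" and u: "finsupp u"
  shows "fock_inner \<tau> (letter_act \<alpha> (g, e) v) u = fock_inner \<tau> v (letter_act \<alpha> (g, \<not> e) u)"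
proof -
  have creation: "fock_inner \<tau> (letter_act \<alpha> (Inr i, False) v) u =
      fock_inner \<tau> v (letter_act \<alpha> (Inr i, True) u)" if v: "finsupp v" for i u v
  proof -
    have "finite ((#) i ` {w. v w \<noteq> 0})" using v by (simp add: finsupp_def)
    hence "fock_inner \<tau> (letter_act \<alpha> (Inr i, False) v) u =
        (\<Sum>w\<in>(#) i ` {w. v w \<noteq> 0}. \<tau> (star (u w) * letter_act \<alpha> (Inr i, False) v w))"
      by (rule fock_inner_superset) (auto split: list.split)
    also have "\<dots> = fock_inner \<tau> v (letter_act \<alpha> (Inr i, True) u)"
      by (simp add: sum.reindex fock_inner_def)
    finally show ?thesis .
  qed
  consider a where "g = Inl a" | i where "g = Inr i" "\<not> e" | i where "g = Inr i" "e"
    by (cases g) auto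
  thus ?thesis
  proof cases
    case (1 a)
    have "finite {w. v w \<noteq> 0}" using v by (simp add: finsupp_def)
    hence "fock_inner \<tau> (letter_act \<alpha> (g, e) v) u =
        (\<Sum>w\<in>{w. v w \<noteq> 0}. \<tau> (star (u w) * letter_act \<alpha> (g, e) v w))"
      by (rule fock_inner_superset) (simp add: 1)
    also have "\<dots> = fock_inner \<tau> v (letter_act \<alpha> (g, \<not> e) u)"
      by (auto simp: fock_inner_def 1 star_mult star_star mult.assoc simp flip: endo_simps(4))
    finally show ?thesis .
  next
    case (2 i)
    thus ?thesis using creation [OF v] by simp
  next
    case (3 i)
    have "fock_inner \<tau> (letter_act \<alpha> (Inr i, True) v) u = cnj (fock_inner \<tau> u (letter_act \<alpha> (Inr i, True) v))"
      by (rule fock_inner_cnj [OF finsupp_letter_act [OF v] u])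
    also have "\<dots> = cnj (fock_inner \<tau> (letter_act \<alpha> (Inr i, False) u) v)"
      by (simp only: creation [OF u])
    also have "\<dots> = fock_inner \<tau> v (letter_act \<alpha> (Inr i, False) u)"
      by (rule fock_inner_cnj [OF v finsupp_letter_act [OF u], symmetric])
    finally show ?thesis using 3 by simp
  qed
qed

lemma fock_inner_word_act:
  assumes "finsupp v" "finsupp u"
  shows "fock_inner \<tau> (word_act \<alpha> x v) u = fock_inner \<tau> v (word_act \<alpha> (word_star x) u)"
  using assms(2)
proof (induction x arbitrary: u)
  case (Cons y x)
  obtain g e where y: "y = (g, e)" by (cases y)
  have "fock_inner \<tau> (word_act \<alpha> (y # x) v) u =
      fock_inner \<tau> (word_act \<alpha> x v) (letter_act \<alpha> (g, \<not> e) u)"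
    unfolding y word_act_Cons
    by (rule fock_inner_letter_act [OF finsupp_word_act [OF assms(1)] Cons.prems])
  also have "\<dots> = fock_inner \<tau> v (word_act \<alpha> (word_star x) (letter_act \<alpha> (g, \<not> e) u))"
    by (rule Cons.IH [OF finsupp_letter_act [OF Cons.prems]])
  also have "word_act \<alpha> (word_star x) (letter_act \<alpha> (g, \<not> e) u) = word_act \<alpha> (word_star (y # x)) u"
    by (simp add: y word_star_def word_act_append)
  finally show ?case .
qed (simp add: word_star_def)

lemma fock_inner_adjoint:
  assumes "finsupp v" "finsupp u"
  shows "fock_inner \<tau> (fock_act \<alpha> p v) u = fock_inner \<tau> v (fock_act \<alpha> (free_star p) u)"
proof -
  have "fock_inner \<tau> (fock_act \<alpha> p v) u =
      (\<Sum>x\<in>Poly_Mapping.keys p. Poly_Mapping.lookup p x * fock_inner \<tau> (word_act \<alpha> x v) u)"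
    unfolding fock_act_def
    by (intro fock_inner_sum_left finsupp_word_act assms finite_keys)
  also have "\<dots> = fock_inner \<tau> v (fock_act \<alpha> (free_star p) u)"
    using fock_inner_sum_right [of v "\<lambda>x. cnj (Poly_Mapping.lookup p x)"
        "\<lambda>x. word_act \<alpha> (word_star x) u" "Poly_Mapping.keys p"]
    by (simp add: fock_inner_word_act assms fock_act_star [abs_def])
  finally show ?thesis .
qed

text \<open>True for every \<open>v\<close>, since a sum over an infinite support is 0 by
  convention.\<close>

lemma fock_inner_self: "Re (fock_inner \<tau> v v) \<ge> 0" "Im (fock_inner \<tau> v v) = 0"
  by (simp_all add: fock_inner_def sum_nonneg tau)

lemma fock_norm_nonneg [simp]: "fock_norm \<tau> v \<ge> 0"
  by (simp add: fock_norm_def fock_inner_self)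

lemma fock_norm_power2: "(fock_norm \<tau> v)\<^sup>2 = Re (fock_inner \<tau> v v)"
  by (simp add: fock_norm_def fock_inner_self)

lemma fock_inner_quadratic:
  assumes "finsupp v" "finsupp u"
  shows "Re (fock_inner \<tau> (\<lambda>w. v w + t *\<^sub>C u w) (\<lambda>w. v w + t *\<^sub>C u w)) =
    Re (fock_inner \<tau> v v) + 2 * Re (t * fock_inner \<tau> u v) + (cmod t)\<^sup>2 * Re (fock_inner \<tau> u u)"
proof -
  define W where "W = {w. v w \<noteq> 0} \<union> {w. u w \<noteq> 0}"
  have W: "finite W" using assms by (simp add: W_def finsupp_def)
  have "fock_inner \<tau> (\<lambda>w. v w + t *\<^sub>C u w) (\<lambda>w. v w + t *\<^sub>C u w) =
      (\<Sum>w\<in>W. \<tau> (star (v w + t *\<^sub>C u w) * (v w + t *\<^sub>C u w)))"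
    by (rule fock_inner_superset [OF W]) (simp add: W_def)
  moreover have "fock_inner \<tau> v v = (\<Sum>w\<in>W. \<tau> (star (v w) * v w))"
    by (rule fock_inner_superset [OF W]) (simp add: W_def)
  moreover have "fock_inner \<tau> u v = (\<Sum>w\<in>W. \<tau> (star (v w) * u w))"
    "fock_inner \<tau> u u = (\<Sum>w\<in>W. \<tau> (star (u w) * u w))"
    by (rule fock_inner_superset [OF W]; simp add: W_def)+
  ultimately show ?thesis
    by (simp add: is_state_quadratic [OF state] sum.distrib sum_distrib_left del: times_complex.sel)
qed

lemma fock_cauchy_schwarz:
  assumes "finsupp v" "finsupp u"
  shows "cmod (fock_inner \<tau> v u) \<le> fock_norm \<tau> v * fock_norm \<tau> u"
proof (rule power2_le_imp_le)
  have "(cmod (fock_inner \<tau> v u))\<^sup>2 \<le> Re (fock_inner \<tau> u u) * Re (fock_inner \<tau> v v)"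
    by (rule cauchy_schwarz_complex, subst fock_inner_quadratic [OF assms(2,1), symmetric])
       (rule fock_inner_self(1))
  thus "(cmod (fock_inner \<tau> v u))\<^sup>2 \<le> (fock_norm \<tau> v * fock_norm \<tau> u)\<^sup>2"
    by (simp add: power_mult_distrib fock_norm_power2 mult.commute)
qed simp

lemma fock_norm_triangle:
  assumes "finsupp v" "finsupp u"
  shows "fock_norm \<tau> (\<lambda>w. v w + u w) \<le> fock_norm \<tau> v + fock_norm \<tau> u"
proof (rule power2_le_imp_le)
  have "(fock_norm \<tau> (\<lambda>w. v w + u w))\<^sup>2 =
      (fock_norm \<tau> v)\<^sup>2 + 2 * Re (fock_inner \<tau> u v) + (fock_norm \<tau> u)\<^sup>2"
    using fock_inner_quadratic [OF assms, of 1] by (simp add: fock_norm_power2)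
  also have "Re (fock_inner \<tau> u v) \<le> fock_norm \<tau> u * fock_norm \<tau> v"
    using fock_cauchy_schwarz [OF assms(2,1)] complex_Re_le_cmod order_trans by blast
  finally show "(fock_norm \<tau> (\<lambda>w. v w + u w))\<^sup>2 \<le> (fock_norm \<tau> v + fock_norm \<tau> u)\<^sup>2"
    by (simp add: power2_sum mult.commute)
qed simp

lemma fock_norm_zero: "fock_norm \<tau> (\<lambda>w. 0) = 0"
  by (simp add: fock_norm_def fock_inner_def)

lemma fock_norm_scale:
  assumes "finsupp v"
  shows "fock_norm \<tau> (\<lambda>w. c *\<^sub>C v w) = cmod c * fock_norm \<tau> v"
proof -
  have "Re (fock_inner \<tau> (\<lambda>w. c *\<^sub>C v w) (\<lambda>w. c *\<^sub>C v w)) = (cmod c)\<^sup>2 * Re (fock_inner \<tau> v v)"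
    using fock_inner_quadratic [of "\<lambda>w. 0" v c] assms by (simp add: finsupp_def fock_inner_def tau(4))
  thus ?thesis by (simp add: fock_norm_def real_sqrt_mult)
qed

lemma fock_norm_sum:
  assumes "finite I" "\<And>i. i \<in> I \<Longrightarrow> finsupp (f i)"
  shows "fock_norm \<tau> (\<lambda>w. \<Sum>i\<in>I. c i *\<^sub>C f i w) \<le> (\<Sum>i\<in>I. cmod (c i) * fock_norm \<tau> (f i))"
  using assms
proof (induction I rule: finite_induct)
  case (insert i I)
  have "finsupp (\<lambda>w. c i *\<^sub>C f i w)" using finsupp_sum [of "{i}" f c] insert.prems by simp
  hence "fock_norm \<tau> (\<lambda>w. c i *\<^sub>C f i w + (\<Sum>i\<in>I. c i *\<^sub>C f i w)) \<le>
      fock_norm \<tau> (\<lambda>w. c i *\<^sub>C f i w) + fock_norm \<tau> (\<lambda>w. \<Sum>i\<in>I. c i *\<^sub>C f i w)"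
    by (intro fock_norm_triangle finsupp_sum) (use insert in auto)
  also have "\<dots> \<le> cmod (c i) * fock_norm \<tau> (f i) + (\<Sum>i\<in>I. cmod (c i) * fock_norm \<tau> (f i))"
    using insert by (intro add_mono) (simp_all add: fock_norm_scale)
  finally show ?case using insert by simp
qed (simp add: fock_norm_zero)

text \<open>Creation preserves the form, and annihilation keeps only the components whose word
  starts with \<open>i\<close>. For an element of A the bound holds in each component, by the root
  argument.\<close>

lemma fock_norm_letter_act:
  "\<exists>C\<ge>0. \<forall>v. finsupp v \<longrightarrow> fock_norm \<tau> (letter_act \<alpha> g v) \<le> C * fock_norm \<tau> v"
proof -
  obtain h e where g: "g = (h, e)" by (cases g)
  consider a where "h = Inl a" | i where "h = Inr i" "\<not> e" | i where "h = Inr i" "e"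
    by (cases h) auto
  thus ?thesis
  proof cases
    case (1 a)
    define b where "b = (if e then star a else a)"
    define C where "C = (norm b)\<^sup>2 + 1"
    \<comment> \<open>The summand 1 in \<open>C\<close> makes the inequality strict. Each
      \<open>word_endo \<alpha> (rev w)\<close> carries this root to one for the image of
      \<open>b\<close>, so one \<open>C\<close> serves all words.\<close>
    obtain y where y: "star y * y = C *\<^sub>R 1 - star b * b"
      using star_root_minus_star_mult [of b C] by (auto simp: C_def)
    have "fock_norm \<tau> (letter_act \<alpha> g v) \<le> sqrt C * fock_norm \<tau> v" if v: "finsupp v" for v
    proof -
      have fin: "finite {w. v w \<noteq> 0}" using v by (simp add: finsupp_def)
      have "Re (\<tau> (star (letter_act \<alpha> g v w) * letter_act \<alpha> g v w)) \<le> C * Re (\<tau> (star (v w) * v w))" for w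
      proof -
        let ?\<alpha> = "word_endo \<alpha> (rev w)"
        have "star (?\<alpha> y * v w) * (?\<alpha> y * v w) = star (v w) * ?\<alpha> (star y * y) * v w"
          by (simp add: star_mult endo_simps mult.assoc)
        also have "\<dots> = C *\<^sub>R (star (v w) * v w) - star (?\<alpha> b * v w) * (?\<alpha> b * v w)"
          unfolding y by (simp add: star_mult endo_simps mult.assoc left_diff_distrib right_diff_distrib)
        finally have "0 \<le> Re (\<tau> (C *\<^sub>R (star (v w) * v w) - star (?\<alpha> b * v w) * (?\<alpha> b * v w)))"
          using tau(9) by metis
        thus ?thesis by (simp add: tau g 1 flip: b_def)
      qed
      hence "(\<Sum>w\<in>{w. v w \<noteq> 0}. Re (\<tau> (star (letter_act \<alpha> g v w) * letter_act \<alpha> g v w))) \<le>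
          (\<Sum>w\<in>{w. v w \<noteq> 0}. C * Re (\<tau> (star (v w) * v w)))"
        by (rule sum_mono)
      moreover have "fock_inner \<tau> (letter_act \<alpha> g v) (letter_act \<alpha> g v) =
          (\<Sum>w\<in>{w. v w \<noteq> 0}. \<tau> (star (letter_act \<alpha> g v w) * letter_act \<alpha> g v w))"
        by (rule fock_inner_superset [OF fin]) (simp add: g 1)
      ultimately have "Re (fock_inner \<tau> (letter_act \<alpha> g v) (letter_act \<alpha> g v)) \<le> C * Re (fock_inner \<tau> v v)"
        by (simp add: fock_inner_def sum_distrib_left)
      thus ?thesis unfolding fock_norm_def by (metis real_sqrt_le_mono real_sqrt_mult)
    qed
    moreover have "sqrt C \<ge> 0" by (simp add: C_def)
    ultimately show ?thesis by blast
  next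
    case (2 i)
    have "fock_inner \<tau> (letter_act \<alpha> g v) (letter_act \<alpha> g v) = fock_inner \<tau> v v" if "finsupp v" for v
      using fock_inner_letter_act [OF that finsupp_letter_act [OF that], of h e \<alpha> g] by (simp add: g 2)
    thus ?thesis by (intro exI [of _ 1]) (simp add: fock_norm_def)
  next
    case (3 i)
    have "Re (fock_inner \<tau> (letter_act \<alpha> g v) (letter_act \<alpha> g v)) \<le> Re (fock_inner \<tau> v v)" if "finsupp v" for v
    proof -
      have "fock_inner \<tau> (letter_act \<alpha> g v) (letter_act \<alpha> g v) =
          (\<Sum>w\<in>(#) i ` {w. v (i # w) \<noteq> 0}. \<tau> (star (v w) * v w))"
        by (simp add: fock_inner_def g 3 sum.reindex)
      hence "Re (fock_inner \<tau> (letter_act \<alpha> g v) (letter_act \<alpha> g v)) =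
          (\<Sum>w\<in>(#) i ` {w. v (i # w) \<noteq> 0}. Re (\<tau> (star (v w) * v w)))"
        by simp
      also have "\<dots> \<le> (\<Sum>w\<in>{w. v w \<noteq> 0}. Re (\<tau> (star (v w) * v w)))"
        using that by (intro sum_mono2) (auto simp: finsupp_def tau)
      finally show ?thesis by (simp add: fock_inner_def)
    qed
    thus ?thesis by (intro exI [of _ 1]) (simp add: fock_norm_def)
  qed
qed

section \<open>The operator seminorm\<close>

definition fock_bound :: "('a + 'd) free_star_algebra \<Rightarrow> real \<Rightarrow> bool" where
  "fock_bound p C \<longleftrightarrow> C \<ge> 0 \<and> (\<forall>v. finsupp v \<longrightarrow> fock_norm \<tau> (fock_act \<alpha> p v) \<le> C * fock_norm \<tau> v)"

lemma fock_bound_exists: "\<exists>C. fock_bound p C"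
proof -
  have "\<exists>C\<ge>0. \<forall>v. finsupp v \<longrightarrow> fock_norm \<tau> (word_act \<alpha> x v) \<le> C * fock_norm \<tau> v" for x
  proof (induction x)
    case Nil
    show ?case by (intro exI [of _ 1]) simp
  next
    case (Cons g x)
    then obtain C where C: "C \<ge> 0" "\<And>v. finsupp v \<Longrightarrow> fock_norm \<tau> (word_act \<alpha> x v) \<le> C * fock_norm \<tau> v"
      by blast
    obtain B where B: "B \<ge> 0" "\<And>v. finsupp v \<Longrightarrow> fock_norm \<tau> (letter_act \<alpha> g v) \<le> B * fock_norm \<tau> v"
      using fock_norm_letter_act by blast
    have "fock_norm \<tau> (word_act \<alpha> (g # x) v) \<le> (B * C) * fock_norm \<tau> v" if "finsupp v" for v
    proof -
      have "fock_norm \<tau> (word_act \<alpha> (g # x) v) \<le> B * fock_norm \<tau> (word_act \<alpha> x v)"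
        by (simp add: B finsupp_word_act that)
      also have "\<dots> \<le> B * (C * fock_norm \<tau> v)" by (intro mult_left_mono C B that)
      finally show ?thesis by (simp add: mult.assoc)
    qed
    thus ?case using B C by (intro exI [of _ "B * C"]) simp
  qed
  then obtain C where C: "\<And>x. C x \<ge> 0"
    "\<And>x v. finsupp v \<Longrightarrow> fock_norm \<tau> (word_act \<alpha> x v) \<le> C x * fock_norm \<tau> v"
    by metis
  have "fock_norm \<tau> (fock_act \<alpha> p v) \<le>
      (\<Sum>x\<in>Poly_Mapping.keys p. cmod (Poly_Mapping.lookup p x) * C x) * fock_norm \<tau> v" if "finsupp v" for v
  proof -
    have "fock_norm \<tau> (fock_act \<alpha> p v) \<le>
        (\<Sum>x\<in>Poly_Mapping.keys p. cmod (Poly_Mapping.lookup p x) * fock_norm \<tau> (word_act \<alpha> x v))"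
      unfolding fock_act_def by (intro fock_norm_sum finsupp_word_act that finite_keys)
    also have "\<dots> \<le> (\<Sum>x\<in>Poly_Mapping.keys p. cmod (Poly_Mapping.lookup p x) * (C x * fock_norm \<tau> v))"
      by (intro sum_mono mult_left_mono C that) simp
    finally show ?thesis by (simp add: sum_distrib_right mult.assoc)
  qed
  thus ?thesis unfolding fock_bound_def
    by (intro exI [of _ "\<Sum>x\<in>Poly_Mapping.keys p. cmod (Poly_Mapping.lookup p x) * C x"])
       (simp add: sum_nonneg C)
qed

text \<open>An infimum of bounds, because a supremum of quotients would have to exclude the null
  vectors of \<open>fock_norm\<close>.\<close>

definition fock_seminorm :: "('a + 'd) free_star_algebra \<Rightarrow> real" where
  "fock_seminorm p = Inf {C. fock_bound p C}"

lemma fock_seminorm_le: "fock_bound p C \<Longrightarrow> fock_seminorm p \<le> C"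
  unfolding fock_seminorm_def by (rule cInf_lower) (auto simp: fock_bound_def bdd_below_def)

lemma fock_seminorm_nonneg: "fock_seminorm p \<ge> 0"
  unfolding fock_seminorm_def using fock_bound_exists
  by (intro cInf_greatest) (auto simp: fock_bound_def)

lemma fock_norm_act_le:
  assumes "finsupp v"
  shows "fock_norm \<tau> (fock_act \<alpha> p v) \<le> fock_seminorm p * fock_norm \<tau> v"
proof (cases "fock_norm \<tau> v = 0")
  case True
  \<comment> \<open>Since some bound exists, null vectors are mapped to null vectors.\<close>
  with assms fock_bound_exists [of p] show ?thesis by (auto simp: fock_bound_def)
next
  case False
  hence pos: "fock_norm \<tau> v > 0" by (simp add: order_less_le)
  have "fock_norm \<tau> (fock_act \<alpha> p v) / fock_norm \<tau> v \<le> fock_seminorm p"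
    unfolding fock_seminorm_def using fock_bound_exists assms pos
    by (intro cInf_greatest) (auto simp: fock_bound_def divide_le_eq)
  with pos show ?thesis by (simp add: divide_le_eq)
qed

lemma cstar_seminorm_fock: "cstar_seminorm fock_seminorm"
proof -
  have add: "fock_seminorm (p + q) \<le> fock_seminorm p + fock_seminorm q" for p q
  proof (rule fock_seminorm_le)
    have "fock_norm \<tau> (fock_act \<alpha> (p + q) v) \<le> (fock_seminorm p + fock_seminorm q) * fock_norm \<tau> v"
      if v: "finsupp v" for v
    proof -
      have "fock_act \<alpha> (p + q) v = (\<lambda>w. fock_act \<alpha> p v w + fock_act \<alpha> q v w)"
        by (simp add: fock_act_add fun_eq_iff)
      thus ?thesis
        using fock_norm_triangle [OF finsupp_fock_act [OF v] finsupp_fock_act [OF v], of \<alpha> p \<alpha> q]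
          fock_norm_act_le [OF v, of p] fock_norm_act_le [OF v, of q]
        by (simp add: distrib_right)
    qed
    thus "fock_bound (p + q) (fock_seminorm p + fock_seminorm q)"
      by (simp add: fock_bound_def fock_seminorm_nonneg)
  qed
  have scale_le: "fock_seminorm (free_scale c p) \<le> cmod c * fock_seminorm p" for c p
  proof (rule fock_seminorm_le)
    have "fock_norm \<tau> (fock_act \<alpha> (free_scale c p) v) \<le> (cmod c * fock_seminorm p) * fock_norm \<tau> v"
      if v: "finsupp v" for v
    proof -
      have "fock_act \<alpha> (free_scale c p) v = (\<lambda>w. c *\<^sub>C fock_act \<alpha> p v w)"
        by (simp add: fock_act_scale fun_eq_iff)
      thus ?thesis
        using mult_left_mono [OF fock_norm_act_le [OF v, of p], of "cmod c"]
        by (simp add: fock_norm_scale [OF finsupp_fock_act [OF v]] mult.assoc)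
    qed
    thus "fock_bound (free_scale c p) (cmod c * fock_seminorm p)"
      by (simp add: fock_bound_def fock_seminorm_nonneg)
  qed
  have scale: "fock_seminorm (free_scale c p) = cmod c * fock_seminorm p" for c p
  proof (cases "c = 0")
    case True
    thus ?thesis using scale_le [of c p] fock_seminorm_nonneg [of "free_scale c p"] by simp
  next
    case False
    \<comment> \<open>The reverse inequality is \<open>scale_le\<close> for the inverse
      scalar.\<close>
    have "free_scale (inverse c) (free_scale c p) = p"
    proof -
      have "(1 :: ('a + 'd) free_star_algebra) = Poly_Mapping.single [] 1"
        using single_one [where 'a = "(('a + 'd) \<times> bool) list"] by (simp add: zero_list_def)
      hence "Poly_Mapping.single [] (inverse c) * Poly_Mapping.single [] c = (1 :: ('a + 'd) free_star_algebra)"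
        using False by (simp add: mult_single plus_list_def)
      thus ?thesis by (simp add: free_scale_def flip: mult.assoc)
    qed
    hence "fock_seminorm p \<le> inverse (cmod c) * fock_seminorm (free_scale c p)"
      using scale_le [of "inverse c" "free_scale c p"] by (simp add: norm_inverse)
    hence "cmod c * fock_seminorm p \<le> fock_seminorm (free_scale c p)"
      using False by (simp add: field_simps)
    with scale_le [of c p] show ?thesis by simp
  qed
  have mult: "fock_seminorm (p * q) \<le> fock_seminorm p * fock_seminorm q" for p q
  proof (rule fock_seminorm_le)
    have "fock_norm \<tau> (fock_act \<alpha> (p * q) v) \<le> (fock_seminorm p * fock_seminorm q) * fock_norm \<tau> v"
      if v: "finsupp v" for v
    proof -
      have "fock_norm \<tau> (fock_act \<alpha> (p * q) v) \<le> fock_seminorm p * fock_norm \<tau> (fock_act \<alpha> q v)"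
        unfolding fock_act_mult by (rule fock_norm_act_le [OF finsupp_fock_act [OF v]])
      also have "\<dots> \<le> fock_seminorm p * (fock_seminorm q * fock_norm \<tau> v)"
        by (intro mult_left_mono fock_norm_act_le v fock_seminorm_nonneg)
      finally show ?thesis by (simp add: mult.assoc)
    qed
    thus "fock_bound (p * q) (fock_seminorm p * fock_seminorm q)"
      by (simp add: fock_bound_def fock_seminorm_nonneg)
  qed
  \<comment> \<open>By adjointness the squared norm of \<open>?u\<close> is the scalar product of
    \<open>fock_act \<alpha> p ?u\<close> with \<open>v\<close>; one factor
    \<open>fock_norm \<tau> ?u\<close> then cancels.\<close>
  have star_le: "fock_seminorm (free_star p) \<le> fock_seminorm p" for p
  proof (rule fock_seminorm_le)
    have "fock_norm \<tau> (fock_act \<alpha> (free_star p) v) \<le> fock_seminorm p * fock_norm \<tau> v"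
      if v: "finsupp v" for v
    proof -
      let ?u = "fock_act \<alpha> (free_star p) v"
      have u: "finsupp ?u" by (rule finsupp_fock_act [OF v])
      have "(fock_norm \<tau> ?u)\<^sup>2 \<le> cmod (fock_inner \<tau> ?u ?u)"
        unfolding fock_norm_power2 by (rule complex_Re_le_cmod)
      also have "\<dots> = cmod (fock_inner \<tau> (fock_act \<alpha> p ?u) v)"
        using fock_inner_adjoint [OF u v, of p] by simp
      also have "\<dots> \<le> fock_norm \<tau> (fock_act \<alpha> p ?u) * fock_norm \<tau> v"
        by (rule fock_cauchy_schwarz [OF finsupp_fock_act [OF u] v])
      also have "\<dots> \<le> fock_seminorm p * fock_norm \<tau> ?u * fock_norm \<tau> v"
        by (intro mult_right_mono fock_norm_act_le u) simp
      finally have "fock_norm \<tau> ?u * fock_norm \<tau> ?u \<le> fock_norm \<tau> ?u * (fock_seminorm p * fock_norm \<tau> v)"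
        by (simp add: power2_eq_square mult_ac)
      thus ?thesis
        using fock_seminorm_nonneg [of p] fock_norm_nonneg [of ?u] fock_norm_nonneg [of v]
        by (cases "fock_norm \<tau> ?u = 0") (auto simp: order_less_le mult_le_cancel_left)
    qed
    thus "fock_bound (free_star p) (fock_seminorm p)"
      by (simp add: fock_bound_def fock_seminorm_nonneg)
  qed
  have "fock_seminorm (free_star p * p) = (fock_seminorm p)\<^sup>2" for p
  proof (rule antisym)
    show "fock_seminorm (free_star p * p) \<le> (fock_seminorm p)\<^sup>2"
      using mult [of "free_star p" p] mult_right_mono [OF star_le fock_seminorm_nonneg, of p p]
      by (simp add: power2_eq_square)
    \<comment> \<open>The C*-identity from below: the squared norm of \<open>?u\<close> is the
      scalar product of \<open>v\<close> with the image of \<open>v\<close> under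
      \<open>free_star p * p\<close>.\<close>
    have "fock_norm \<tau> (fock_act \<alpha> p v) \<le> sqrt (fock_seminorm (free_star p * p)) * fock_norm \<tau> v"
      if v: "finsupp v" for v
    proof (rule power2_le_imp_le)
      let ?u = "fock_act \<alpha> p v"
      have u: "finsupp ?u" by (rule finsupp_fock_act [OF v])
      have "(fock_norm \<tau> ?u)\<^sup>2 \<le> cmod (fock_inner \<tau> v (fock_act \<alpha> (free_star p * p) v))"
        unfolding fock_norm_power2 fock_act_mult fock_inner_adjoint [OF v u]
        by (rule complex_Re_le_cmod)
      also have "\<dots> \<le> fock_norm \<tau> v * fock_norm \<tau> (fock_act \<alpha> (free_star p * p) v)"
        by (rule fock_cauchy_schwarz [OF v finsupp_fock_act [OF v]])
      also have "\<dots> \<le> fock_norm \<tau> v * (fock_seminorm (free_star p * p) * fock_norm \<tau> v)"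
        by (intro mult_left_mono fock_norm_act_le v) simp
      finally show "(fock_norm \<tau> ?u)\<^sup>2 \<le> (sqrt (fock_seminorm (free_star p * p)) * fock_norm \<tau> v)\<^sup>2"
        by (simp add: power_mult_distrib fock_seminorm_nonneg power2_eq_square mult_ac)
    qed (simp add: fock_seminorm_nonneg)
    hence "fock_seminorm p \<le> sqrt (fock_seminorm (free_star p * p))"
      by (intro fock_seminorm_le) (simp add: fock_bound_def fock_seminorm_nonneg)
    thus "(fock_seminorm p)\<^sup>2 \<le> fock_seminorm (free_star p * p)"
      using fock_seminorm_nonneg by (metis power_mono real_sqrt_pow2)
  qed
  with add scale mult show ?thesis by (simp add: cstar_seminorm_def)
qed

end

section \<open>The KMS state of a trace\<close>

lemma dense_range_induct:
  assumes "closure (range f) = UNIV" "closed {y. P y}" "\<And>p. P (f p)"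
  shows "P y"
  using closure_minimal [OF _ assms(2), of "range f"] assms(1,3) by blast

text \<open>With \<open>b\<close>, also \<open>y * b\<close> lies in every kernel, so
  \<open>y\<close> is absorbed there. The two-sided form is needed for squares
  \<open>star (a * v) * a * v\<close>.\<close>

lemma covariance_ideal_mult:
  assumes "cstar_dynamical_system \<alpha>" "a \<in> covariance_ideal \<alpha>"
  shows "x * a * y \<in> covariance_ideal \<alpha>"
proof -
  have "x * a * y * b = 0" if b: "\<forall>i. \<alpha> i b = 0" for b
  proof -
    have "\<alpha> i (y * b) = 0" for i
      using assms(1) b by (simp add: cstar_dynamical_system_def unital_star_homD)
    hence "a * (y * b) = 0"
      using assms(2) by (simp add: covariance_ideal_def annihilator_def)
    thus ?thesis by (simp add: mult.assoc)
  qed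
  thus ?thesis by (simp add: covariance_ideal_def annihilator_def)
qed

definition vacuum :: "'w \<Rightarrow> 'w \<Rightarrow> 'a::cstar_algebra" where
  "vacuum w = (\<lambda>u. if u = w then 1 else 0)"

lemma finsupp_vacuum: "finsupp (vacuum w)"
  by (rule finsupp_subset [of "{w}"]) (simp_all add: vacuum_def)

lemma fock_act_defect:
  fixes \<alpha> :: "'d::finite \<Rightarrow> 'a \<Rightarrow> 'a::cstar_algebra"
  shows "fock_act \<alpha> (free_gen (Inl a) *
      (1 - (\<Sum>i\<in>UNIV. free_gen (Inr i) * free_star (free_gen (Inr i))))) v w =
    (if w = [] then a * v [] else 0)"
proof (cases w)
  case (Cons j u)
  have "(\<Sum>i\<in>UNIV. if j = i then v (i # u) else 0) = v (j # u)" by simp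
  thus ?thesis by (simp add: Cons fock_act_mult fock_act_diff fock_act_sum)
qed (simp add: fock_act_mult fock_act_diff fock_act_sum)

section \<open>Cuntz-Pimsner relations and vector functionals on the Fock module\<close>

context fock
begin

text \<open>All families but the last vanish identically on the module. A covariance relation leaves
  \<open>a * v []\<close> at the empty word; its square lies in the ideal, where \<tau> is
  0.\<close>

lemma fock_seminorm_relations:
  assumes "r \<in> cuntz_pimsner_relations \<alpha>"
  shows "fock_seminorm r = 0"
proof -
  have zero: "fock_norm \<tau> (fock_act \<alpha> r v) = 0" if "\<And>w. fock_act \<alpha> r v w = 0" for r v
    using fock_norm_zero that by (metis ext)
  have defect: "fock_norm \<tau> (fock_act \<alpha> (free_gen (Inl a) *
      (1 - (\<Sum>i\<in>UNIV. free_gen (Inr i) * free_star (free_gen (Inr i))))) v) = 0"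
    if a: "a \<in> covariance_ideal \<alpha>" for a v
  proof -
    let ?u = "fock_act \<alpha> (free_gen (Inl a) *
      (1 - (\<Sum>i\<in>UNIV. free_gen (Inr i) * free_star (free_gen (Inr i))))) v"
    have "fock_inner \<tau> ?u ?u = (\<Sum>w\<in>{[]}. \<tau> (star (?u w) * ?u w))"
      by (rule fock_inner_superset) (simp_all add: fock_act_defect)
    also have "\<dots> = \<tau> (star (a * v []) * a * v [])"
      by (simp add: fock_act_defect mult.assoc)
    also have "\<dots> = 0"
      by (rule vanish [OF covariance_ideal_mult [OF dynamical a]])
    finally show ?thesis by (simp add: fock_norm_def)
  qed
  have "\<forall>r\<in>cuntz_pimsner_relations \<alpha>. \<forall>v. fock_norm \<tau> (fock_act \<alpha> r v) = 0"
    unfolding cuntz_pimsner_relations_def Let_def ball_Un ball_Collect_1 ball_Collect_2 ball_Collect_mem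
  proof (intro conjI allI ballI)
    fix a i and v :: "'d list \<Rightarrow> 'a"
    show "fock_norm \<tau> (fock_act \<alpha> (free_gen (Inl a) * free_gen (Inr i) -
        free_gen (Inr i) * free_gen (Inl (\<alpha> i a))) v) = 0"
    proof (rule zero)
      show "fock_act \<alpha> (free_gen (Inl a) * free_gen (Inr i) -
        free_gen (Inr i) * free_gen (Inl (\<alpha> i a))) v w = 0" for w
        \<comment> \<open>At \<open>i # u\<close> the reversed word ends in \<open>i\<close>, so
          \<open>\<alpha> i\<close> is applied first, as the relation demands; at all other words
          both terms are 0.\<close>
        by (cases w) (simp_all add: fock_act_diff fock_act_mult)
    qed
  qed (rule zero defect; simp add: fock_act_diff fock_act_add fock_act_mult fock_act_scale
        endo_simps distrib_right mult_scaleC_left mult.assoc)+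
  hence "fock_bound r 0" using assms by (simp add: fock_bound_def)
  from fock_seminorm_le [OF this] fock_seminorm_nonneg [of r] show ?thesis by simp
qed

text \<open>By \<open>fock_inner_vacuum\<close> this is the vector functional of
  \<open>vacuum w\<close>.\<close>

definition vacuum_functional :: "'d list \<Rightarrow> ('a + 'd) free_star_algebra \<Rightarrow> complex" where
  "vacuum_functional w p = \<tau> (fock_act \<alpha> p (vacuum w) w)"

lemma fock_inner_vacuum:
  assumes "finsupp v"
  shows "fock_inner \<tau> v (vacuum w) = \<tau> (v w)"
proof -
  let ?W = "insert w {u. v u \<noteq> 0}"
  have W: "finite ?W" using assms by (simp add: finsupp_def)
  have "fock_inner \<tau> v (vacuum w) = (\<Sum>u\<in>?W. \<tau> (star (vacuum w u) * v u))"
    by (rule fock_inner_superset [OF W]) auto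
  also have "\<dots> = (\<Sum>u\<in>?W. if u = w then \<tau> (v u) else 0)"
    by (rule sum.cong) (simp_all add: vacuum_def tau(4))
  also have "\<dots> = \<tau> (v w)" using W by (simp only: sum.delta) simp
  finally show ?thesis .
qed

lemma vacuum_functional_le: "cmod (vacuum_functional w p) \<le> fock_seminorm p"
proof -
  have norm: "fock_norm \<tau> (vacuum w) = 1" for w :: "'d list"
    by (simp add: fock_norm_def fock_inner_vacuum finsupp_vacuum) (simp add: vacuum_def tau(3))
  have "vacuum_functional w p = fock_inner \<tau> (fock_act \<alpha> p (vacuum w)) (vacuum w)"
    by (simp add: vacuum_functional_def fock_inner_vacuum finsupp_fock_act finsupp_vacuum)
  also have "cmod \<dots> \<le> fock_norm \<tau> (fock_act \<alpha> p (vacuum w)) * fock_norm \<tau> (vacuum w)"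
    by (intro fock_cauchy_schwarz finsupp_fock_act finsupp_vacuum)
  also have "\<dots> \<le> fock_seminorm p"
    using fock_norm_act_le [OF finsupp_vacuum, of p w] by (simp add: norm)
  finally show ?thesis .
qed

lemma vacuum_functional_add:
  "vacuum_functional w (p + q) = vacuum_functional w p + vacuum_functional w q"
  by (simp add: vacuum_functional_def fock_act_add tau)

lemma vacuum_functional_scale: "vacuum_functional w (free_scale k p) = k * vacuum_functional w p"
  by (simp add: vacuum_functional_def fock_act_scale tau)

lemma vacuum_functional_one: "vacuum_functional w 1 = 1"
  by (simp add: vacuum_functional_def vacuum_def tau)

lemma vacuum_functional_pos: "vacuum_functional w (free_star p * p) \<in> \<real>\<^sub>\<ge>\<^sub>0"
proof -
  let ?v = "fock_act \<alpha> p (vacuum w)"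
  have v: "finsupp ?v" by (intro finsupp_fock_act finsupp_vacuum)
  have "vacuum_functional w (free_star p * p) = fock_inner \<tau> (fock_act \<alpha> (free_star p) ?v) (vacuum w)"
    by (simp add: vacuum_functional_def fock_act_mult fock_inner_vacuum finsupp_fock_act v)
  also have "\<dots> = cnj (fock_inner \<tau> (vacuum w) (fock_act \<alpha> (free_star p) ?v))"
    by (intro fock_inner_cnj finsupp_fock_act v finsupp_vacuum)
  also have "\<dots> = cnj (fock_inner \<tau> ?v ?v)"
    by (simp only: fock_inner_adjoint [OF finsupp_vacuum v])
  finally show ?thesis
    by (simp add: complex_nonneg_Reals_iff fock_inner_self)
qed

text \<open>On \<open>vacuum w\<close>, acting by \<open>a\<close> from the left is multiplying by
  \<open>word_endo \<alpha> (rev w) a\<close> from the right. Module linearity pulls this factor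
  out, and the trace property of \<tau> carries it to the other side.\<close>

lemma vacuum_functional_Inl:
  "vacuum_functional w (free_gen (Inl a) * p) = vacuum_functional w (p * free_gen (Inl a))"
proof -
  have "letter_act \<alpha> (Inl a, False) (vacuum w) = (\<lambda>u. vacuum w u * word_endo \<alpha> (rev w) a)"
    by (auto simp: vacuum_def)
  thus ?thesis
    using trace by (simp add: vacuum_functional_def fock_act_mult fock_act_right)
qed

text \<open>\<open>S i\<close> lengthens words and sends \<open>vacuum w\<close> to
  \<open>vacuum (i # w)\<close>, so the two sides belong to words whose lengths differ by 1. Under
  the weights exp(- m \<beta>) this difference becomes the KMS factor.\<close>

lemma vacuum_functional_Inr:
  "vacuum_functional [] (free_gen (Inr i) * p) = 0"
  "vacuum_functional (j # w) (free_gen (Inr i) * p) =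
     (if j = i then vacuum_functional w (p * free_gen (Inr i)) else 0)"
proof -
  have "letter_act \<alpha> (Inr i, False) (vacuum w) = vacuum (i # w)"
    by (auto simp: vacuum_def fun_eq_iff split: list.split)
  thus "vacuum_functional (j # w) (free_gen (Inr i) * p) =
     (if j = i then vacuum_functional w (p * free_gen (Inr i)) else 0)"
    by (simp add: vacuum_functional_def fock_act_mult tau)
qed (simp add: vacuum_functional_def fock_act_mult tau)

lemma vacuum_functional_defect:
  "vacuum_functional w (free_gen (Inl a) *
     (1 - (\<Sum>i\<in>UNIV. free_gen (Inr i) * free_star (free_gen (Inr i))))) = (if w = [] then \<tau> a else 0)"
  unfolding vacuum_functional_def fock_act_defect by (simp add: vacuum_def tau)

end

text \<open>A functional dominated by the norm depends only on the evaluation of a polynomial, and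
  it is Lipschitz on a dense subalgebra.\<close>

lemma state_extension:
  fixes h :: "'g \<Rightarrow> 'b::cstar_algebra" and \<omega> :: "'g free_star_algebra \<Rightarrow> complex"
  assumes dense: "closure (range (free_eval h)) = UNIV"
    and add: "\<And>p q. \<omega> (p + q) = \<omega> p + \<omega> q"
    and scale: "\<And>k p. \<omega> (free_scale k p) = k * \<omega> p"
    and pos: "\<And>p. \<omega> (free_star p * p) \<in> \<real>\<^sub>\<ge>\<^sub>0"
    and one: "\<omega> 1 = 1"
    and le: "\<And>p. cmod (\<omega> p) \<le> norm (free_eval h p)"
  shows "\<exists>\<psi>. is_state \<psi> \<and> (\<forall>p. \<psi> (free_eval h p) = \<omega> p)"
proof -
  let ?X = "range (free_eval h)"
  have diff: "\<omega> (p - q) = \<omega> p - \<omega> q" for p q using add [of "p - q" q] by simp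
  have diff_le: "cmod (\<omega> p - \<omega> q) \<le> norm (free_eval h p - free_eval h q)" for p q
    using le [of "p - q"] by (simp add: diff free_eval_diff)
  define \<psi>0 where "\<psi>0 y = \<omega> (SOME p. free_eval h p = y)" for y
  have \<psi>0: "\<psi>0 (free_eval h p) = \<omega> p" for p
  proof -
    have "free_eval h (SOME q. free_eval h q = free_eval h p) = free_eval h p"
      by (rule someI [of "\<lambda>q. free_eval h q = free_eval h p" p]) simp
    with diff_le [of "SOME q. free_eval h q = free_eval h p" p] show ?thesis
      by (simp add: \<psi>0_def)
  qed
  have "uniformly_continuous_on ?X \<psi>0"
    by (rule lipschitz_on_uniformly_continuous [of 1], rule lipschitz_onI)
       (use diff_le in \<open>auto simp: \<psi>0 dist_norm\<close>)
  from uniformly_continuous_on_extension_on_closure [OF this]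
  obtain \<psi> where "uniformly_continuous_on (closure ?X) \<psi>"
    and "\<And>x. x \<in> ?X \<Longrightarrow> \<psi>0 x = \<psi> x" by metis
  hence cont: "continuous_on UNIV \<psi>" and \<psi>: "\<psi> (free_eval h p) = \<omega> p" for p
    using dense \<psi>0 by (auto dest: uniformly_continuous_imp_continuous)
  have cont': "continuous_on X (\<lambda>x. \<psi> (f x))" if "continuous_on X f" for X and f :: "'c::topological_space \<Rightarrow> 'b"
    using continuous_on_compose2 [OF cont that] by simp
  note dense_induct = dense_range_induct [OF dense]
  \<comment> \<open>Density is applied to one variable at a time.\<close>
  have add_range: "\<psi> (free_eval h p + y) = \<psi> (free_eval h p) + \<psi> y" for p y
    by (rule dense_induct)
       (intro closed_Collect_eq continuous_intros cont', simp add: \<psi> add flip: free_eval_add)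
  have "\<psi> (x + y) = \<psi> x + \<psi> y" for x y
    by (rule dense_induct [of "\<lambda>x. \<psi> (x + y) = \<psi> x + \<psi> y"])
       (intro closed_Collect_eq continuous_intros cont', rule add_range)
  moreover have "\<psi> (k *\<^sub>C x) = k * \<psi> x" for k x
    by (rule dense_induct [of "\<lambda>x. \<psi> (k *\<^sub>C x) = k * \<psi> x"])
       (intro closed_Collect_eq continuous_intros cont' continuous_on_id
          bounded_linear.continuous_on [OF bounded_linear_scaleC],
        simp add: \<psi> scale flip: free_eval_scale)
  moreover have "\<psi> (star x * x) \<in> \<real>\<^sub>\<ge>\<^sub>0" for x
  proof (rule dense_induct [of "\<lambda>x. \<psi> (star x * x) \<in> \<real>\<^sub>\<ge>\<^sub>0"])
    have "continuous_on UNIV (\<lambda>x. \<psi> (star x * x))"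
      by (intro cont' continuous_intros)
    hence "closed ((\<lambda>x. \<psi> (star x * x)) -` \<real>\<^sub>\<ge>\<^sub>0)"
      by (rule closed_vimage [OF closed_nonneg_Reals_complex])
    thus "closed {x. \<psi> (star x * x) \<in> \<real>\<^sub>\<ge>\<^sub>0}" by (simp add: vimage_def)
  qed (simp add: \<psi> pos flip: free_eval_star free_eval_mult)
  moreover have "\<psi> 1 = 1" using \<psi> [of 1] one by simp
  ultimately show ?thesis using \<psi> unfolding is_state_def by blast
qed

context cuntz_pimsner_gauge
begin

lemma KMS_state_of_trace_exists:
  assumes \<tau>: "\<tau> \<in> vanishing_tracial_states \<alpha>"
  shows "\<exists>\<psi>. KMS_on_generators \<iota> S \<beta> \<psi> \<and> (\<forall>a. \<psi> (\<iota> a * defect) = of_real c * \<tau> a)"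
proof -
  interpret fock \<alpha> \<tau> by unfold_locales (rule dynamical, rule \<tau>)
  let ?h = "case_sum \<iota> S"
  let ?q = "real CARD('d) * exp (- \<beta>)"
  have c: "c = 1 - ?q" by (simp add: c_def mult.commute)
  \<comment> \<open>The total contribution of the words of length \<open>m\<close>, before
    normalization by \<open>c\<close>.\<close>
  define t where "t p m = of_real (exp (- (real m * \<beta>))) *
      (\<Sum>w\<in>{w :: 'd list. length w = m}. vacuum_functional w p)" for p m
  have exp_pow: "exp (- (real m * \<beta>)) = exp (- \<beta>) ^ m" for m
    by (simp flip: exp_of_nat_mult)
  have q: "0 \<le> ?q" "?q < 1" using card_exp_less_1 by simp_all
  have t_le: "cmod (t p m) \<le> ?q ^ m * norm (free_eval ?h p)" for p m
  proof -
    \<comment> \<open>Universality: the operator seminorm vanishes on the relations, so the norm of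
      the algebra dominates it.\<close>
    have "cmod (vacuum_functional w p) \<le> norm (free_eval ?h p)" for w
      using vacuum_functional_le [of w p] algebra cstar_seminorm_fock fock_seminorm_relations
      unfolding cuntz_pimsner_algebra_def universal_cstar_algebra_def by (meson order_trans)
    hence "cmod (\<Sum>w\<in>{w :: 'd list. length w = m}. vacuum_functional w p) \<le>
        of_nat (card {w :: 'd list. length w = m}) * norm (free_eval ?h p)"
      by (intro sum_norm_bound)
    hence "exp (- \<beta>) ^ m * cmod (\<Sum>w\<in>{w :: 'd list. length w = m}. vacuum_functional w p) \<le>
        exp (- \<beta>) ^ m * (real CARD('d) ^ m * norm (free_eval ?h p))"
      by (intro mult_left_mono) (simp_all add: card_words)
    thus ?thesis unfolding t_def exp_pow by (simp add: norm_mult norm_power power_mult_distrib mult_ac)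
  qed
  have geometric: "(\<lambda>m. ?q ^ m * norm (free_eval ?h p)) sums (norm (free_eval ?h p) / c)" for p
    using sums_mult2 [OF geometric_sums [of ?q], of "norm (free_eval ?h p)"] q by (simp add: c)
  have summable: "summable (t p)" for p
    by (rule summable_comparison_test' [OF sums_summable [OF geometric [of p]]]) (rule t_le)
  define \<omega> where "\<omega> p = of_real c * suminf (t p)" for p
  have \<omega>_le: "cmod (\<omega> p) \<le> norm (free_eval ?h p)" for p
  proof -
    have "cmod (suminf (t p)) \<le> suminf (\<lambda>m. ?q ^ m * norm (free_eval ?h p))"
      by (rule norm_suminf_le [OF t_le sums_summable [OF geometric]])
    also have "\<dots> = norm (free_eval ?h p) / c" using geometric sums_unique by metis
    finally show ?thesis using c_pos by (simp add: \<omega>_def norm_mult field_simps)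
  qed
  have \<omega>_pos: "\<omega> (free_star p * p) \<in> \<real>\<^sub>\<ge>\<^sub>0" for p
  proof -
    have "t (free_star p * p) m \<in> \<real>\<^sub>\<ge>\<^sub>0" for m
      using vacuum_functional_pos [of _ p]
      by (auto simp: t_def complex_nonneg_Reals_iff intro!: sum_nonneg sum.neutral mult_nonneg_nonneg)
    hence "(\<Sum>m<n. t (free_star p * p) m) \<in> \<real>\<^sub>\<ge>\<^sub>0" for n
      by (induction n) auto
    moreover have "(\<lambda>n. \<Sum>m<n. t (free_star p * p) m) \<longlonglongrightarrow> suminf (t (free_star p * p))"
      by (rule summable_LIMSEQ [OF summable])
    ultimately have "suminf (t (free_star p * p)) \<in> \<real>\<^sub>\<ge>\<^sub>0"
      by (rule closed_sequentially [OF closed_nonneg_Reals_complex])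
    thus ?thesis using c_pos by (auto simp: \<omega>_def intro!: nonneg_Reals_mult_I)
  qed
  have \<omega>_one: "\<omega> 1 = 1"
  proof -
    \<comment> \<open>Each of the d^m vector functionals is 1 at the unit, so the total mass is
      1/c.\<close>
    have "t 1 m = of_real (?q ^ m)" for m
      unfolding t_def exp_pow
      by (simp add: vacuum_functional_one card_words power_mult_distrib mult.commute)
    moreover have "(\<lambda>m. ?q ^ m) sums (1 / c)" using geometric_sums [of ?q] q by (simp add: c)
    ultimately have "t 1 sums of_real (1 / c)" by (metis (no_types, lifting) sums_of_real sums_cong)
    thus ?thesis using c_pos by (simp add: \<omega>_def sums_iff)
  qed
  have \<omega>_add: "\<omega> (p + p') = \<omega> p + \<omega> p'" for p p'
  proof -
    have "t (p + p') = (\<lambda>m. t p m + t p' m)"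
      by (simp add: t_def vacuum_functional_add sum.distrib distrib_left fun_eq_iff)
    thus ?thesis by (simp add: \<omega>_def suminf_add [OF summable summable, symmetric] distrib_left)
  qed
  have \<omega>_scale: "\<omega> (free_scale k p) = k * \<omega> p" for k p
  proof -
    have "t (free_scale k p) = (\<lambda>m. k * t p m)"
      by (simp add: t_def vacuum_functional_scale sum_distrib_left mult_ac fun_eq_iff)
    thus ?thesis by (simp add: \<omega>_def suminf_mult [OF summable])
  qed
  obtain \<psi> where \<psi>: "is_state \<psi>" "\<And>p. \<psi> (free_eval ?h p) = \<omega> p"
    using state_extension [OF dense \<omega>_add \<omega>_scale \<omega>_pos \<omega>_one \<omega>_le] by blast
  have \<omega>_Inl: "\<omega> (free_gen (Inl a) * p) = \<omega> (p * free_gen (Inl a))" for a p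
    by (simp add: \<omega>_def t_def [abs_def] vacuum_functional_Inl)
  have \<omega>_Inr: "\<omega> (free_gen (Inr i) * p) = of_real (exp (- \<beta>)) * \<omega> (p * free_gen (Inr i))" for i p
  proof -
    \<comment> \<open>Only words starting with \<open>i\<close> contribute; removing this letter
      lowers the index by 1 and costs exp(- \<beta>). The term of index 0 vanishes.\<close>
    have "(\<Sum>w\<in>{w :: 'd list. length w = Suc m}. vacuum_functional w (free_gen (Inr i) * p)) =
        (\<Sum>w\<in>{w. length w = m}. \<Sum>j\<in>UNIV. if j = i then vacuum_functional w (p * free_gen (Inr i)) else 0)" for m
      by (simp only: sum_words_Suc vacuum_functional_Inr(2)) (rule sum.swap)
    hence "t (free_gen (Inr i) * p) (Suc m) = of_real (exp (- \<beta>)) * t (p * free_gen (Inr i)) m" for m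
      unfolding t_def exp_pow by simp
    moreover have "t (free_gen (Inr i) * p) 0 = 0"
      by (simp add: t_def vacuum_functional_Inr)
    ultimately have "suminf (t (free_gen (Inr i) * p)) =
        of_real (exp (- \<beta>)) * suminf (t (p * free_gen (Inr i)))"
      using suminf_split_head [OF summable [of "free_gen (Inr i) * p"]]
      by (simp add: suminf_mult [OF summable])
    thus ?thesis by (simp add: \<omega>_def)
  qed
  note dense_induct = dense_range_induct [OF dense]
  have "\<psi> (\<iota> a * y) = \<psi> (y * \<iota> a)" for a y
  proof (rule dense_induct [of "\<lambda>y. \<psi> (\<iota> a * y) = \<psi> (y * \<iota> a)"])
    show "closed {y. \<psi> (\<iota> a * y) = \<psi> (y * \<iota> a)}"
      by (intro closed_Collect_eq continuous_on_state [OF \<psi>(1)] continuous_intros)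
    show "\<psi> (\<iota> a * free_eval ?h p) = \<psi> (free_eval ?h p * \<iota> a)" for p
      using \<omega>_Inl [of a p] by (simp flip: \<psi>(2) add: free_eval_mult)
  qed
  moreover have "\<psi> (S i * y) = of_real (exp (- \<beta>)) * \<psi> (y * S i)" for i y
  proof (rule dense_induct [of "\<lambda>y. \<psi> (S i * y) = of_real (exp (- \<beta>)) * \<psi> (y * S i)"])
    show "closed {y. \<psi> (S i * y) = of_real (exp (- \<beta>)) * \<psi> (y * S i)}"
      by (intro closed_Collect_eq continuous_intros continuous_on_state [OF \<psi>(1)])
    show "\<psi> (S i * free_eval ?h p) = of_real (exp (- \<beta>)) * \<psi> (free_eval ?h p * S i)" for p
      using \<omega>_Inr [of i p] by (simp flip: \<psi>(2) add: free_eval_mult)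
  qed
  moreover have "\<psi> (\<iota> a * defect) = of_real c * \<tau> a" for a
  proof -
    let ?p = "free_gen (Inl a) * (1 - (\<Sum>i\<in>UNIV. free_gen (Inr i) * free_star (free_gen (Inr i))))
      :: ('a + 'd) free_star_algebra"
    \<comment> \<open>P is seen by the empty word alone, so the series reduces to its first
      term.\<close>
    have "t ?p m = (if m = 0 then \<tau> a else 0)" for m
      unfolding t_def vacuum_functional_defect by (auto intro!: sum.neutral)
    hence "t ?p = (\<lambda>m. if m = 0 then \<tau> a else 0)" by blast
    hence "suminf (t ?p) = \<tau> a"
      using sums_single [of 0 "\<lambda>_. \<tau> a"] by (simp add: sums_iff)
    moreover have "free_eval ?h ?p = \<iota> a * defect"
      by (simp add: free_eval_mult free_eval_diff free_eval_sum free_eval_star)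
    ultimately show ?thesis using \<psi>(2) [of ?p] by (simp only: \<omega>_def)
  qed
  ultimately show ?thesis using \<psi>(1) unfolding KMS_on_generators_def by blast
qed

end

section \<open>The affine homeomorphism\<close>

lemma word_prod_append: "word_prod S (v @ w) = word_prod S v * word_prod S w"
  by (induction v) (simp_all add: mult.assoc)

lemma is_state_convex:
  assumes f: "is_state f" and g: "is_state g" and s: "s \<in> {0..1::real}"
  shows "is_state (\<lambda>x. of_real s * f x + of_real (1 - s) * g x)"
proof -
  have "of_real s * f (star x * x) + of_real (1 - s) * g (star x * x) \<in> \<real>\<^sub>\<ge>\<^sub>0" for x
    using f g s unfolding is_state_def
    by (intro nonneg_Reals_add_I nonneg_Reals_mult_I) (auto simp del: of_real_diff)
  thus ?thesis unfolding is_state_def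
    by (simp add: is_stateD [OF f] is_stateD [OF g] algebra_simps)
qed

section \<open>Spanning elements, uniqueness and continuity\<close>

context cuntz_pimsner_gauge
begin

definition standard_elements :: "'b set" where
  "standard_elements = {word_prod S \<mu> * \<iota> a * star (word_prod S \<nu>) | \<mu> a \<nu>. True}"

lemma iota_word_prod: "\<iota> a * word_prod S \<mu> = word_prod S \<mu> * \<iota> (word_endo \<alpha> (rev \<mu>) a)"
proof (induction \<mu> arbitrary: a)
  case (Cons i \<mu>)
  have "\<iota> a * word_prod S (i # \<mu>) = S i * (\<iota> (\<alpha> i a) * word_prod S \<mu>)"
    by (simp add: iota_S flip: mult.assoc)
  thus ?case by (simp add: Cons.IH mult.assoc)
qed simp

text \<open>Words grow by left multiplication with letters, so this yields density. For empty \<mu>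
  the letter \<open>star (S i)\<close> passes \<open>\<iota> b\<close> and is collected at the end
  of \<nu>; orthogonal letters give 0, hence \<open>insert 0\<close>.\<close>

lemma letter_mult_standard_elements:
  assumes "x \<in> standard_elements"
  shows "\<iota> a * x \<in> standard_elements" "S i * x \<in> standard_elements"
    "star (S i) * x \<in> insert 0 standard_elements"
proof -
  obtain \<mu> b \<nu> where x: "x = word_prod S \<mu> * \<iota> b * star (word_prod S \<nu>)"
    using assms by (auto simp: standard_elements_def)
  have "\<iota> a * x = word_prod S \<mu> * \<iota> (word_endo \<alpha> (rev \<mu>) a * b) * star (word_prod S \<nu>)"
    by (simp add: x iota_word_prod unital_star_homD [OF iota_hom] flip: mult.assoc)
  thus "\<iota> a * x \<in> standard_elements" by (auto simp: standard_elements_def)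
  have "S i * x = word_prod S (i # \<mu>) * \<iota> b * star (word_prod S \<nu>)" by (simp add: x mult.assoc)
  thus "S i * x \<in> standard_elements" unfolding standard_elements_def by blast
  show "star (S i) * x \<in> insert 0 standard_elements"
  proof (cases \<mu>)
    case Nil
    have "star (S i) * x = word_prod S [] * \<iota> (\<alpha> i b) * star (word_prod S (\<nu> @ [i]))"
      by (simp add: x Nil word_prod_append star_mult star_S_iota flip: mult.assoc)
    thus ?thesis unfolding standard_elements_def by blast
  next
    case (Cons j \<mu>')
    have "star (S i) * x = (star (S i) * S j) * (word_prod S \<mu>' * \<iota> b * star (word_prod S \<nu>))"
      by (simp add: x Cons mult.assoc)
    thus ?thesis by (cases "i = j") (auto simp: isometry standard_elements_def)
  qed
qed

lemma span_image_subset: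
  assumes "linear f" "f ` X \<subseteq> span Y" "x \<in> span X"
  shows "f x \<in> span Y"
proof -
  have "span (f ` X) \<subseteq> span Y" using assms(2) by (simp add: span_minimal)
  thus ?thesis using assms(1,3) by (auto simp: linear_span_image)
qed

lemma closure_span_standard_elements: "closure (span standard_elements) = UNIV"
proof -
  let ?h = "case_sum \<iota> S"
  let ?V = "span standard_elements"
  have insert0: "insert 0 standard_elements \<subseteq> ?V"
    by (auto simp: span_zero span_base)
  have letter: "(if e then star (?h g) else ?h g) * x \<in> ?V" if "x \<in> ?V" for g e x
  proof (rule span_image_subset [OF _ _ that])
    show "linear ((*) (if e then star (?h g) else ?h g))"
      by (rule bounded_linear.linear [OF bounded_linear_mult_right])
    show "(*) (if e then star (?h g) else ?h g) ` standard_elements \<subseteq> ?V"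
    proof (cases g)
      case (Inl a)
      thus ?thesis using letter_mult_standard_elements(1) insert0
        by (auto simp flip: unital_star_homD(4) [OF iota_hom])
    next
      case (Inr i)
      have "S i * x \<in> ?V" "star (S i) * x \<in> ?V" if "x \<in> standard_elements" for x
        using letter_mult_standard_elements(2,3) [OF that, of i] insert0 by blast+
      with Inr show ?thesis by auto
    qed
  qed
  have "1 = word_prod S [] * \<iota> 1 * star (word_prod S [])"
    by (simp add: unital_star_homD [OF iota_hom])
  hence one: "1 \<in> ?V" by (intro span_base) (use standard_elements_def in blast)
  have word: "word_eval ?h w \<in> ?V" for w
  proof (induction w)
    case (Cons x w)
    obtain g e where x: "x = (g, e)" by (cases x)
    show ?case using letter [OF Cons.IH, of e g] by (simp add: word_eval_def x)
  qed (simp add: word_eval_def one)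
  have scale: "k *\<^sub>C x \<in> ?V" if "x \<in> ?V" for k x
  proof (rule span_image_subset [OF _ _ that])
    show "linear ((*\<^sub>C) k :: 'b \<Rightarrow> 'b)"
      by (rule bounded_linear.linear [OF bounded_linear_scaleC])
    \<comment> \<open>Complex scalars are absorbed into \<open>a\<close>, so the real span is a
      complex subspace.\<close>
    have "k *\<^sub>C (word_prod S \<mu> * \<iota> a * star (word_prod S \<nu>)) =
        word_prod S \<mu> * \<iota> (k *\<^sub>C a) * star (word_prod S \<nu>)" for \<mu> a \<nu>
      by (simp add: unital_star_homD [OF iota_hom] mult_scaleC_left mult_scaleC_right)
    hence "(*\<^sub>C) k ` standard_elements \<subseteq> standard_elements"
      unfolding standard_elements_def by fast
    thus "(*\<^sub>C) k ` standard_elements \<subseteq> ?V" using insert0 by auto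
  qed
  have "free_eval ?h p \<in> ?V" for p
    unfolding free_eval_def by (intro span_sum scale word)
  hence "closure (range (free_eval ?h)) \<subseteq> closure ?V" by (intro closure_mono) auto
  thus ?thesis using dense by blast
qed

lemma standard_elements_induct:
  assumes "\<And>\<mu> a \<nu>. P (word_prod S \<mu> * \<iota> a * star (word_prod S \<nu>))"
    and "subspace {x. P x}" and "closed {x. P x}"
  shows "P x"
proof -
  have "span standard_elements \<subseteq> {x. P x}"
    using assms(1,2) by (intro span_minimal) (auto simp: standard_elements_def)
  hence "closure (span standard_elements) \<subseteq> {x. P x}" using assms(3) by (rule closure_minimal)
  thus ?thesis using closure_span_standard_elements by blast
qed

text \<open>\<open>kms_formula\<close> expresses both states on a dense span through the same
  trace.\<close>

lemma KMS_on_generators_eqI: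
  assumes "KMS_on_generators \<iota> S \<beta> \<psi>" "KMS_on_generators \<iota> S \<beta> \<psi>'"
    and "defect_trace \<psi> = defect_trace \<psi>'"
  shows "\<psi> = \<psi>'"
proof
  fix x
  have \<psi>: "is_state \<psi>" "is_state \<psi>'" using assms by (simp_all add: KMS_on_generators_def)
  show "\<psi> x = \<psi>' x"
  proof (rule standard_elements_induct)
    show "\<psi> (word_prod S \<mu> * \<iota> a * star (word_prod S \<nu>)) =
        \<psi>' (word_prod S \<mu> * \<iota> a * star (word_prod S \<nu>))" for \<mu> a \<nu>
      by (simp only: kms_formula [OF assms(1)] kms_formula [OF assms(2)] assms(3))
    show "subspace {x. \<psi> x = \<psi>' x}"
      by (simp add: subspace_def is_stateD(1,4,7) [OF \<psi>(1)] is_stateD(1,4,7) [OF \<psi>(2)])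
    show "closed {x. \<psi> x = \<psi>' x}"
      by (intro closed_Collect_eq continuous_on_state \<psi> continuous_on_id)
  qed
qed

text \<open>The choice is immaterial: by \<open>KMS_on_generators_eqI\<close> the trace determines
  the state.\<close>

definition KMS_state_of_trace :: "('a \<Rightarrow> complex) \<Rightarrow> 'b \<Rightarrow> complex" where
  "KMS_state_of_trace \<tau> =
     (SOME \<psi>. KMS_on_generators \<iota> S \<beta> \<psi> \<and> (\<forall>a. \<psi> (\<iota> a * defect) = of_real c * \<tau> a))"

lemma KMS_state_of_trace:
  assumes "\<tau> \<in> vanishing_tracial_states \<alpha>"
  shows "KMS_on_generators \<iota> S \<beta> (KMS_state_of_trace \<tau>)"
    "defect_trace (KMS_state_of_trace \<tau>) = \<tau>"
proof -
  note * = someI_ex [OF KMS_state_of_trace_exists [OF assms], folded KMS_state_of_trace_def]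
  show kms: "KMS_on_generators \<iota> S \<beta> (KMS_state_of_trace \<tau>)" using * by (rule conjunct1)
  show "defect_trace (KMS_state_of_trace \<tau>) = \<tau>"
    using conjunct2 [OF *] c_pos by (simp add: defect_trace_def [OF kms] fun_eq_iff)
qed

lemma KMS_state_of_trace_defect_trace:
  assumes "KMS_on_generators \<iota> S \<beta> \<psi>"
  shows "KMS_state_of_trace (defect_trace \<psi>) = \<psi>"
  using KMS_state_of_trace [OF defect_trace_vanishing [OF assms]] assms
  by (intro KMS_on_generators_eqI)

text \<open>A convex combination of KMS states is KMS and its trace is the combination of the
  traces; uniqueness identifies it.\<close>

lemma affine_KMS_state_of_trace:
  "affine_map_on (vanishing_tracial_states \<alpha>) KMS_state_of_trace"
  unfolding affine_map_on_def
proof (intro ballI)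
  fix f g and s :: real
  assume f: "f \<in> vanishing_tracial_states \<alpha>" and g: "g \<in> vanishing_tracial_states \<alpha>"
    and s: "s \<in> {0..1}"
  let ?m = "\<lambda>x. of_real s * f x + of_real (1 - s) * g x"
  let ?\<psi> = "\<lambda>y. of_real s * KMS_state_of_trace f y + of_real (1 - s) * KMS_state_of_trace g y"
  note kf = KMS_state_of_trace(1) [OF f] and kg = KMS_state_of_trace(1) [OF g]
  have "is_state ?\<psi>" using kf kg s by (intro is_state_convex) (auto simp: KMS_on_generators_def)
  moreover have "?\<psi> (\<iota> a * y) = ?\<psi> (y * \<iota> a)" for a y
    by (simp only: kms_iota [OF kf] kms_iota [OF kg])
  moreover have "?\<psi> (S i * y) = of_real (exp (- \<beta>)) * ?\<psi> (y * S i)" for i y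
    by (simp add: kms_S [OF kf] kms_S [OF kg] algebra_simps)
  ultimately have k: "KMS_on_generators \<iota> S \<beta> ?\<psi>" by (simp only: KMS_on_generators_def) blast
  have "defect_trace ?\<psi> a = of_real s * defect_trace (KMS_state_of_trace f) a +
      of_real (1 - s) * defect_trace (KMS_state_of_trace g) a" for a
    by (simp only: defect_trace_def [OF k] defect_trace_def [OF kf] defect_trace_def [OF kg])
       (simp add: add_divide_distrib)
  hence "defect_trace ?\<psi> = ?m"
    by (simp only: KMS_state_of_trace(2) [OF f] KMS_state_of_trace(2) [OF g] fun_eq_iff) simp
  thus "KMS_state_of_trace ?m = ?\<psi>" using KMS_state_of_trace_defect_trace [OF k] by simp
qed

text \<open>The elements at which evaluation is continuous in \<tau> form a closed real subspace,
  which reduces the claim to the terms of the series.\<close>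

lemma continuous_on_KMS_state_of_trace:
  "continuous_on (vanishing_tracial_states \<alpha>) KMS_state_of_trace"
proof (rule continuous_on_coordinatewise_then_product)
  fix x
  let ?K = "vanishing_tracial_states \<alpha>"
  have kms: "KMS_on_generators \<iota> S \<beta> (KMS_state_of_trace \<tau>)" and st: "is_state (KMS_state_of_trace \<tau>)"
    if "\<tau> \<in> ?K" for \<tau>
    using KMS_state_of_trace(1) [OF that] by (simp_all add: KMS_on_generators_def)
  show "continuous_on ?K (\<lambda>\<tau>. KMS_state_of_trace \<tau> x)"
  proof (rule standard_elements_induct)
    fix \<mu> \<nu> :: "'d list" and a
    let ?f = "\<lambda>m \<tau>. complex_of_real (exp (- (real (m + length \<mu>) * \<beta>))) *
        (\<Sum>w\<in>{w :: 'd list. length w = m}. \<tau> (word_endo \<alpha> (rev w) a))"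
    have coord: "continuous_on ?K (\<lambda>\<tau>. \<tau> b)" for b
      by (rule continuous_on_subset [OF continuous_on_product_coordinates]) simp
    \<comment> \<open>Every \<tau> is bounded by the norm, so the geometric majorant is uniform in
      \<tau>.\<close>
    have "uniform_limit ?K (\<lambda>n \<tau>. \<Sum>m<n. ?f m \<tau>) (\<lambda>\<tau>. suminf (\<lambda>m. ?f m \<tau>)) sequentially"
    proof (rule Weierstrass_m_test)
      fix m \<tau> assume "\<tau> \<in> ?K"
      hence "is_state \<tau>" by (simp add: vanishing_tracial_states_def is_tracial_state_def)
      hence "cmod (\<tau> (word_endo \<alpha> (rev w) a)) \<le> norm a" for w
        by (rule is_state_le [OF is_state_compose [OF _ word_endo_hom]])
      hence "cmod (\<Sum>w\<in>{w :: 'd list. length w = m}. \<tau> (word_endo \<alpha> (rev w) a)) \<le>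
          of_nat (card {w :: 'd list. length w = m}) * norm a"
        by (intro sum_norm_bound)
      hence "exp (- (real (m + length \<mu>) * \<beta>)) *
          cmod (\<Sum>w\<in>{w :: 'd list. length w = m}. \<tau> (word_endo \<alpha> (rev w) a)) \<le>
          exp (- (real m * \<beta>)) * (real CARD('d) ^ m * norm a)"
        using beta_pos by (intro mult_mono) (simp_all add: card_words sum_nonneg)
      also have "exp (- (real m * \<beta>)) = exp (- \<beta>) ^ m" by (simp flip: exp_of_nat_mult)
      finally show "norm (?f m \<tau>) \<le> (real CARD('d) * exp (- \<beta>)) ^ m * norm a"
        by (simp only: norm_mult norm_of_real abs_exp_cancel power_mult_distrib) (simp add: mult_ac)
    next
      show "summable (\<lambda>m. (real CARD('d) * exp (- \<beta>)) ^ m * norm a)"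
        using card_exp_less_1 by (intro summable_mult2 summable_geometric) simp
    qed
    moreover have "\<forall>n. continuous_on ?K (\<lambda>\<tau>. \<Sum>m<n. ?f m \<tau>)"
      by (intro allI continuous_on_sum continuous_on_mult continuous_on_const coord)
    ultimately have "continuous_on ?K (\<lambda>\<tau>. suminf (\<lambda>m. ?f m \<tau>))"
      by (intro uniform_limit_theorem [OF always_eventually _ trivial_limit_sequentially])
    hence "continuous_on ?K (\<lambda>\<tau>. (if \<mu> = \<nu> then 1 else 0) * complex_of_real c * suminf (\<lambda>m. ?f m \<tau>))"
      by (intro continuous_intros)
    thus "continuous_on ?K (\<lambda>\<tau>. KMS_state_of_trace \<tau> (word_prod S \<mu> * \<iota> a * star (word_prod S \<nu>)))"
      by (rule continuous_on_eq) (simp add: kms_formula [OF kms] KMS_state_of_trace(2))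
  next
    show "subspace {x. continuous_on ?K (\<lambda>\<tau>. KMS_state_of_trace \<tau> x)}"
      unfolding subspace_def
    proof (safe)
      show "continuous_on ?K (\<lambda>\<tau>. KMS_state_of_trace \<tau> 0)"
        by (rule continuous_on_eq [OF continuous_on_const [of _ 0]]) (simp add: is_stateD(4) [OF st])
    next
      fix x y
      assume "continuous_on ?K (\<lambda>\<tau>. KMS_state_of_trace \<tau> x)" "continuous_on ?K (\<lambda>\<tau>. KMS_state_of_trace \<tau> y)"
      from continuous_on_add [OF this] show "continuous_on ?K (\<lambda>\<tau>. KMS_state_of_trace \<tau> (x + y))"
        by (rule continuous_on_eq) (simp add: is_stateD(1) [OF st])
    next
      fix r x
      assume "continuous_on ?K (\<lambda>\<tau>. KMS_state_of_trace \<tau> x)"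
      from continuous_on_mult_left [OF this, of "of_real r"]
      show "continuous_on ?K (\<lambda>\<tau>. KMS_state_of_trace \<tau> (r *\<^sub>R x))"
        by (rule continuous_on_eq) (simp add: is_stateD(7) [OF st])
    qed
  next
    show "closed {x. continuous_on ?K (\<lambda>\<tau>. KMS_state_of_trace \<tau> x)}"
      unfolding closed_sequential_limits
    proof (safe)
      fix y z
      assume cont: "\<forall>n. y n \<in> {x. continuous_on ?K (\<lambda>\<tau>. KMS_state_of_trace \<tau> x)}" and lim: "y \<longlonglongrightarrow> z"
      \<comment> \<open>All values of the map are states, so norm convergence of \<open>y\<close> is
        uniform in \<tau>.\<close>
      have "uniform_limit ?K (\<lambda>n \<tau>. KMS_state_of_trace \<tau> (y n)) (\<lambda>\<tau>. KMS_state_of_trace \<tau> z) sequentially"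
      proof (rule uniform_limitI)
        fix e :: real assume "e > 0"
        with lim have "\<forall>\<^sub>F n in sequentially. dist (y n) z < e" by (simp add: tendsto_iff)
        thus "\<forall>\<^sub>F n in sequentially. \<forall>\<tau>\<in>?K. dist (KMS_state_of_trace \<tau> (y n)) (KMS_state_of_trace \<tau> z) < e"
        proof (rule eventually_mono, intro ballI)
          fix n \<tau> assume "dist (y n) z < e" "\<tau> \<in> ?K"
          thus "dist (KMS_state_of_trace \<tau> (y n)) (KMS_state_of_trace \<tau> z) < e"
            using is_state_le [OF st, of \<tau> "y n - z"]
            by (simp add: dist_norm is_stateD(6) [OF st])
        qed
      qed
      thus "continuous_on ?K (\<lambda>\<tau>. KMS_state_of_trace \<tau> z)"
        using cont [unfolded mem_Collect_eq]
        by (intro uniform_limit_theorem [OF always_eventually _ trivial_limit_sequentially])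
    qed
  qed
qed

text \<open>Each coordinate of the inverse \<open>defect_trace\<close> is evaluation at
  \<open>\<iota> a * defect\<close> divided by \<open>c\<close>, hence continuous for pointwise
  convergence.\<close>

lemma homeomorphic_KMS_state_of_trace:
  "homeomorphic_map (weak_star_topology (vanishing_tracial_states \<alpha>))
     (weak_star_topology {\<psi>. KMS_state \<sigma> \<beta> \<psi>}) KMS_state_of_trace"
proof -
  have "continuous_on (Collect (KMS_on_generators \<iota> S \<beta>)) (\<lambda>\<psi>. defect_trace \<psi> a)" for a
  proof -
    have "continuous_on (Collect (KMS_on_generators \<iota> S \<beta>)) (\<lambda>\<psi>. \<psi> (\<iota> a * defect) / of_real c)"
      using c_pos
      by (intro continuous_on_divide continuous_on_const
          continuous_on_subset [OF continuous_on_product_coordinates]) auto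
    thus ?thesis by (rule continuous_on_eq) (simp add: defect_trace_def)
  qed
  hence "continuous_on (Collect (KMS_on_generators \<iota> S \<beta>)) defect_trace"
    by (rule continuous_on_coordinatewise_then_product)
  hence "homeomorphic_maps (top_of_set (vanishing_tracial_states \<alpha>))
      (top_of_set (Collect (KMS_on_generators \<iota> S \<beta>))) KMS_state_of_trace defect_trace"
    unfolding homeomorphic_maps_def
    using continuous_on_KMS_state_of_trace KMS_state_of_trace KMS_state_of_trace_defect_trace
      defect_trace_vanishing
    by (auto simp: continuous_map_subtopology_eu)
  thus ?thesis
    unfolding weak_star_topology_def KMS_state_iff homeomorphic_map_maps by blast
qed

end

theorem theorem3p6:
  fixes \<alpha> :: "'d::finite \<Rightarrow> 'a \<Rightarrow> 'a::cstar_algebra"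
    and \<iota> :: "'a \<Rightarrow> 'b::cstar_algebra"
    and S :: "'d \<Rightarrow> 'b"
    and \<gamma> :: "complex \<Rightarrow> 'b \<Rightarrow> 'b"
    and \<sigma> :: "real \<Rightarrow> 'b \<Rightarrow> 'b"
    and \<beta> :: real
  assumes "cstar_dynamical_system \<alpha>"
    and "cuntz_pimsner_algebra \<alpha> \<iota> S"
    and "gauge_action \<iota> S \<gamma>"
    and "\<And>t. \<sigma> t = \<gamma> (exp (\<i> * complex_of_real t))"
    and "\<beta> > ln (real CARD('d))"
  shows "\<exists>\<Phi> :: ('a \<Rightarrow> complex) \<Rightarrow> ('b \<Rightarrow> complex).
      homeomorphic_map (weak_star_topology (vanishing_tracial_states \<alpha>))
                       (weak_star_topology {\<psi>. KMS_state \<sigma> \<beta> \<psi>}) \<Phi> \<and>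
      affine_map_on (vanishing_tracial_states \<alpha>) \<Phi> \<and>
      (\<forall>\<tau>\<in>vanishing_tracial_states \<alpha>. \<forall>a \<mu> \<nu>.
         \<Phi> \<tau> (word_prod S \<mu> * \<iota> a * star (word_prod S \<nu>)) =
         (if \<mu> = \<nu> then 1 else 0) *
         complex_of_real (1 - exp (- \<beta>) * real CARD('d)) *
         suminf (\<lambda>m. complex_of_real (exp (- (real (m + length \<mu>) * \<beta>))) *
               (\<Sum>w\<in>{w :: 'd list. length w = m}. \<tau> (word_endo \<alpha> (rev w) a))))"
proof -
  interpret cuntz_pimsner_gauge \<alpha> \<iota> S \<gamma> \<sigma> \<beta> "1 - exp (- \<beta>) * real CARD('d)"
    by unfold_locales (rule assms refl)+
  have "KMS_state_of_trace \<tau> (word_prod S \<mu> * \<iota> a * star (word_prod S \<nu>)) =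
      (if \<mu> = \<nu> then 1 else 0) *
      complex_of_real (1 - exp (- \<beta>) * real CARD('d)) *
      suminf (\<lambda>m. complex_of_real (exp (- (real (m + length \<mu>) * \<beta>))) *
            (\<Sum>w\<in>{w :: 'd list. length w = m}. \<tau> (word_endo \<alpha> (rev w) a)))"
    if "\<tau> \<in> vanishing_tracial_states \<alpha>" for \<tau> a \<mu> \<nu>
    using kms_formula [OF KMS_state_of_trace(1) [OF that]]
    by (simp only: KMS_state_of_trace(2) [OF that])
  with homeomorphic_KMS_state_of_trace affine_KMS_state_of_trace show ?thesis by blast
qed

end
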